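(* Let $p=p(n)\in(0,1)$ be a sequence with $p\gg n^{-2}$ and $\limsup_{n\to\infty}p<1$. Let $K_{n,p}$ denote either (i) the number of edges of the random symmetric edge polytope $P_{n,p}$, or (ii) the number of edges appearing in any unimodular triangulation of $P_{n,p}$. In case (i), assume additionally that $1/\sqrt{2}$ is not an accumulation point of the sequence $p=p(n)$. Then, as $n\to\infty$, the following statements hold. (a) The expectation and the variance satisfy $$\mathbb{E}[K_{n,p}]\simeq n^4p^2\qquad\text{and}\qquad \mathbb{V}(K_{n,p})\simeq n^6p^3 .$$ (b) The normalized random variable satisfies a central limit theorem, that is, $$\frac{K_{n,p}-\mathbb{E}[K_{n,p}]}{\sqrt{\mathbb{V}(K_{n,p})}}\xrightarrow{d}\mathcal{N}(0,1),$$ where $\xrightarrow{d}\mathcal{N}(0,1)$ denotes convergence in distribution to a standard Gaussian random variable.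
   Context: Graphs: for a finite simple graph $G=(V,E)$ the elements of $V$ are called nodes and the elements of $E\subseteq\binom{V}{2}$ arcs. With $(\mathbf{e}_i)_{i\in V}$ the standard basis of $\mathbb{R}^V$, the symmetric edge polytope of $G$ is $P_G:=\operatorname{conv}\{\pm(\mathbf{e}_i-\mathbf{e}_j):\{i,j\}\in E\}\subset\mathbb{R}^V$ (empty if $E=\emptyset$). A face of a polytope is its intersection with a supporting hyperplane; the polytope itself is not regarded as a face. Edges of a polytope are its $1$-dimensional faces (so if $G$ has exactly one arc, $P_G$ has no edges). A (lattice) triangulation of a $d$-dimensional lattice polytope $P$ is a subdivision of $P$ into $d$-dimensional lattice simplices with union $P$, any two of which meet in a (possibly empty) common face. It is unimodular if every $d$-simplex in it is lattice equivalent (with respect to the lattice $\mathbb{Z}^V\cap\operatorname{aff}(P)$) to the standard simplex spanned by the origin and the standard unit vectors, i.e. has normalized minimal volume. The edges of a triangulation are the $1$-dimensional elements of the simplicial complex consisting of its simplices and all their faces. It is known that every $P_G$ has a unimodular triangulation, and that all unimodular triangulations of a given lattice polytope have the same number of edges, so the number in (ii) is well defined. Randomness: $G_{n,p}$ is the Erdős–Rényi random graph on node set $[n]=\{1,\dots,n\}$, where each arc of the complete graph is retained independently with probability $p=p(n)\in(0,1)$; $P_{n,p}:=P_{G_{n,p}}$. $\mathbb{V}$ denotes variance. Asymptotic notation for sequences: $a_n\simeq b_n$ means $0<\liminf|a_n/b_n|\le\limsup|a_n/b_n|<\infty$; $a_n\gg b_n$ means $\liminf|a_n/b_n|=\infty$.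 That $1/\sqrt2$ is not an accumulation point of $p$ means that no subsequence of $p(n)$ converges to $1/\sqrt2$, i.e. $\liminf_n|p(n)-1/\sqrt2|>0$. *)

theory Defs
  imports
    "HOL-Probability.Probability"
    "HOL-Analysis.Finite_Function_Topology"
begin

text \<open>
  Since the node set \<open>[n]\<close> varies with \<open>n\<close>, the spaces \<open>\<real>\<^sup>V\<close> for finite \<open>V \<subseteq> \<nat>\<close> are all realised as
  subspaces of the single real vector space \<open>nat \<Rightarrow>\<^sub>0 real\<close> of finitely supported functions.
  The library's \<open>aff_dim\<close>, \<open>exposed_face_of\<close>, \<open>simplex\<close> and \<open>triangulation\<close> require the
  class \<open>euclidean_space\<close>, of which this space is not an instance.
\<close>

type_synonym vec = "nat \<Rightarrow>\<^sub>0 real"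

definition real_space :: "nat set \<Rightarrow> vec set" where
  "real_space V = {x. Poly_Mapping.keys x \<subseteq> V}"

definition int_lattice :: "nat set \<Rightarrow> vec set" where
  "int_lattice V = {x \<in> real_space V. \<forall>i. Poly_Mapping.lookup x i \<in> \<int>}"

definition unit_vec :: "nat \<Rightarrow> vec" where
  "unit_vec i = Poly_Mapping.single i 1"


section \<open>Symmetric edge polytopes\<close>

definition all_arcs :: "nat set \<Rightarrow> nat set set" where
  "all_arcs V = {e. e \<subseteq> V \<and> card e = 2}"

definition symmetric_edge_polytope :: "nat set set \<Rightarrow> vec set" where
  "symmetric_edge_polytope E =
     convex hull {u. \<exists>i j. {i, j} \<in> E \<and>
       (u = unit_vec i - unit_vec j \<or> u = - (unit_vec i - unit_vec j))}"


section \<open>Faces and dimension\<close>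

text \<open>The defining property of the library's \<open>aff_dim\<close>; in particular \<open>{}\<close> has dimension \<open>-1\<close>.\<close>

definition has_aff_dim :: "'a::real_vector set \<Rightarrow> int \<Rightarrow> bool" where
  "has_aff_dim S d \<longleftrightarrow>
     (\<exists>B. finite B \<and> \<not> affine_dependent B \<and> affine hull B = affine hull S \<and> int (card B) = d + 1)"

text \<open>
  Nonempty proper faces: \<open>{x. f x = b}\<close> is a supporting hyperplane of \<open>P\<close>, and \<open>P\<close> is not a face
  of itself.  A linear functional on \<open>nat \<Rightarrow>\<^sub>0 real\<close> restricts to an arbitrary linear functional on
  \<open>real_space V\<close>; if the restriction vanishes, the intersection is \<open>{}\<close> or \<open>P\<close>.
\<close>

definition is_face :: "'a::real_vector set \<Rightarrow> 'a set \<Rightarrow> bool" where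
  "is_face F P \<longleftrightarrow>
     (\<exists>(f :: 'a \<Rightarrow> real) b. linear f \<and> (\<exists>x. f x \<noteq> 0) \<and> (\<forall>x\<in>P. f x \<le> b) \<and> F = P \<inter> {x. f x = b})
     \<and> F \<noteq> {} \<and> F \<noteq> P"

definition polytope_edges :: "'a::real_vector set \<Rightarrow> 'a set set" where
  "polytope_edges P = {F. is_face F P \<and> has_aff_dim F 1}"


section \<open>Unimodular triangulations\<close>

definition lattice_simplex :: "nat set \<Rightarrow> int \<Rightarrow> vec set \<Rightarrow> bool" where
  "lattice_simplex V d S \<longleftrightarrow>
     (\<exists>C. finite C \<and> C \<subseteq> int_lattice V \<and> \<not> affine_dependent C \<and> int (card C) = d + 1 \<and>
          S = convex hull C)"

text \<open>
  \<open>T\<close> is the set of maximal simplices.  The empty polytope (dimension \<open>-1\<close>) is triangulated by \<open>{}\<close>.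
\<close>

definition lattice_triangulation :: "nat set \<Rightarrow> vec set \<Rightarrow> vec set set \<Rightarrow> bool" where
  "lattice_triangulation V P T \<longleftrightarrow>
     finite T \<and>
     (\<exists>d. has_aff_dim P d \<and> (\<forall>S\<in>T. lattice_simplex V d S)) \<and>
     \<Union>T = P \<and>
     (\<forall>S\<in>T. \<forall>S'\<in>T. S \<noteq> S' \<longrightarrow> S \<inter> S' = {} \<or> (is_face (S \<inter> S') S \<and> is_face (S \<inter> S') S'))"

definition standard_simplex :: "nat \<Rightarrow> vec set" where
  "standard_simplex d = convex hull (insert 0 (unit_vec ` {1..d}))"

text \<open>
  Lattice equivalence of \<open>S\<close> to a standard simplex with respect to the lattice \<open>\<int>\<^sup>V \<inter> A\<close> in the affine
  space \<open>A\<close>: an affine bijection \<open>A \<rightarrow> \<real>\<^sup>d\<close> mapping the lattice onto \<open>\<int>\<^sup>d\<close> and \<open>S\<close> onto the standard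
  simplex.
\<close>

definition unimodular_simplex :: "nat set \<Rightarrow> vec set \<Rightarrow> vec set \<Rightarrow> bool" where
  "unimodular_simplex V A S \<longleftrightarrow>
     (\<exists>(d::nat) f c. linear f \<and>
        (let \<phi> = (\<lambda>x. f x + c) in
           bij_betw \<phi> A (real_space {1..d}) \<and>
           \<phi> ` (int_lattice V \<inter> A) = int_lattice {1..d} \<and>
           \<phi> ` S = standard_simplex d))"

definition unimodular_triangulation :: "nat set \<Rightarrow> vec set \<Rightarrow> vec set set \<Rightarrow> bool" where
  "unimodular_triangulation V P T \<longleftrightarrow>
     lattice_triangulation V P T \<and> (\<forall>S\<in>T. unimodular_simplex V (affine hull P) S)"

definition triangulation_edges :: "vec set set \<Rightarrow> vec set set" where
  "triangulation_edges T = {F. (\<exists>S\<in>T. F = S \<or> is_face F S) \<and> has_aff_dim F 1}"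


section \<open>Random graphs and asymptotics\<close>

definition random_graph :: "nat \<Rightarrow> real \<Rightarrow> nat set set pmf" where
  "random_graph n q =
     map_pmf (\<lambda>\<omega>. {e \<in> all_arcs {1..n}. \<omega> e})
       (Pi_pmf (all_arcs {1..n}) False (\<lambda>_. bernoulli_pmf q))"

definition same_order :: "(nat \<Rightarrow> real) \<Rightarrow> (nat \<Rightarrow> real) \<Rightarrow> bool" where
  "same_order a b \<longleftrightarrow>
     0 < liminf (\<lambda>n. ereal \<bar>a n / b n\<bar>) \<and> limsup (\<lambda>n. ereal \<bar>a n / b n\<bar>) < \<infinity>"

definition much_greater :: "(nat \<Rightarrow> real) \<Rightarrow> (nat \<Rightarrow> real) \<Rightarrow> bool" where
  "much_greater a b \<longleftrightarrow> liminf (\<lambda>n. ereal \<bar>a n / b n\<bar>) = \<infinity>"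

definition accumulation_point :: "(nat \<Rightarrow> real) \<Rightarrow> real \<Rightarrow> bool" where
  "accumulation_point a x \<longleftrightarrow> (\<exists>r. strict_mono r \<and> (a \<circ> r) \<longlonglongrightarrow> x)"

end

(*
  Each arc {a, b} yields the two vertices e_a - e_b and e_b - e_a, and a supporting functional on the
  polytope is a weighting of the nodes.  A pair of vertices coming from disjoint arcs ab, cd spans an
  edge unless ad and bc are arcs as well, so twice the number of edges of the polytope is
  Q - C + 2H + 2U, where Q, C, H count ordered pairs of disjoint arcs, rooted four-cycles and ordered
  cherries, and U <= min(H, n^2) collects the pairs of consecutive arcs.  In a unimodular
  triangulation the edges correspond, through their midpoints, to the sums u + w of two lattice
  points of the polytope that are not twice a lattice point; this gives
  Q - C/2 + 2H + 4|E| + 2U in the same way.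

  Expanding the subgraph counts in products of centred arc indicators, which are orthogonal, shows
  that both numbers are, up to an L2-error of smaller order than n^3 p^(3/2), equal to their mean plus
  a multiple of the centred number of arcs.  The multiple is 2(n-2)(n-3)p(1 - 2 g p^2) with g = 1
  for the polytope and g = 1/2 for the triangulation, whence the special role of 1/sqrt 2.  The
  remaining binomial sum is treated with characteristic functions.
*)

theory Submission
  imports Defs
begin

section \<open>Convex position and edges\<close>

text \<open>What resists exact counting is U: whether two consecutive arrows span an edge depends on
  the rest of the graph, so U is not a subgraph count. It is never expanded; the bounds H, of mean
  order n^3 p^2, and n^2 make E[U^2] of smaller order than n^6 p^3 for sparse and for dense graphs
  alike. For the other terms the error is read off from the number of copies through a given set of
  arcs: one arc lies in order n^2 of the tuples counted by Q and C, two distinct arcs in a bounded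
  number (Q) or in order n (C), so that only the linear part survives. Fixing an arc of a four-cycle
  allows twice as many copies as fixing an arc of a pair, and leaves p^3 instead of p; this is the
  factor 1 - 2 g p^2. For g = 1/2 it stays away from 0 as soon as p stays away from 1. Since p
  varies with n, the limit law is obtained from explicit error bounds: the characteristic function
  of the normalised arc count is compared with (1 - t^2/(2N))^N, N being the number of possible
  arcs, and Levy's continuity theorem finishes.\<close>

definition convex_position :: "'a::real_vector set \<Rightarrow> bool" where
  "convex_position C \<longleftrightarrow> (\<forall>c\<in>C. c \<notin> convex hull (C - {c}))"

lemma convex_position_subset:
  assumes "convex_position C" "W \<subseteq> C"
  shows "convex_position W"
  unfolding convex_position_def
proof
  fix c assume c: "c \<in> W"
  have "convex hull (W - {c}) \<subseteq> convex hull (C - {c})"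
    using assms(2) by (intro hull_mono) auto
  with assms c show "c \<notin> convex hull (W - {c})"
    unfolding convex_position_def by blast
qed

text \<open>Brings the vertices of a lattice simplex under the same treatment as the arrows, which
  are in convex position but as a rule affinely dependent.\<close>

lemma affine_independent_convex_position:
  assumes "\<not> affine_dependent C"
  shows "convex_position C"
proof -
  have "convex hull (C - {c}) \<subseteq> affine hull (C - {c})" for c
    by (rule convex_hull_subset_affine_hull)
  with assms show ?thesis
    unfolding convex_position_def affine_dependent_def by blast
qed

lemma convex_position_hull_Int:
  assumes "convex_position C" "W \<subseteq> C"
  shows "convex hull W \<inter> C = W"
proof
  show "convex hull W \<inter> C \<subseteq> W"
  proof
    fix x assume x: "x \<in> convex hull W \<inter> C"
    show "x \<in> W"
    proof (rule ccontr)
      assume "x \<notin> W"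
      hence "W \<subseteq> C - {x}" using assms(2) by auto
      hence "convex hull W \<subseteq> convex hull (C - {x})" by (rule hull_mono)
      with x assms(1) show False unfolding convex_position_def by blast
    qed
  qed
  show "W \<subseteq> convex hull W \<inter> C" using assms(2) hull_subset by fastforce
qed

text \<open>A subset is recovered from its hull by intersecting with the whole set, so counting
  faces reduces to counting vertex sets.\<close>

lemma convex_hull_inj_on_convex_position:
  assumes "convex_position C"
  shows "inj_on (\<lambda>W. convex hull W) (Pow C)"
  by (rule inj_onI) (metis assms convex_position_hull_Int PowD)

lemma has_aff_dim_pair:
  assumes "u \<noteq> w"
  shows "has_aff_dim (convex hull {u, w}) 1"
  unfolding has_aff_dim_def
  by (rule exI[of _ "{u, w}"]) (use assms in simp)

lemma middle_point:
  fixes x y :: "'a::real_vector"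
  assumes "a \<le> b" "b \<le> c"
  shows "x + b *\<^sub>R y \<in> convex hull {x + a *\<^sub>R y, x + c *\<^sub>R y}"
proof (cases "a = c")
  case True
  then show ?thesis using assms by (auto simp: hull_inc)
next
  case False
  define t where "t = (b - a) / (c - a)"
  have t: "0 \<le> t" "t \<le> 1" using assms False by (auto simp: t_def field_simps)
  have b: "b = (1 - t) * a + t * c" using assms False
  proof -
    have "t * (c - a) = b - a" using assms False by (simp add: t_def)
    thus ?thesis by (simp add: algebra_simps)
  qed
  have "x + b *\<^sub>R y = (1 - t) *\<^sub>R (x + a *\<^sub>R y) + t *\<^sub>R (x + c *\<^sub>R y)"
    unfolding b by (simp add: algebra_simps scaleR_left.diff)
  thus ?thesis unfolding convex_hull_2 using t by (intro CollectI exI[of _ "1 - t"] exI[of _ t]) auto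
qed

text \<open>Of three points on a line one lies between the other two, hence in their hull; convex
  position leaves at most two points.\<close>

lemma convex_position_dim_1:
  assumes fin: "finite C" and C: "convex_position C" and dim: "has_aff_dim (convex hull C) 1"
  shows "card C = 2"
proof -
  obtain B where B: "finite B" "affine hull B = affine hull C" "card B = 2"
    using dim unfolding has_aff_dim_def by auto
  then obtain x y where xy: "B = {x, y}" "x \<noteq> y" by (auto simp: card_2_iff)
  have line: "\<exists>s. c = x + s *\<^sub>R (y - x)" if "c \<in> C" for c
  proof -
    have "c \<in> affine hull {x, y}" using that B xy hull_inc by metis
    then obtain p q where pq: "c = p *\<^sub>R x + q *\<^sub>R y" "p + q = 1" unfolding affine_hull_2 by auto
    have p: "p = 1 - q" using pq(2) by simp
    have "c = x + q *\<^sub>R (y - x)" unfolding pq(1) p by (simp add: algebra_simps)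
    thus ?thesis ..
  qed
  then obtain s where "\<forall>c\<in>C. c = x + s c *\<^sub>R (y - x)" by (atomize_elim, intro bchoice) blast
  hence s: "\<And>c. c \<in> C \<Longrightarrow> x + s c *\<^sub>R (y - x) = c" by simp
  have mid: False if "u \<in> C" "v \<in> C" "w \<in> C" "u \<noteq> v" "v \<noteq> w" "s u \<le> s v" "s v \<le> s w" for u v w
  proof -
    have "v \<in> convex hull {u, w}"
      using middle_point[OF that(6,7), of x "y - x"] by (simp only: s that(1-3))
    moreover have "convex hull {u, w} \<subseteq> convex hull (C - {v})"
      using that by (intro hull_mono) auto
    ultimately show False using C that(2) unfolding convex_position_def by blast
  qed
  have "card C \<le> 2"
  proof (rule ccontr)
    assume "\<not> card C \<le> 2"
    hence "3 \<le> card C" by simp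
    then obtain W where "W \<subseteq> C" "card W = 3" by (meson obtain_subset_with_card_n)
    then obtain u v w where "u \<in> C" "v \<in> C" "w \<in> C" "u \<noteq> v" "v \<noteq> w" "u \<noteq> w"
      by (auto simp: card_3_iff)
    thus False
      using mid[of u v w] mid[of u w v] mid[of v u w] mid[of v w u] mid[of w u v] mid[of w v u]
      by (cases "s u \<le> s v"; cases "s v \<le> s w"; cases "s u \<le> s w") auto
  qed
  moreover have "card C \<noteq> 0"
  proof
    assume "card C = 0"
    hence "affine hull B = {}" using fin B by simp
    thus False using xy by simp
  qed
  moreover have "card C \<noteq> 1"
  proof
    assume "card C = 1"
    then obtain c where "C = {c}" by (auto simp: card_1_singleton_iff)
    hence "affine hull B = {c}" using B by simp
    moreover have "{x, y} \<subseteq> affine hull B" unfolding xy by (rule hull_subset)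
    ultimately show False using xy by auto
  qed
  ultimately show ?thesis by linarith
qed

text \<open>In a convex combination on the hyperplane the terms \<open>u c * (b - f c)\<close> are
  nonnegative and add up to 0, so only points on the hyperplane carry weight.\<close>

lemma convex_hull_Int_hyperplane:
  fixes f :: "'a::real_vector \<Rightarrow> real"
  assumes "finite C" "linear f" "\<forall>x\<in>C. f x \<le> b"
  shows "convex hull C \<inter> {x. f x = b} = convex hull {x\<in>C. f x = b}"
proof
  interpret linear f by fact
  show "convex hull C \<inter> {x. f x = b} \<subseteq> convex hull {x\<in>C. f x = b}"
  proof
    fix x assume "x \<in> convex hull C \<inter> {x. f x = b}"
    then obtain u where u: "\<forall>c\<in>C. 0 \<le> u c" "sum u C = 1" "x = (\<Sum>c\<in>C. u c *\<^sub>R c)" and fx: "f x = b"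
      using convex_hull_finite[OF assms(1)] by auto
    have "(\<Sum>c\<in>C. u c * (b - f c)) = b * sum u C - f x"
      by (simp add: u(3) sum scale algebra_simps sum_subtractf sum_distrib_left)
    also have "\<dots> = 0" using u fx by simp
    finally have "\<forall>c\<in>C. u c * (b - f c) = 0"
      using assms u by (subst (asm) sum_nonneg_eq_0_iff) (auto intro!: mult_nonneg_nonneg)
    hence z: "u c = 0" if "c \<in> C" "f c \<noteq> b" for c using that by auto
    have 1: "sum u {c\<in>C. f c = b} = 1"
      using u(2) z assms(1) by (subst (asm) sum.mono_neutral_right[of _ "{c\<in>C. f c = b}"]) auto
    have 2: "x = (\<Sum>c\<in>{c\<in>C. f c = b}. u c *\<^sub>R c)"
      unfolding u(3) using z assms(1) by (intro sum.mono_neutral_right) auto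
    show "x \<in> convex hull {x\<in>C. f x = b}"
      using convex_hull_finite[of "{x\<in>C. f x = b}"] assms(1) u(1) 1 2 by auto
  qed
  have "convex {x. f x = b}"
    by (auto simp: convex_def add scale) (metis distrib_right mult_1)
  hence "convex hull {x\<in>C. f x = b} \<subseteq> {x. f x = b}" by (intro hull_minimal) auto
  moreover have "convex hull {x\<in>C. f x = b} \<subseteq> convex hull C" by (intro hull_mono) auto
  ultimately show "convex hull {x\<in>C. f x = b} \<subseteq> convex hull C \<inter> {x. f x = b}" by auto
qed

lemma convex_hull_le_linear:
  fixes f :: "'a::real_vector \<Rightarrow> real"
  assumes "linear f" "\<forall>x\<in>C. f x \<le> b"
  shows "\<forall>x\<in>convex hull C. f x \<le> b"
proof -
  interpret linear f by fact
  have "convex {x. f x \<le> b}"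
    unfolding convex_def
    by (auto simp: add scale) (meson convex_bound_le)
  hence "convex hull C \<subseteq> {x. f x \<le> b}" using assms by (intro hull_minimal) auto
  thus ?thesis by auto
qed

text \<open>Vertex sets of edges. \<open>W \<noteq> C\<close> carries over that a polytope is not a
  face of itself: it rules out a polytope that is a segment, such as that of a graph with one
  arc.\<close>

definition exposed_pairs :: "'a::real_vector set \<Rightarrow> 'a set set" where
  "exposed_pairs C = {W. W \<subseteq> C \<and> W \<noteq> C \<and> card W = 2 \<and>
     (\<exists>(f :: 'a \<Rightarrow> real) b. linear f \<and> (\<forall>x\<in>C. f x \<le> b) \<and> W = {x\<in>C. f x = b})}"

lemma polytope_edges_convex_hull:
  assumes fin: "finite C" and C: "convex_position C"
  shows "polytope_edges (convex hull C) = (\<lambda>W. convex hull W) ` exposed_pairs C"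
proof (intro equalityI subsetI)
  fix F assume "F \<in> polytope_edges (convex hull C)"
  then obtain f :: "'a \<Rightarrow> real" and b where f: "linear f" "\<forall>x\<in>convex hull C. f x \<le> b"
    and F: "F = convex hull C \<inter> {x. f x = b}" "F \<noteq> {}" "F \<noteq> convex hull C" "has_aff_dim F 1"
    unfolding polytope_edges_def is_face_def mem_Collect_eq by (elim conjE exE) (rule that)
  define W where "W = {x\<in>C. f x = b}"
  have fC: "\<forall>x\<in>C. f x \<le> b" using f(2) by (simp add: hull_inc)
  have FW: "F = convex hull W"
    unfolding F W_def by (rule convex_hull_Int_hyperplane[OF fin f(1) fC])
  have W: "W \<subseteq> C" by (auto simp: W_def)
  have "card W = 2"
    using convex_position_dim_1[of W] F(4) FW W C convex_position_subset finite_subset[OF W fin] by metis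
  moreover have "W \<noteq> C" using F(3) FW by auto
  ultimately have "W \<in> exposed_pairs C"
    unfolding exposed_pairs_def using W f(1) fC W_def by blast
  thus "F \<in> (\<lambda>W. convex hull W) ` exposed_pairs C" using FW by blast
next
  fix F assume "F \<in> (\<lambda>W. convex hull W) ` exposed_pairs C"
  then obtain W f b where FW: "F = convex hull W" and W: "W \<subseteq> C" "W \<noteq> C" "card W = 2"
    and f: "linear (f :: 'a \<Rightarrow> real)" "\<forall>x\<in>C. f x \<le> b" "W = {x\<in>C. f x = b}"
    unfolding exposed_pairs_def by auto
  obtain u w where uw: "W = {u, w}" "u \<noteq> w" using W(3) by (auto simp: card_2_iff)
  \<comment> \<open>The functional separates \<open>u\<close> from a point outside \<open>W\<close>,
    so it is not zero, as \<open>is_face\<close> demands.\<close>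
  obtain c where c: "c \<in> C" "c \<notin> W" using W by auto
  have "u \<in> W" using uw by simp
  hence "f u = b" "f c \<noteq> b" using f(3) c by (simp_all add: f(3))
  hence "f u \<noteq> f c" by simp
  hence nz: "\<exists>x. f x \<noteq> 0" by metis
  have "F \<noteq> convex hull C"
    using convex_position_hull_Int[OF C W(1)] convex_position_hull_Int[OF C subset_refl] FW W(2) by metis
  moreover have "F = convex hull C \<inter> {x. f x = b}"
    unfolding FW convex_hull_Int_hyperplane[OF fin f(1,2)] by (simp only: f(3)[symmetric])
  moreover have "F \<noteq> {}" using FW uw by simp
  moreover have "has_aff_dim F 1" using FW uw has_aff_dim_pair by metis
  ultimately show "F \<in> polytope_edges (convex hull C)"
    unfolding polytope_edges_def is_face_def using f(1) nz convex_hull_le_linear[OF f(1,2)] by blast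
qed

lemma card_polytope_edges_convex_hull:
  assumes "finite C" "convex_position C"
  shows "card (polytope_edges (convex hull C)) = card (exposed_pairs C)"
  unfolding polytope_edges_convex_hull[OF assms]
  by (intro card_image inj_on_subset[OF convex_hull_inj_on_convex_position[OF assms(2)]])
    (auto simp: exposed_pairs_def)


section \<open>Edges of symmetric edge polytopes\<close>

definition arrow :: "nat \<Rightarrow> nat \<Rightarrow> vec" where
  "arrow a b = unit_vec a - unit_vec b"

abbreviation coord :: "vec \<Rightarrow> nat \<Rightarrow> real" where
  "coord \<equiv> Poly_Mapping.lookup"

text \<open>The linear functional with the value \<open>\<phi> i\<close> at
  \<open>unit_vec i\<close>. Summing over the support makes it total on the infinite index set,
  without reference to a node set.\<close>

definition weighting :: "(nat \<Rightarrow> real) \<Rightarrow> vec \<Rightarrow> real" where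
  "weighting \<phi> x = (\<Sum>i\<in>Poly_Mapping.keys x. coord x i * \<phi> i)"

lemma lookup_scaleR: "coord (r *\<^sub>R x) i = r * coord (x::vec) i"
proof -
  have "finite {i. r * coord x i \<noteq> 0}"
    by (rule finite_subset[OF _ finite_keys[of x]]) (auto simp: in_keys_iff)
  thus ?thesis by (simp add: scaleR_poly_mapping_def)
qed

lemma lookup_unit_vec: "coord (unit_vec a) i = (if a = i then 1 else 0)"
  by (simp add: unit_vec_def lookup_single when_def)

lemma lookup_arrow:
  "coord (arrow a b) i = (if a = i then 1 else 0) - (if b = i then 1 else 0)"
  by (simp add: arrow_def lookup_minus lookup_unit_vec)

lemma weighting_superset:
  assumes "finite S" "Poly_Mapping.keys x \<subseteq> S"
  shows "weighting \<phi> x = (\<Sum>i\<in>S. coord x i * \<phi> i)"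
  unfolding weighting_def
  using assms by (intro sum.mono_neutral_left) (auto simp: in_keys_iff)

lemma linear_weighting: "linear (weighting \<phi>)"
proof
  fix x y :: vec and r :: real
  let ?S = "Poly_Mapping.keys x \<union> Poly_Mapping.keys y"
  have "Poly_Mapping.keys (x + y) \<subseteq> ?S" by (rule Poly_Mapping.keys_add)
  thus "weighting \<phi> (x + y) = weighting \<phi> x + weighting \<phi> y"
    by (subst (1 2 3) weighting_superset[of ?S])
      (auto simp: lookup_add algebra_simps sum.distrib)
  have "Poly_Mapping.keys (r *\<^sub>R x) \<subseteq> Poly_Mapping.keys x" by (auto simp: in_keys_iff lookup_scaleR)
  thus "weighting \<phi> (r *\<^sub>R x) = r *\<^sub>R weighting \<phi> x"
    by (subst (1 2) weighting_superset[of "Poly_Mapping.keys x"])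
      (auto simp: lookup_scaleR sum_distrib_left algebra_simps)
qed

lemma weighting_unit_vec: "weighting \<phi> (unit_vec a) = \<phi> a"
  by (simp add: weighting_def unit_vec_def)

lemma weighting_arrow: "weighting \<phi> (arrow a b) = \<phi> a - \<phi> b"
  by (simp add: arrow_def linear_diff[OF linear_weighting] weighting_unit_vec)

lemma arrow_eq_iff:
  assumes "a \<noteq> b"
  shows "arrow a b = arrow c d \<longleftrightarrow> a = c \<and> b = d"
proof
  assume eq: "arrow a b = arrow c d"
  from arg_cong[OF eq, of "\<lambda>x. coord x a"] arg_cong[OF eq, of "\<lambda>x. coord x b"] assms
  show "a = c \<and> b = d" by (auto simp: lookup_arrow split: if_splits)
qed auto

lemma minus_arrow: "- arrow a b = arrow b a"
  by (simp add: arrow_def)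

text \<open>The factor 2 relates unordered pairs of vertices to ordered ones, and arcs to their two
  orientations.\<close>

lemma card_ordered_pairs:
  assumes "finite X" "\<And>W. W \<in> X \<Longrightarrow> card W = 2"
  shows "card {(u, w). u \<noteq> w \<and> {u, w} \<in> X} = 2 * card X"
proof -
  have "{(u, w). u \<noteq> w \<and> {u, w} \<in> X} = (\<Union>W\<in>X. {(u, w). u \<noteq> w \<and> {u, w} = W})" by auto
  also have "card \<dots> = (\<Sum>W\<in>X. card {(u, w). u \<noteq> w \<and> {u, w} = W})"
  proof (rule card_UN_disjoint)
    show "\<forall>W\<in>X. finite {(u, w). u \<noteq> w \<and> {u, w} = W}"
    proof
      fix W assume "W \<in> X"
      hence "finite W" using assms(2)[of W] card.infinite by force
      moreover have "{(u, w). u \<noteq> w \<and> {u, w} = W} \<subseteq> W \<times> W" by auto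
      ultimately show "finite {(u, w). u \<noteq> w \<and> {u, w} = W}" by (meson finite_SigmaI finite_subset)
    qed
  qed (use assms in auto)
  also have "\<dots> = (\<Sum>W\<in>X. 2)"
  proof (rule sum.cong)
    fix W assume "W \<in> X"
    then obtain x y where "W = {x, y}" "x \<noteq> y" using assms(2)[of W] by (auto simp: card_2_iff)
    hence "{(u, w). u \<noteq> w \<and> {u, w} = W} = {(x, y), (y, x)}" by (auto simp: doubleton_eq_iff)
    thus "card {(u, w). u \<noteq> w \<and> {u, w} = W} = 2" using \<open>x \<noteq> y\<close> by simp
  qed simp
  finally show ?thesis by simp
qed

lemma card_Un_disjoint5:
  assumes "finite A" "finite B" "finite C" "finite D" "finite F"
    and "A \<inter> B = {}" "A \<inter> C = {}" "A \<inter> D = {}" "A \<inter> F = {}" "B \<inter> C = {}" "B \<inter> D = {}" "B \<inter> F = {}"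
      "C \<inter> D = {}" "C \<inter> F = {}" "D \<inter> F = {}"
  shows "card (A \<union> B \<union> C \<union> D \<union> F) = card A + card B + card C + card D + card F"
  using assms by (simp add: card_Un_disjoint Int_Un_distrib2)

definition arrows :: "nat set set \<Rightarrow> vec set" where
  "arrows E = {u. \<exists>a b. {a, b} \<in> E \<and> u = arrow a b}"

lemma symmetric_edge_polytope_arrows: "symmetric_edge_polytope E = convex hull (arrows E)"
proof -
  have "{u. \<exists>i j. {i, j} \<in> E \<and> (u = unit_vec i - unit_vec j \<or> u = - (unit_vec i - unit_vec j))} = arrows E"
    unfolding arrows_def arrow_def by (auto simp: insert_commute) (metis insert_commute)
  thus ?thesis by (simp add: symmetric_edge_polytope_def)
qed

text \<open>Orientation is kept: the tuple stands for the ordered pair \<open>arrow a b\<close>,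
  \<open>arrow c d\<close>. An unordered pair of disjoint arcs therefore occurs eight times here, a
  four-cycle eight times in \<open>four_cycles\<close>, and a cherry twice in
  \<open>cherries\<close>.\<close>

definition arc_pairs :: "nat set set \<Rightarrow> (nat \<times> nat \<times> nat \<times> nat) set" where
  "arc_pairs E = {(a, b, c, d). {a, b} \<in> E \<and> {c, d} \<in> E \<and> distinct [a, b, c, d]}"

definition four_cycles :: "nat set set \<Rightarrow> (nat \<times> nat \<times> nat \<times> nat) set" where
  "four_cycles E = {(a, b, c, d). {a, b} \<in> E \<and> {b, c} \<in> E \<and> {c, d} \<in> E \<and> {d, a} \<in> E \<and> distinct [a, b, c, d]}"

definition cherries :: "nat set set \<Rightarrow> (nat \<times> nat \<times> nat) set" where
  "cherries E = {(a, b, c). {a, b} \<in> E \<and> {a, c} \<in> E \<and> distinct [a, b, c]}"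

locale graph =
  fixes E :: "nat set set" and V :: "nat set"
  assumes finite_V: "finite V" and arcs: "E \<subseteq> all_arcs V"
begin

lemma arc_neq: "{a, b} \<in> E \<Longrightarrow> a \<noteq> b"
  using arcs by (auto simp: all_arcs_def)

lemma arc_V: "{a, b} \<in> E \<Longrightarrow> a \<in> V \<and> b \<in> V"
  using arcs by (auto simp: all_arcs_def)

lemma arc_sym: "{a, b} \<in> E \<Longrightarrow> {b, a} \<in> E"
  by (simp add: insert_commute)

lemma finite_tuples:
  "finite (arc_pairs E)" "finite (four_cycles E)" "finite (cherries E)" "finite (arrows E)"
proof -
  show "finite (arc_pairs E)" "finite (four_cycles E)"
    by (rule finite_subset[of _ "V \<times> V \<times> V \<times> V"];
        auto simp: arc_pairs_def four_cycles_def finite_V dest: arc_V)+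
  show "finite (cherries E)"
    by (rule finite_subset[of _ "V \<times> V \<times> V"]) (auto simp: cherries_def finite_V dest: arc_V)
  have "arrows E \<subseteq> (\<lambda>(a, b). arrow a b) ` (V \<times> V)" by (auto simp: arrows_def dest: arc_V)
  thus "finite (arrows E)" using finite_V finite_subset by blast
qed

lemma convex_position_arrows: "convex_position (arrows E)"
  unfolding convex_position_def
proof
  fix c assume "c \<in> arrows E"
  then obtain a b where ab: "{a, b} \<in> E" "c = arrow a b" by (auto simp: arrows_def)
  have neq: "a \<noteq> b" using ab arc_neq by simp
  \<comment> \<open>Only the arrow from \<open>a\<close> to \<open>b\<close> drops by 2; every other
    arrow drops by at most 1.\<close>
  let ?\<phi> = "\<lambda>i. if i = a then 1 else if i = b then -1 else 0::real"
  have "\<forall>x\<in>arrows E - {c}. weighting ?\<phi> x \<le> 1"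
    using neq by (auto simp: arrows_def ab weighting_arrow split: if_splits)
  hence "\<forall>x\<in>convex hull (arrows E - {c}). weighting ?\<phi> x \<le> 1"
    by (rule convex_hull_le_linear[OF linear_weighting])
  moreover have "weighting ?\<phi> c = 2" using neq by (simp add: ab weighting_arrow)
  ultimately show "c \<notin> convex hull (arrows E - {c})" by force
qed

lemma arrow_in_arrows: "{a, b} \<in> E \<Longrightarrow> arrow a b \<in> arrows E"
  by (auto simp: arrows_def)

lemma uminus_arrows: "x \<in> arrows E \<Longrightarrow> - x \<in> arrows E"
  by (auto simp: arrows_def minus_arrow) (metis arc_sym)

text \<open>A functional that is maximal at \<open>u\<close> and \<open>w\<close> takes twice its
  maximum at \<open>u + w\<close>, so it must be maximal at both summands of any other decomposition
  into arrows.\<close>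

lemma exposed_pairs_swap:
  assumes W: "{u, w} \<in> exposed_pairs (arrows E)"
    and u': "u' \<in> arrows E" and w': "w' \<in> arrows E" and eq: "u + w = u' + w'"
  shows "u' \<in> {u, w}"
proof -
  obtain f :: "vec \<Rightarrow> real" and b where f: "linear f" "\<forall>x\<in>arrows E. f x \<le> b" "{u, w} = {x\<in>arrows E. f x = b}"
    using W unfolding exposed_pairs_def by auto
  have "f u = b" "f w = b" using f(3) by blast+
  hence "f u' + f w' = 2 * b"
    using arg_cong[OF eq, of f] by (simp add: linear_add[OF f(1)])
  moreover have "f u' \<le> b" "f w' \<le> b" using f(2) u' w' by auto
  ultimately have "f u' = b" by linarith
  thus ?thesis using u' f(3) by blast
qed

text \<open>Since the arrows are symmetric about the origin, the maximum \<open>b\<close> is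
  positive: if it were 0, all arrows would lie on the hyperplane. So \<open>u + w\<close> has the
  value \<open>2 * b\<close>, too large for an arrow or the origin.\<close>

lemma exposed_pairs_sum:
  assumes W: "{u, w} \<in> exposed_pairs (arrows E)"
  shows "u + w \<notin> arrows E" "u + w \<noteq> 0"
proof -
  obtain f :: "vec \<Rightarrow> real" and b where f: "linear f" "\<forall>x\<in>arrows E. f x \<le> b" "{u, w} = {x\<in>arrows E. f x = b}"
    and ne: "{u, w} \<noteq> arrows E"
    using W unfolding exposed_pairs_def by blast
  have uw: "f u = b" "f w = b" "u \<in> arrows E" using f(3) by blast+
  have neg: "- b \<le> b" using f(2) uminus_arrows[OF uw(3)] linear_neg[OF f(1), of u] uw(1) by fastforce
  have "b \<noteq> 0"
  proof
    assume b: "b = 0"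
    have "f x = b" if "x \<in> arrows E" for x
      using bspec[OF f(2) that] bspec[OF f(2) uminus_arrows[OF that]] linear_neg[OF f(1), of x] b by simp
    hence "{x\<in>arrows E. f x = b} = arrows E" by auto
    thus False using ne f(3) by simp
  qed
  hence b: "b > 0" using neg by simp
  have fuw: "f (u + w) = 2 * b" using uw linear_add[OF f(1)] by simp
  show "u + w \<notin> arrows E" using f(2) fuw b by fastforce
  show "u + w \<noteq> 0" using fuw b linear_0[OF f(1)] by auto
qed

text \<open>The maximum is normalised to 1. The reverse of an arrow on the hyperplane has the value
  -1, so the hyperplane never contains all arrows.\<close>

lemma exposed_pairsI:
  assumes "{a, b} \<in> E" "{c, d} \<in> E" "(a, b) \<noteq> (c, d)"
    and "\<phi> a - \<phi> b = (1::real)" "\<phi> c - \<phi> d = 1"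
    and lt: "\<And>x y. {x, y} \<in> E \<Longrightarrow> (x, y) \<noteq> (a, b) \<Longrightarrow> (x, y) \<noteq> (c, d) \<Longrightarrow> \<phi> x - \<phi> y < 1"
  shows "{arrow a b, arrow c d} \<in> exposed_pairs (arrows E)"
proof -
  let ?f = "weighting \<phi>"
  have le: "\<forall>x\<in>arrows E. ?f x \<le> 1"
  proof
    fix x assume "x \<in> arrows E"
    then obtain i j where "{i, j} \<in> E" "x = arrow i j" by (auto simp: arrows_def)
    thus "?f x \<le> 1" using lt[of i j] assms(4,5) by (cases "(i, j) = (a, b) \<or> (i, j) = (c, d)") (auto simp: weighting_arrow)
  qed
  have eq: "{arrow a b, arrow c d} = {x\<in>arrows E. ?f x = 1}"
  proof
    show "{arrow a b, arrow c d} \<subseteq> {x\<in>arrows E. ?f x = 1}"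
      using assms by (auto simp: weighting_arrow arrow_in_arrows)
    show "{x\<in>arrows E. ?f x = 1} \<subseteq> {arrow a b, arrow c d}"
    proof
      fix x assume "x \<in> {x\<in>arrows E. ?f x = 1}"
      then obtain i j where "{i, j} \<in> E" "x = arrow i j" "\<phi> i - \<phi> j = 1" 
        by (auto simp: arrows_def weighting_arrow)
      thus "x \<in> {arrow a b, arrow c d}" using lt[of i j] by auto
    qed
  qed
  have ne: "{arrow a b, arrow c d} \<noteq> arrows E"
  proof
    assume "{arrow a b, arrow c d} = arrows E"
    hence "arrow b a \<in> {x\<in>arrows E. ?f x = 1}"
      using eq arrow_in_arrows[OF arc_sym[OF assms(1)]] by simp
    thus False using assms(4) by (simp add: weighting_arrow)
  qed
  have "card {arrow a b, arrow c d} = 2"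
    using assms(3) arrow_eq_iff[OF arc_neq[OF assms(1)], of c d] by simp
  moreover have "{arrow a b, arrow c d} \<subseteq> arrows E" using assms by (auto simp: arrow_in_arrows)
  ultimately show ?thesis
    unfolding exposed_pairs_def using ne le eq linear_weighting by blast
qed

text \<open>The only obstruction is the identity
  \<open>arrow a b + arrow c d = arrow a d + arrow c b\<close>, which is a second decomposition
  exactly when both crossing arcs are present.\<close>

lemma exposed_disjoint_iff:
  assumes "(a, b, c, d) \<in> arc_pairs E"
  shows "{arrow a b, arrow c d} \<in> exposed_pairs (arrows E) \<longleftrightarrow> (a, b, c, d) \<notin> four_cycles E"
proof -
  have ab: "{a, b} \<in> E" "{c, d} \<in> E" "a \<noteq> b" "a \<noteq> c" "a \<noteq> d" "b \<noteq> c" "b \<noteq> d" "c \<noteq> d"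
    using assms by (auto simp: arc_pairs_def)
  have one: "{arrow a b, arrow c d} \<in> exposed_pairs (arrows E)"
    if "{a, b} \<in> E" "{c, d} \<in> E" "a \<noteq> b" "a \<noteq> c" "a \<noteq> d" "b \<noteq> c" "b \<noteq> d" "c \<noteq> d" "{a, d} \<notin> E" for a b c d
    \<comment> \<open>The drops from \<open>a\<close> to \<open>b\<close> and from \<open>c\<close>
      to \<open>d\<close> are 1. The only larger one, 3/2 from \<open>a\<close> to \<open>d\<close>,
      is not along an arc, and all remaining ones are at most 3/4.\<close>
    by (rule exposed_pairsI[where \<phi> = "\<lambda>i. if i = a then 5/4 else if i = b then 1/4 else
            if i = c then 3/4 else if i = d then -1/4 else 1/2"]) (use that in auto)
  show ?thesis
  proof
    assume W: "{arrow a b, arrow c d} \<in> exposed_pairs (arrows E)"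
    show "(a, b, c, d) \<notin> four_cycles E"
    proof
      assume "(a, b, c, d) \<in> four_cycles E"
      hence "{a, d} \<in> E" "{c, b} \<in> E" by (auto simp: four_cycles_def insert_commute)
      moreover have "arrow a b + arrow c d = arrow a d + arrow c b" by (simp add: arrow_def)
      ultimately have "arrow a d \<in> {arrow a b, arrow c d}"
        using exposed_pairs_swap[OF W] arrow_in_arrows by blast
      thus False using ab by (auto simp: arrow_eq_iff)
    qed
  next
    assume "(a, b, c, d) \<notin> four_cycles E"
    hence "{a, d} \<notin> E \<or> {c, b} \<notin> E" using ab by (auto simp: four_cycles_def insert_commute)
    thus "{arrow a b, arrow c d} \<in> exposed_pairs (arrows E)"
      using one[of a b c d] one[of c d a b] ab by (auto simp: insert_commute)
  qed
qed

lemma exposed_same_tail: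
  assumes "{a, b} \<in> E" "{a, d} \<in> E" "b \<noteq> d"
  shows "{arrow a b, arrow a d} \<in> exposed_pairs (arrows E)"
  \<comment> \<open>\<open>a\<close> is alone on level 1 and only \<open>b\<close>, \<open>d\<close>
    are on level 0, so no other arrow drops by 1.\<close>
  by (rule exposed_pairsI[where \<phi> = "\<lambda>i. if i = a then 1 else if i = b \<or> i = d then 0 else 1/2"])
    (use assms arc_neq in auto)

lemma exposed_same_head:
  assumes "{a, b} \<in> E" "{c, b} \<in> E" "a \<noteq> c"
  shows "{arrow a b, arrow c b} \<in> exposed_pairs (arrows E)"
  by (rule exposed_pairsI[where \<phi> = "\<lambda>i. if i = b then 0 else if i = a \<or> i = c then 1 else 1/2"])
    (use assms arc_neq in auto)

text \<open>The arrows of a path add up to \<open>arrow a c\<close>, so the pair is not exposed if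
  \<open>{a, c}\<close> is an arc or the end nodes have another common neighbour. As this depends on
  the rest of the graph, the set is only estimated.\<close>

definition exposed_paths :: "(nat \<times> nat \<times> nat) set" where
  "exposed_paths = {(a, b, c). {a, b} \<in> E \<and> {b, c} \<in> E \<and> a \<noteq> c \<and> {arrow a b, arrow b c} \<in> exposed_pairs (arrows E)}"

text \<open>The middle node of an exposed path \<open>a, b, c\<close> is determined by \<open>a\<close> and \<open>c\<close>, because all such paths have the same sum.\<close>

lemma card_exposed_paths: "card exposed_paths \<le> card (cherries E)" "card exposed_paths \<le> card V ^ 2"
proof -
  show "card exposed_paths \<le> card (cherries E)"
  proof (rule card_inj_on_le[OF _ _ finite_tuples(3)])
    show "inj_on (\<lambda>(a, b, c). (b, a, c)) exposed_paths" by (auto simp: inj_on_def)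
    show "(\<lambda>(a, b, c). (b, a, c)) ` exposed_paths \<subseteq> cherries E"
      by (auto simp: exposed_paths_def cherries_def insert_commute dest: arc_neq)
  qed
  have "inj_on (\<lambda>(a, b, c). (a, c)) exposed_paths"
  proof -
    have "b = b'" if "(a, b, c) \<in> exposed_paths" "(a, b', c) \<in> exposed_paths" for a b b' c
    proof -
      from that have *: "{a, b} \<in> E" "{b, c} \<in> E" "{a, b'} \<in> E" "{b', c} \<in> E"
        "{arrow a b, arrow b c} \<in> exposed_pairs (arrows E)" by (auto simp: exposed_paths_def)
      have "arrow a b + arrow b c = arrow a b' + arrow b' c" by (simp add: arrow_def)
      hence "arrow a b' \<in> {arrow a b, arrow b c}"
        using exposed_pairs_swap[OF *(5)] arrow_in_arrows * by blast
      thus "b = b'" using * by (auto simp: arrow_eq_iff arc_neq dest: arc_neq)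
    qed
    thus ?thesis by (auto simp: inj_on_def)
  qed
  hence "card exposed_paths \<le> card (V \<times> V)"
    by (rule card_inj_on_le) (auto simp: exposed_paths_def finite_V dest: arc_V)
  thus "card exposed_paths \<le> card V ^ 2" by (simp add: card_cartesian_product power2_eq_square)
qed

text \<open>Ordered pairs of arrows are sorted by what they share: nothing, the tail, the head, or
  the head of one and the tail of the other, in either order. The four-cycles stand on the left to
  avoid truncated subtraction.\<close>

lemma card_polytope_edges:
  "2 * card (polytope_edges (symmetric_edge_polytope E)) + card (four_cycles E)
    = card (arc_pairs E) + 2 * card (cherries E) + 2 * card exposed_paths"
proof -
  let ?X = "exposed_pairs (arrows E)"
  define G where "G = {(a, b, c, d). {a, b} \<in> E \<and> {c, d} \<in> E \<and> (a, b) \<noteq> (c, d) \<and> {arrow a b, arrow c d} \<in> ?X}"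
  have "2 * card (polytope_edges (symmetric_edge_polytope E)) = 2 * card ?X"
    by (simp add: symmetric_edge_polytope_arrows card_polytope_edges_convex_hull
        convex_position_arrows finite_tuples)
  also have "\<dots> = card {(u, w). u \<noteq> w \<and> {u, w} \<in> ?X}"
  proof (rule card_ordered_pairs[symmetric])
    have "?X \<subseteq> Pow (arrows E)" by (auto simp: exposed_pairs_def)
    thus "finite ?X" using finite_tuples(4) finite_subset by blast
  qed (auto simp: exposed_pairs_def)
  also have "\<dots> = card G"
  proof (rule bij_betw_same_card[symmetric, of "\<lambda>(a, b, c, d). (arrow a b, arrow c d)"])
    show "bij_betw (\<lambda>(a, b, c, d). (arrow a b, arrow c d)) G {(u, w). u \<noteq> w \<and> {u, w} \<in> ?X}"
      unfolding bij_betw_def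
    proof
      show "inj_on (\<lambda>(a, b, c, d). (arrow a b, arrow c d)) G"
        by (auto simp: inj_on_def G_def arrow_eq_iff arc_neq)
      show "(\<lambda>(a, b, c, d). (arrow a b, arrow c d)) ` G = {(u, w). u \<noteq> w \<and> {u, w} \<in> ?X}"
      proof (intro equalityI subsetI)
        fix z assume "z \<in> {(u, w). u \<noteq> w \<and> {u, w} \<in> ?X}"
        then obtain u w where z: "z = (u, w)" "u \<noteq> w" "{u, w} \<in> ?X" by auto
        hence "u \<in> arrows E" "w \<in> arrows E" by (auto simp: exposed_pairs_def)
        then obtain a b c d where "u = arrow a b" "{a, b} \<in> E" "w = arrow c d" "{c, d} \<in> E"
          by (auto simp: arrows_def)
        thus "z \<in> (\<lambda>(a, b, c, d). (arrow a b, arrow c d)) ` G"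
          using z by (intro image_eqI[of _ _ "(a, b, c, d)"]) (auto simp: G_def)
      qed (auto simp: G_def arrow_eq_iff arc_neq)
    qed
  qed
  also have "G = (arc_pairs E - four_cycles E)
       \<union> (\<lambda>(a, b, c). (a, b, a, c)) ` cherries E \<union> (\<lambda>(a, b, c). (b, a, c, a)) ` cherries E
       \<union> (\<lambda>(a, b, c). (a, b, b, c)) ` exposed_paths \<union> (\<lambda>(a, b, c). (b, c, a, b)) ` exposed_paths"
    (is "_ = ?A \<union> ?B \<union> ?C \<union> ?D \<union> ?F")
  proof (intro equalityI subsetI)
    fix z assume "z \<in> G"
    then obtain a b c d where z: "z = (a, b, c, d)" and G: "{a, b} \<in> E" "{c, d} \<in> E" "(a, b) \<noteq> (c, d)" "{arrow a b, arrow c d} \<in> ?X"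
      by (auto simp: G_def)
    have neq: "a \<noteq> b" "c \<noteq> d" using G arc_neq by auto
    \<comment> \<open>Opposite arrows add up to 0, which the arrows of an exposed pair do
      not.\<close>
    have "\<not> (a = d \<and> b = c)"
      using exposed_pairs_sum(2)[OF G(4)] by (auto simp: arrow_def)
    then consider "a \<noteq> c" "a \<noteq> d" "b \<noteq> c" "b \<noteq> d" | "a = c" "b \<noteq> d" | "b = d" "a \<noteq> c"
      | "b = c" "a \<noteq> d" | "a = d" "b \<noteq> c" using G(3) by auto
    thus "z \<in> ?A \<union> ?B \<union> ?C \<union> ?D \<union> ?F"
    proof cases
      case 1
      hence "(a, b, c, d) \<in> arc_pairs E" using G neq by (auto simp: arc_pairs_def)
      thus ?thesis using exposed_disjoint_iff G(4) z by blast
    next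
      case 2
      hence "(a, b, d) \<in> cherries E" using G neq by (auto simp: cherries_def)
      hence "z \<in> ?B" using 2 z by force
      thus ?thesis by blast
    next
      case 3
      hence "(b, a, c) \<in> cherries E" using G neq by (auto simp: cherries_def insert_commute)
      hence "z \<in> ?C" using 3 z by force
      thus ?thesis by blast
    next
      case 4
      hence "(a, b, d) \<in> exposed_paths" using G neq by (auto simp: exposed_paths_def)
      hence "z \<in> ?D" using 4 z by force
      thus ?thesis by blast
    next
      case 5
      hence "(c, d, b) \<in> exposed_paths" using G neq by (auto simp: exposed_paths_def insert_commute)
      hence "z \<in> ?F" using 5 z by force
      thus ?thesis by blast
    qed
  next
    fix z assume "z \<in> ?A \<union> ?B \<union> ?C \<union> ?D \<union> ?F"
    then consider "z \<in> ?A" | "z \<in> ?B" | "z \<in> ?C" | "z \<in> ?D" | "z \<in> ?F" by blast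
    thus "z \<in> G"
    proof cases
      case 1
      thus ?thesis using exposed_disjoint_iff by (auto simp: G_def arc_pairs_def)
    next
      case 2
      thus ?thesis by (auto simp: G_def cherries_def exposed_same_tail)
    next
      case 3
      thus ?thesis by (auto simp: G_def cherries_def exposed_same_head insert_commute)
    next
      case 4
      thus ?thesis by (auto simp: G_def exposed_paths_def dest: arc_neq)
    next
      case 5
      thus ?thesis by (auto simp: G_def exposed_paths_def insert_commute dest: arc_neq)
    qed
  qed
  also have "card \<dots> = card (arc_pairs E - four_cycles E) + card (cherries E) + card (cherries E)
      + card exposed_paths + card exposed_paths"
  proof -
    have fin: "finite exposed_paths"
      by (rule finite_subset[of _ "V \<times> V \<times> V"]) (auto simp: exposed_paths_def finite_V dest: arc_V)
    have "?A \<inter> ?B = {}" "?A \<inter> ?C = {}" "?A \<inter> ?D = {}" "?A \<inter> ?F = {}"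
      by (auto simp: arc_pairs_def)
    moreover have "?B \<inter> ?C = {}" "?B \<inter> ?D = {}" "?B \<inter> ?F = {}" "?C \<inter> ?D = {}" "?C \<inter> ?F = {}" "?D \<inter> ?F = {}"
      by (auto simp: cherries_def exposed_paths_def dest: arc_neq)
    ultimately have "card (?A \<union> ?B \<union> ?C \<union> ?D \<union> ?F) = card ?A + card ?B + card ?C + card ?D + card ?F"
      using finite_tuples fin by (intro card_Un_disjoint5) auto
    moreover have "card ?B = card (cherries E)" "card ?C = card (cherries E)"
      "card ?D = card exposed_paths" "card ?F = card exposed_paths"
      by (intro card_image; auto simp: inj_on_def)+
    ultimately show ?thesis by simp
  qed
  finally have "2 * card (polytope_edges (symmetric_edge_polytope E)) = card (arc_pairs E - four_cycles E)
      + 2 * card (cherries E) + 2 * card exposed_paths" by simp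
  moreover have sub: "four_cycles E \<subseteq> arc_pairs E" by (auto simp: four_cycles_def arc_pairs_def)
  ultimately show ?thesis
    using card_Diff_subset[OF finite_tuples(2) sub] card_mono[OF finite_tuples(1) sub] by linarith
qed

end


section \<open>Unimodular triangulations\<close>

lemma lookup_linear:
  "linear (\<lambda>x::vec. coord x i)"
  by standard (simp_all add: lookup_add lookup_scaleR)

lemma lookup_sum_scaleR:
  "coord (\<Sum>c\<in>C. \<mu> c *\<^sub>R g c :: vec) i = (\<Sum>c\<in>C. \<mu> c * coord (g c) i)"
  by (simp add: linear_sum[OF lookup_linear] linear_scale[OF lookup_linear])

lemma int_lattice_add: "x \<in> int_lattice V \<Longrightarrow> y \<in> int_lattice V \<Longrightarrow> x + y \<in> int_lattice V"
  unfolding int_lattice_def real_space_def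
  using Poly_Mapping.keys_add[of x y] by (auto simp: lookup_add)

lemma arrow_int_lattice: "a \<in> V \<Longrightarrow> b \<in> V \<Longrightarrow> arrow a b \<in> int_lattice V"
  unfolding int_lattice_def real_space_def
  by (auto simp: lookup_arrow in_keys_iff split: if_splits)

lemma zero_int_lattice: "0 \<in> int_lattice V"
  by (simp add: int_lattice_def real_space_def)

text \<open>Such a point has nonnegative integer coordinates of sum at most 1, so at most one of
  them is nonzero, and that one is 1.\<close>

lemma standard_simplex_int_lattice:
  assumes y: "y \<in> standard_simplex d" "y \<in> int_lattice {1..d}"
  shows "y \<in> insert 0 (unit_vec ` {1..d})"
proof (cases "y = 0")
  case False
  have nonneg: "0 \<le> coord y i" for i
  proof -
    have "linear (\<lambda>x::vec. - coord x i)"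
      by standard (simp_all add: lookup_add lookup_scaleR)
    moreover have "\<forall>x\<in>insert 0 (unit_vec ` {1..d}). - coord x i \<le> 0"
      by (auto simp: lookup_unit_vec)
    ultimately have "\<forall>x\<in>standard_simplex d. - coord x i \<le> 0"
      unfolding standard_simplex_def by (rule convex_hull_le_linear)
    thus ?thesis using y(1) by auto
  qed
  have "\<forall>x\<in>insert 0 (unit_vec ` {1..d}). weighting (\<lambda>_. 1) x \<le> 1"
    using linear_0[OF linear_weighting] by (auto simp: weighting_unit_vec)
  hence "weighting (\<lambda>_. 1) y \<le> 1"
    using convex_hull_le_linear[OF linear_weighting] y(1) unfolding standard_simplex_def by blast
  hence sum1: "(\<Sum>i\<in>{1..d}. coord y i) \<le> 1"
    using y(2) by (subst (asm) weighting_superset[of "{1..d}"]) (auto simp: int_lattice_def real_space_def)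
  obtain i where i: "coord y i \<noteq> 0"
    using False by (metis lookup_zero poly_mapping_eqI)
  hence id: "i \<in> {1..d}" using y(2) by (auto simp: int_lattice_def real_space_def in_keys_iff)
  have ge1: "1 \<le> coord y j" if "coord y j \<noteq> 0" for j
  proof -
    obtain z where z: "coord y j = of_int z"
      using y(2) by (auto simp: int_lattice_def Ints_def)
    with nonneg[of j] that have "1 \<le> z" by simp
    thus ?thesis using z by simp
  qed
  have "coord y i + (\<Sum>j\<in>{1..d} - {i}. coord y j) \<le> 1"
    using sum1 id by (simp add: sum.remove)
  moreover have "0 \<le> (\<Sum>j\<in>{1..d} - {i}. coord y j)" by (intro sum_nonneg nonneg)
  ultimately have yi: "coord y i = 1" and z: "(\<Sum>j\<in>{1..d} - {i}. coord y j) = 0"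
    using ge1[OF i] by linarith+
  have "coord y j = 0" if "j \<noteq> i" for j
  proof (cases "j \<in> {1..d}")
    case True
    thus ?thesis using z that nonneg by (subst (asm) sum_nonneg_eq_0_iff) auto
  next
    case False
    thus ?thesis using y(2) by (auto simp: int_lattice_def real_space_def in_keys_iff)
  qed
  hence "y = unit_vec i" using yi by (intro poly_mapping_eqI) (auto simp: lookup_unit_vec)
  thus ?thesis using id by blast
qed simp

text \<open>The data of one maximal simplex. \<open>A\<close> is linear because it will be the
  affine hull of a polytope that contains the origin; as a lattice point of \<open>A\<close> the
  origin anchors the integrality argument below.\<close>

locale unimodular_in =
  fixes V :: "nat set" and A S C :: "vec set"
  assumes subspace_A: "subspace A"
    and S: "S = convex hull C" and fin: "finite C" and C_lattice: "C \<subseteq> int_lattice V"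
    and S_A: "S \<subseteq> A" and indep: "\<not> affine_dependent C"
    and unimodular: "unimodular_simplex V A S"
begin

lemma C_S: "C \<subseteq> S"
  unfolding S by (rule hull_subset)

definition is_chart :: "(vec \<Rightarrow> vec) \<Rightarrow> vec \<Rightarrow> nat \<Rightarrow> bool" where
  "is_chart f c d \<longleftrightarrow> linear f \<and> (\<forall>x\<in>C. f x + c \<in> insert 0 (unit_vec ` {1..d})) \<and>
    inj_on (\<lambda>x. f x + c) C \<and> (\<forall>x\<in>A \<inter> int_lattice V. f x + c \<in> int_lattice {1..d})"

text \<open>The points of \<open>C\<close> are lattice points, and the standard simplex has no
  lattice points besides its vertices, so the lattice equivalence sends \<open>C\<close> to
  these.\<close>

lemma chart: "\<exists>f c d. is_chart f c d"
proof -
  obtain d f c where f: "linear f" and bij: "bij_betw (\<lambda>x. f x + c) A (real_space {1..d::nat})"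
    and lat: "(\<lambda>x. f x + c) ` (int_lattice V \<inter> A) = int_lattice {1..d}"
    and simp: "(\<lambda>x. f x + c) ` S = standard_simplex d"
    using unimodular unfolding unimodular_simplex_def Let_def by blast
  show ?thesis
    unfolding is_chart_def
  proof (intro exI conjI)
    show "linear f" by (rule f)
    show "\<forall>x\<in>C. f x + c \<in> insert 0 (unit_vec ` {1..d})"
    proof
      fix x assume x: "x \<in> C"
      hence "f x + c \<in> standard_simplex d" using C_S simp by blast
      moreover have "f x + c \<in> int_lattice {1..d}" using x C_S S_A C_lattice lat by blast
      ultimately show "f x + c \<in> insert 0 (unit_vec ` {1..d})" by (rule standard_simplex_int_lattice)
    qed
    show "inj_on (\<lambda>x. f x + c) C"
      using bij C_S S_A by (meson bij_betw_imp_inj_on inj_on_subset subset_trans)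
    show "\<forall>x\<in>A \<inter> int_lattice V. f x + c \<in> int_lattice {1..d}" using lat by blast
  qed
qed

text \<open>Any two vertices of the standard simplex are joined by an edge; the supporting
  functional is pulled back along the chart.\<close>

lemma exposed_pairs_all:
  assumes uw: "u \<in> C" "w \<in> C" "u \<noteq> w" "C \<noteq> {u, w}"
  shows "{u, w} \<in> exposed_pairs C"
proof -
  obtain f c d where "is_chart f c d" using chart by blast
  hence f: "linear f" and units: "\<forall>x\<in>C. f x + c \<in> insert 0 (unit_vec ` {1..d})"
    and inj: "inj_on (\<lambda>x. f x + c) C"
    unfolding is_chart_def by blast+
  \<comment> \<open>\<open>\<kappa>\<close> prescribes 1 at the images of \<open>u\<close> and
    \<open>w\<close> and 0 at the other vertices. Subtracting \<open>\<kappa> 0\<close> turns this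
    into a linear weighting \<open>\<psi>\<close>, and \<open>b\<close> absorbs that constant
    together with the translation \<open>c\<close>.\<close>
  define \<kappa> where "\<kappa> y = (if y \<in> {f u + c, f w + c} then 1 else 0::real)" for y
  define \<psi> where "\<psi> i = \<kappa> (unit_vec i) - \<kappa> 0" for i
  define b where "b = 1 - \<kappa> 0 - weighting \<psi> c"
  let ?h = "\<lambda>x. weighting \<psi> (f x)"
  have lin: "linear ?h"
    using linear_compose[OF f linear_weighting] by (simp add: o_def)
  have val: "?h x = b - 1 + \<kappa> (f x + c)" if "x \<in> C" for x
  proof -
    have "weighting \<psi> (f x + c) = \<kappa> (f x + c) - \<kappa> 0"
      using units that linear_0[OF linear_weighting] by (auto simp: weighting_unit_vec \<psi>_def)
    thus ?thesis by (simp add: linear_add[OF linear_weighting] b_def)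
  qed
  have \<kappa>: "\<kappa> (f x + c) = (if x \<in> {u, w} then 1 else 0)" if "x \<in> C" for x
    using inj_on_eq_iff[OF inj that uw(1)] inj_on_eq_iff[OF inj that uw(2)] by (simp add: \<kappa>_def)
  have hx: "?h x = (if x \<in> {u, w} then b else b - 1)" if "x \<in> C" for x
    by (simp add: val[OF that] \<kappa>[OF that])
  have "\<forall>x\<in>C. ?h x \<le> b" using hx by simp
  moreover have "{u, w} = {x\<in>C. ?h x = b}"
  proof (intro equalityI subsetI)
    fix x assume "x \<in> {u, w}"
    thus "x \<in> {x\<in>C. ?h x = b}" using hx[of x] uw by auto
  next
    fix x assume "x \<in> {x\<in>C. ?h x = b}"
    thus "x \<in> {u, w}" using hx[of x] by (cases "x \<in> {u, w}") auto
  qed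
  moreover have "{u, w} \<subseteq> C" "{u, w} \<noteq> C" "card {u, w} = 2" using uw by auto
  ultimately show ?thesis unfolding exposed_pairs_def using lin by blast
qed

text \<open>A one-dimensional simplex is its own edge but not its own face, hence the alternative
  \<open>F = S\<close>.\<close>

lemma edges:
  "{F. (F = S \<or> is_face F S) \<and> has_aff_dim F 1} = (\<lambda>W. convex hull W) ` {W. W \<subseteq> C \<and> card W = 2}"
proof -
  have cp: "convex_position C" by (rule affine_independent_convex_position[OF indep])
  have pe: "F \<in> polytope_edges S \<longleftrightarrow> is_face F S \<and> has_aff_dim F 1" for F
    by (simp add: polytope_edges_def)
  show ?thesis
  proof (intro equalityI subsetI)
    fix F assume F: "F \<in> {F. (F = S \<or> is_face F S) \<and> has_aff_dim F 1}"
    show "F \<in> (\<lambda>W. convex hull W) ` {W. W \<subseteq> C \<and> card W = 2}"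
    proof (cases "F = S")
      case True
      thus ?thesis using convex_position_dim_1[OF fin cp] F S by auto
    next
      case False
      hence "F \<in> polytope_edges S" using F pe by simp
      thus ?thesis unfolding S polytope_edges_convex_hull[OF fin cp] exposed_pairs_def by blast
    qed
  next
    fix F assume "F \<in> (\<lambda>W. convex hull W) ` {W. W \<subseteq> C \<and> card W = 2}"
    then obtain u w where uw: "F = convex hull {u, w}" "u \<noteq> w" "u \<in> C" "w \<in> C"
      by (auto simp: card_2_iff)
    show "F \<in> {F. (F = S \<or> is_face F S) \<and> has_aff_dim F 1}"
    proof (cases "C = {u, w}")
      case True
      thus ?thesis using uw has_aff_dim_pair S by auto
    next
      case False
      hence "F \<in> polytope_edges S"
        unfolding S polytope_edges_convex_hull[OF fin cp] using exposed_pairs_all[OF uw(3,4,2)] uw(1) by blast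
      thus ?thesis using pe by simp
    qed
  qed
qed

text \<open>Affine maps preserve barycentric coordinates, and in the standard simplex these are the
  coordinates together with the complement of their sum to 1. It is applied with
  \<open>k = 1\<close> to lattice points and with \<open>k = 2\<close> to halves of lattice
  points.\<close>

lemma barycentric_Ints:
  fixes k :: nat
  assumes \<mu>: "sum \<mu> C = 1" and k: "real k *\<^sub>R (\<Sum>c\<in>C. \<mu> c *\<^sub>R c) \<in> int_lattice V" and c: "c \<in> C"
  shows "real k * \<mu> c \<in> \<int>"
proof -
  obtain f s d where "is_chart f s d" using chart by blast
  hence f: "linear f" and units: "\<forall>x\<in>C. f x + s \<in> insert 0 (unit_vec ` {1..d})"
    and inj: "inj_on (\<lambda>x. f x + s) C" and lat: "\<forall>x\<in>A \<inter> int_lattice V. f x + s \<in> int_lattice {1..d}"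
    unfolding is_chart_def by blast+
  let ?\<phi> = "\<lambda>x. f x + s"
  define x where "x = (\<Sum>c\<in>C. \<mu> c *\<^sub>R c)"
  have xA: "x \<in> A" unfolding x_def
    using C_S S_A by (intro subspace_sum[OF subspace_A] subspace_scale[OF subspace_A]) auto
  have \<phi>x: "?\<phi> x = (\<Sum>c\<in>C. \<mu> c *\<^sub>R ?\<phi> c)"
    using \<mu> by (simp add: x_def linear_sum[OF f] linear_scale[OF f] scaleR_add_right sum.distrib scaleR_sum_left[symmetric])
  have lookup_int: "coord (?\<phi> z) i \<in> \<int>" if "z \<in> A" "z \<in> int_lattice V" for z i
    using lat that unfolding int_lattice_def by blast
  have int: "real k * coord (?\<phi> x) i \<in> \<int>" for i
  proof -
    \<comment> \<open>The chart is affine, not linear: scaling the argument by \<open>k\<close>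
      leaves \<open>k - 1\<close> copies of the image of the origin, which is integral because 0 is
      a lattice point of \<open>A\<close>.\<close>
    have "real k *\<^sub>R ?\<phi> x = ?\<phi> (real k *\<^sub>R x) + (real k - 1) *\<^sub>R ?\<phi> 0"
      by (simp add: linear_scale[OF f] linear_0[OF f] algebra_simps)
    hence "real k * coord (?\<phi> x) i
        = coord (?\<phi> (real k *\<^sub>R x)) i + (real k - 1) * coord (?\<phi> 0) i"
      by (metis lookup_add lookup_scaleR)
    moreover have "coord (?\<phi> (real k *\<^sub>R x)) i \<in> \<int>"
      using k xA subspace_scale[OF subspace_A] by (intro lookup_int) (auto simp: x_def)
    moreover have "coord (?\<phi> 0) i \<in> \<int>"
      using subspace_0[OF subspace_A] zero_int_lattice by (intro lookup_int)
    ultimately show ?thesis by (metis Ints_1 Ints_add Ints_diff Ints_mult Ints_of_nat)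
  qed
  have unit: "real k * \<mu> e \<in> \<int>" if e: "e \<in> C" "?\<phi> e = unit_vec i" for e i
  proof -
    have "coord (?\<phi> x) i = (\<Sum>c\<in>C. \<mu> c * coord (?\<phi> c) i)"
      unfolding \<phi>x lookup_sum_scaleR ..
    also have "\<dots> = (\<Sum>c\<in>C. if c = e then \<mu> c else 0)"
    proof (rule sum.cong)
      fix c assume c: "c \<in> C"
      have "coord (?\<phi> c) i = (if c = e then 1 else 0)"
      proof (cases "c = e")
        case False
        hence "?\<phi> c \<noteq> unit_vec i" using inj_on_eq_iff[OF inj c e(1)] e(2) by simp
        moreover have "?\<phi> c \<in> insert 0 (unit_vec ` {1..d})" using units c by blast
        ultimately show ?thesis using False by (auto simp: lookup_unit_vec)
      qed (simp add: e lookup_unit_vec)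
      thus "\<mu> c * coord (?\<phi> c) i = (if c = e then \<mu> c else 0)" by simp
    qed simp
    also have "\<dots> = \<mu> e" using fin e by simp
    finally show ?thesis using int[of i] by simp
  qed
  show ?thesis
  proof (cases "?\<phi> c = 0")
    case False
    thus ?thesis using units c unit by blast
  next
    case True
    \<comment> \<open>No coordinate sees the vertex sent to 0; its weight is what the other weights
      leave from 1.\<close>
    have "\<mu> c = 1 - sum \<mu> (C - {c})" using \<mu> c fin by (simp add: sum.remove)
    hence "real k * \<mu> c = real k - real k * sum \<mu> (C - {c})" by (simp only: right_diff_distrib mult_1_right)
    hence "real k * \<mu> c = real k - (\<Sum>e\<in>C - {c}. real k * \<mu> e)" by (simp only: sum_distrib_left)
    moreover have I: "real k * \<mu> e \<in> \<int>" if e: "e \<in> C - {c}" for e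
    proof -
      have "?\<phi> e \<noteq> 0" using inj_on_eq_iff[OF inj, of e c] e True c by simp
      thus ?thesis using units e unit by blast
    qed
    moreover have "(\<Sum>e\<in>C - {c}. real k * \<mu> e) \<in> \<int>" by (rule Ints_sum) (rule I)
    ultimately show ?thesis by simp
  qed
qed

text \<open>The barycentric coordinates at \<open>u\<close> and \<open>w\<close> are 1/2, not
  integers.\<close>

lemma midpoint_not_lattice:
  assumes "u \<in> C" "w \<in> C" "u \<noteq> w"
  shows "(1/2) *\<^sub>R (u + w) \<notin> int_lattice V"
proof
  assume lat: "(1/2) *\<^sub>R (u + w) \<in> int_lattice V"
  let ?\<mu> = "\<lambda>c. if c = u \<or> c = w then 1/2 else 0::real"
  have C: "C \<inter> {c. c = u \<or> c = w} = {u, w}" using assms by auto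
  have 1: "sum ?\<mu> C = 1" using fin assms(3) by (simp add: sum.If_cases C)
  have "(\<Sum>c\<in>C. ?\<mu> c *\<^sub>R c) = (\<Sum>c\<in>C. if c = u \<or> c = w then (1/2) *\<^sub>R c else 0)"
    by (intro sum.cong) auto
  also have "\<dots> = (1/2) *\<^sub>R (u + w)"
    using fin assms(3) by (simp add: sum.If_cases C scaleR_add_right)
  finally have "real 1 *\<^sub>R (\<Sum>c\<in>C. ?\<mu> c *\<^sub>R c) \<in> int_lattice V" using lat by simp
  from barycentric_Ints[OF 1 this assms(1)] have "(1/2::real) \<in> \<int>" by simp
  then obtain z where "(1/2::real) = of_int z" by (auto simp: Ints_def)
  hence "of_int (2 * z) = (1::real)" by simp
  hence "2 * z = 1" by linarith
  thus False by presburger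
qed

text \<open>The barycentric coordinates are nonnegative multiples of 1/2 with sum 1: either one of
  them is 1, or exactly two are 1/2.\<close>

lemma half_lattice_point:
  assumes x: "x \<in> S" "x + x \<in> int_lattice V"
  shows "x \<in> C \<or> (\<exists>u\<in>C. \<exists>w\<in>C. u \<noteq> w \<and> x + x = u + w)"
proof -
  obtain \<mu> where \<mu>: "\<forall>c\<in>C. 0 \<le> \<mu> c" "sum \<mu> C = 1" "x = (\<Sum>c\<in>C. \<mu> c *\<^sub>R c)"
    using x(1) unfolding S convex_hull_finite[OF fin] by auto
  have "real 2 *\<^sub>R (\<Sum>c\<in>C. \<mu> c *\<^sub>R c) \<in> int_lattice V" using x(2) by (simp add: \<mu>(3) scaleR_2)
  hence int: "2 * \<mu> c \<in> \<int>" if "c \<in> C" for c using barycentric_Ints[OF \<mu>(2) _ that, of 2] by simp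
  have half: "\<mu> c = 0 \<or> \<mu> c = 1/2 \<or> \<mu> c = 1" if c: "c \<in> C" for c
  proof -
    obtain z where z: "2 * \<mu> c = of_int z" using int[OF c] by (auto simp: Ints_def)
    have "\<mu> c \<le> 1" using member_le_sum[OF c, of \<mu>] \<mu>(1,2) fin by auto
    moreover have "0 \<le> \<mu> c" using \<mu>(1) c by auto
    ultimately have "0 \<le> z" "z \<le> 2" using z by linarith+
    hence "z = 0 \<or> z = 1 \<or> z = 2" by presburger
    thus ?thesis using z by auto
  qed
  define H where "H = {c\<in>C. \<mu> c \<noteq> 0}"
  have H: "H \<subseteq> C" "finite H" using fin by (auto simp: H_def)
  have sumH: "sum \<mu> H = 1" unfolding \<mu>(2)[symmetric] using fin by (intro sum.mono_neutral_left) (auto simp: H_def)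
  have xH: "x = (\<Sum>c\<in>H. \<mu> c *\<^sub>R c)" unfolding \<mu>(3) using fin by (intro sum.mono_neutral_right) (auto simp: H_def)
  show ?thesis
  proof (cases "\<exists>c\<in>H. \<mu> c = 1")
    case True
    then obtain c where c: "c \<in> H" "\<mu> c = 1" by blast
    have "sum \<mu> (H - {c}) = 0" using sumH c H by (simp add: sum.remove)
    hence "\<forall>e\<in>H - {c}. \<mu> e = 0" using \<mu>(1) H by (subst (asm) sum_nonneg_eq_0_iff) auto
    hence "H = {c}" using c by (auto simp: H_def)
    thus ?thesis using xH c H by simp
  next
    case False
    hence h: "\<forall>c\<in>H. \<mu> c = 1/2" using half H by (auto simp: H_def)
    hence "sum \<mu> H = (\<Sum>c\<in>H. 1/2)" by (intro sum.cong) auto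
    hence "sum \<mu> H = real (card H) / 2" by simp
    hence "card H = 2" using sumH by simp
    then obtain u w where uw: "H = {u, w}" "u \<noteq> w" by (auto simp: card_2_iff)
    have "x = (1/2) *\<^sub>R u + (1/2) *\<^sub>R w" using xH uw h by simp
    hence "x = (1/2) *\<^sub>R (u + w)" by (simp add: scaleR_add_right)
    hence "x + x = u + w" by (simp add: scaleR_add_left[symmetric])
    thus ?thesis using uw H by auto
  qed
qed

lemma lattice_point:
  assumes x: "x \<in> S" "x \<in> int_lattice V"
  shows "x \<in> C"
proof (rule ccontr)
  assume "x \<notin> C"
  then obtain u w where uw: "u \<in> C" "w \<in> C" "u \<noteq> w" "x + x = u + w"
    using half_lattice_point[OF x(1) int_lattice_add[OF x(2) x(2)]] by auto
  have "(1/2) *\<^sub>R (u + w) = x" unfolding uw(4)[symmetric] by (rule scaleR_half_double)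
  thus False using midpoint_not_lattice[OF uw(1-3)] x(2) by simp
qed

lemma pair_sum_unique:
  assumes "u \<in> C" "w \<in> C" "u' \<in> C" "w' \<in> C" and eq: "u + w = u' + w'"
  shows "u' \<in> {u, w}"
proof (rule ccontr)
  assume n: "u' \<notin> {u, w}"
  \<comment> \<open>The coefficients of \<open>u + w - u' - w'\<close>, written as a sum of
    indicators so that coinciding points add up. If \<open>u'\<close> is neither \<open>u\<close>
    nor \<open>w\<close>, its coefficient is negative, which makes the affine relation
    nontrivial.\<close>
  define U where "U c = (if c = u then 1 else 0) + (if c = w then 1 else 0)
      - (if c = u' then 1 else 0) - (if c = w' then 1 else 0::real)" for c
  have "sum U C = 0" unfolding U_def using fin assms by (simp add: sum.distrib sum_subtractf)
  moreover have "(\<Sum>c\<in>C. U c *\<^sub>R c) = u + w - u' - w'"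
  proof -
    have *: "(if c = z then 1 else 0::real) *\<^sub>R c = (if c = z then c else 0)" for c z :: vec by simp
    show ?thesis unfolding U_def
      using fin assms by (simp add: scaleR_left.add scaleR_left.diff sum.distrib sum_subtractf *)
  qed
  moreover have "U u' \<noteq> 0" using n by (auto simp: U_def)
  moreover have "u + w - u' - w' = 0" by (simp add: eq)
  ultimately have "affine_dependent C"
    unfolding affine_dependent_explicit_finite[OF fin] using assms(3) by metis
  thus False using indep by simp
qed

end

text \<open>For nonempty \<open>E\<close> the set \<open>insert 0 (arrows E)\<close> consists of the
  lattice points of the polytope. Doubles are removed because half of a double is a lattice point,
  hence a vertex of its simplex and not the midpoint of an edge.\<close>

definition pair_sums :: "nat set set \<Rightarrow> vec set" where
  "pair_sums E = {u + w |u w. u \<in> insert 0 (arrows E) \<and> w \<in> insert 0 (arrows E)} - (\<lambda>u. u + u) ` insert 0 (arrows E)"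

context graph
begin

lemma zero_in_hull:
  assumes "E \<noteq> {}"
  shows "0 \<in> convex hull (arrows E)"
proof -
  obtain e where "e \<in> E" using assms by blast
  then obtain a b where "{a, b} \<in> E" using arcs by (force simp: all_arcs_def card_2_iff)
  hence "arrow a b \<in> arrows E" "arrow b a \<in> arrows E" using arrow_in_arrows arc_sym by auto
  hence "(1/2) *\<^sub>R arrow a b + (1/2) *\<^sub>R arrow b a \<in> convex hull (arrows E)"
    by (intro convexD convex_convex_hull hull_inc) auto
  moreover have "(1/2) *\<^sub>R arrow a b + (1/2) *\<^sub>R arrow b a = 0"
    by (simp add: scaleR_add_right[symmetric] arrow_def)
  ultimately show ?thesis by simp
qed

lemma arrows_int_lattice: "insert 0 (arrows E) \<subseteq> int_lattice V"
  by (auto simp: arrows_def zero_int_lattice dest: arc_V intro: arrow_int_lattice)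

text \<open>Constant weightings give coordinate sum 0, and the sign weighting gives l1-norm at most
  2. A nonzero integral vector with these properties has one entry 1 and one entry -1, and the
  weighting peaked at these two nodes excludes pairs that are not arcs.\<close>

lemma hull_lattice_points:
  assumes x: "x \<in> convex hull (arrows E)" "x \<in> int_lattice V"
  shows "x \<in> insert 0 (arrows E)"
proof (cases "x = 0")
  case False
  have le: "weighting \<phi> x \<le> b" if "\<forall>y\<in>arrows E. weighting \<phi> y \<le> b" for \<phi> b
    using convex_hull_le_linear[OF linear_weighting that] x(1) by blast
  have wf: "weighting \<phi> x = (\<Sum>i\<in>V. coord x i * \<phi> i)" for \<phi>
    using x(2) by (intro weighting_superset finite_V) (auto simp: int_lattice_def real_space_def)
  have out: "coord x i = 0" if "i \<notin> V" for i
    using x(2) that by (auto simp: int_lattice_def real_space_def in_keys_iff)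
  have int: "1 \<le> \<bar>coord x i\<bar>" if "coord x i \<noteq> 0" for i
    using x(2) that by (auto simp: int_lattice_def intro: Ints_nonzero_abs_ge1)
  let ?s = "\<lambda>i. sgn (coord x i)"
  have "weighting (\<lambda>_. 1) x \<le> 0" "weighting (\<lambda>_. -1) x \<le> 0"
    by (intro le; auto simp: arrows_def weighting_arrow)+
  hence sum0: "(\<Sum>i\<in>V. coord x i) = 0" by (simp add: wf sum_negf)
  have "weighting ?s x \<le> 2"
  proof (intro le ballI)
    fix y assume "y \<in> arrows E"
    then obtain a b where "y = arrow a b" by (auto simp: arrows_def)
    thus "weighting ?s y \<le> 2" by (simp add: weighting_arrow sgn_if)
  qed
  hence sum2: "(\<Sum>i\<in>V. \<bar>coord x i\<bar>) \<le> 2" by (simp add: wf abs_sgn)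
  obtain i where i: "coord x i > 0"
  proof (rule ccontr)
    assume "\<not> thesis"
    hence np: "coord x i \<le> 0" for i using that linorder_not_less by blast
    hence "coord x i = 0" if "i \<in> V" for i
      using sum_nonneg_eq_0_iff[OF finite_V, of "\<lambda>i. - coord x i"] sum0 that by (simp add: sum_negf)
    hence "x = 0" using out by (intro poly_mapping_eqI) (metis lookup_zero)
    thus False using False by simp
  qed
  obtain j where j: "coord x j < 0"
  proof (rule ccontr)
    assume "\<not> thesis"
    hence np: "coord x i \<ge> 0" for i using that linorder_not_less by blast
    hence "coord x i = 0" if "i \<in> V" for i
      using sum_nonneg_eq_0_iff[OF finite_V, of "\<lambda>i. coord x i"] sum0 that by simp
    hence "x = 0" using out by (intro poly_mapping_eqI) (metis lookup_zero)
    thus False using False by simp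
  qed
  have ij: "i \<in> V" "j \<in> V" "i \<noteq> j" using i j out by force+
  have "(\<Sum>k\<in>V. \<bar>coord x k\<bar>) = \<bar>coord x i\<bar> + (\<bar>coord x j\<bar> + (\<Sum>k\<in>V - {i} - {j}. \<bar>coord x k\<bar>))"
    using ij finite_V by (subst sum.remove[of V i], simp, simp, subst sum.remove[of "V - {i}" j]) auto
  moreover have "0 \<le> (\<Sum>k\<in>V - {i} - {j}. \<bar>coord x k\<bar>)" by (intro sum_nonneg) auto
  moreover have "1 \<le> coord x i" "coord x j \<le> -1" using int[of i] int[of j] i j by auto
  ultimately have one: "coord x i = 1" "coord x j = -1"
    and z: "(\<Sum>k\<in>V - {i} - {j}. \<bar>coord x k\<bar>) = 0"
    using sum2 i j by linarith+
  have rest: "coord x k = 0" if "k \<noteq> i" "k \<noteq> j" for k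
    using z that out[of k] finite_V by (cases "k \<in> V") (auto simp: sum_nonneg_eq_0_iff)
  have xa: "x = arrow i j" using one rest ij by (intro poly_mapping_eqI) (auto simp: lookup_arrow)
  have "{i, j} \<in> E"
  proof (rule ccontr)
    assume n: "{i, j} \<notin> E"
    let ?\<phi> = "\<lambda>k. if k = i then 1 else if k = j then -1 else 0::real"
    have "weighting ?\<phi> x \<le> 1"
      using n ij by (intro le) (auto simp: arrows_def weighting_arrow insert_commute)
    thus False using ij by (simp add: xa weighting_arrow)
  qed
  thus ?thesis using xa arrow_in_arrows by simp
qed simp

text \<open>
  A point \<open>x\<close> with \<open>2x\<close> in the lattice has half-integral barycentric coordinates in its simplex, so it
  is a vertex or the midpoint of an edge; this makes \<open>F \<mapsto> u + w\<close> for \<open>F = [u, w]\<close> a bijection.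
\<close>

lemma card_triangulation_edges:
  assumes T: "unimodular_triangulation V (symmetric_edge_polytope E) T"
  shows "card (triangulation_edges T) = card (pair_sums E)"
proof (cases "E = {}")
  case True
  have P: "symmetric_edge_polytope E = {}" by (simp add: True symmetric_edge_polytope_arrows arrows_def)
  hence "\<Union>T = {}" using T by (simp add: unimodular_triangulation_def lattice_triangulation_def)
  hence "F = {}" if "S \<in> T" "F = S \<or> is_face F S" for S F using that by (auto simp: is_face_def)
  moreover have "\<not> has_aff_dim ({} :: vec set) 1" by (auto simp: has_aff_dim_def)
  ultimately have "triangulation_edges T = {}" unfolding triangulation_edges_def by blast
  moreover have "pair_sums E = {}" by (auto simp: True pair_sums_def arrows_def)
  ultimately show ?thesis by simp
next
  case False
  define P where "P = symmetric_edge_polytope E"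
  define A where "A = affine hull P"
  let ?L = "insert 0 (arrows E)"
  have P: "P = convex hull (arrows E)" by (simp add: P_def symmetric_edge_polytope_arrows)
  have PA: "P \<subseteq> A" unfolding A_def by (rule hull_subset)
  have zero: "0 \<in> P" unfolding P by (rule zero_in_hull[OF False])
  have "0 \<in> A" using zero PA by blast
  hence sub: "subspace A" unfolding A_def by (simp add: subspace_affine)
  have tri: "\<Union>T = P"
    and faces: "\<And>S S'. S \<in> T \<Longrightarrow> S' \<in> T \<Longrightarrow> S \<noteq> S' \<Longrightarrow> S \<inter> S' = {} \<or> is_face (S \<inter> S') S"
    using T unfolding unimodular_triangulation_def lattice_triangulation_def P_def by blast+
  obtain d where d: "\<forall>S\<in>T. lattice_simplex V d S"
    using T unfolding unimodular_triangulation_def lattice_triangulation_def by auto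
  have "\<forall>S\<in>T. \<exists>C. unimodular_in V A S C"
  proof
    fix S assume S: "S \<in> T"
    then obtain C where "finite C" "C \<subseteq> int_lattice V" "\<not> affine_dependent C" "S = convex hull C"
      using d unfolding lattice_simplex_def by blast
    moreover have "S \<subseteq> A" using S tri PA by blast
    moreover have "unimodular_simplex V A S"
      using T S unfolding unimodular_triangulation_def A_def P_def by blast
    ultimately have "unimodular_in V A S C" using sub by unfold_locales
    thus "\<exists>C. unimodular_in V A S C" ..
  qed
  from bchoice[OF this] obtain C where C: "\<And>S. S \<in> T \<Longrightarrow> unimodular_in V A S (C S)" by blast
  define W where "W = {w. \<exists>S\<in>T. w \<subseteq> C S \<and> card w = 2}"
  have CL: "C S \<subseteq> ?L" if ST: "S \<in> T" for S
  proof
    fix x assume x: "x \<in> C S"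
    interpret unimodular_in V A S "C S" by (rule C[OF ST])
    have "x \<in> P" using x C_S ST tri by blast
    thus "x \<in> ?L" using hull_lattice_points x C_lattice unfolding P by blast
  qed
  have lat: "x \<in> C S" if "S \<in> T" "x \<in> S" "x \<in> ?L" for x S
  proof -
    interpret unimodular_in V A S "C S" by (rule C[OF that(1)])
    show ?thesis using lattice_point that arrows_int_lattice by blast
  qed
  have edges: "triangulation_edges T = (\<lambda>w. convex hull w) ` W"
  proof -
    have "triangulation_edges T = (\<Union>S\<in>T. {F. (F = S \<or> is_face F S) \<and> has_aff_dim F 1})"
      unfolding triangulation_edges_def by blast
    also have "\<dots> = (\<Union>S\<in>T. (\<lambda>w. convex hull w) ` {w. w \<subseteq> C S \<and> card w = 2})"
      by (intro SUP_cong refl unimodular_in.edges[OF C])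
    also have "\<dots> = (\<lambda>w. convex hull w) ` W" unfolding W_def by blast
    finally show ?thesis .
  qed
  have inj: "inj_on (\<lambda>w. convex hull w) W"
  proof (rule inj_onI)
    fix w w' assume w: "w \<in> W" "w' \<in> W" "convex hull w = convex hull w'"
    obtain S S' where S: "S \<in> T" "w \<subseteq> C S" "S' \<in> T" "w' \<subseteq> C S'" using w unfolding W_def by blast
    interpret S': unimodular_in V A S' "C S'" by (rule C[OF S(3)])
    \<comment> \<open>All lattice points of a simplex are among its vertices, so \<open>w\<close>
      too consists of vertices of \<open>S'\<close>, and both sets can be compared there.\<close>
    have "convex hull w' \<subseteq> S'" by (subst S'.S) (rule hull_mono[OF S(4)])
    hence "w \<subseteq> S'" using w(3) hull_subset[of w convex] by blast
    hence "w \<subseteq> C S'" using lat[OF S(3)] S CL by blast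
    thus "w = w'"
      using convex_hull_inj_on_convex_position[OF affine_independent_convex_position[OF S'.indep]] S(4) w(3)
      by (auto simp: inj_on_def)
  qed
  have injs: "inj_on (\<lambda>w. \<Sum>x\<in>w. x) W"
  proof (rule inj_onI)
    fix w w' assume w: "w \<in> W" "w' \<in> W" "(\<Sum>x\<in>w. x) = (\<Sum>x\<in>w'. x)"
    obtain S S' where S: "S \<in> T" "w \<subseteq> C S" "S' \<in> T" "w' \<subseteq> C S'" "card w = 2" "card w' = 2"
      using w unfolding W_def by blast
    obtain u v u' v' where uv: "w = {u, v}" "u \<noteq> v" "w' = {u', v'}" "u' \<noteq> v'" using S by (auto simp: card_2_iff)
    have eq: "u + v = u' + v'" using w uv by simp
    interpret S: unimodular_in V A S "C S" by (rule C[OF S(1)])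
    interpret S': unimodular_in V A S' "C S'" by (rule C[OF S(3)])
    have uS: "u \<in> S" "v \<in> S" "u' \<in> S'" "v' \<in> S'" using uv S S.C_S S'.C_S by auto
    have "u \<in> S' \<and> v \<in> S'"
    proof (cases "S = S'")
      case False
      \<comment> \<open>The common midpoint lies in a face shared by both simplices. A functional
        that is maximal at the midpoint is maximal at both ends, so the whole edge belongs to
        \<open>S'\<close>.\<close>
      define m where "m = (1/2) *\<^sub>R (u + v)"
      have conv: "convex S" "convex S'"
        by (subst S.S, rule convex_convex_hull) (subst S'.S, rule convex_convex_hull)
      have "m \<in> S" unfolding m_def scaleR_add_right by (rule convexD[OF conv(1) uS(1,2)]) simp_all
      moreover have "m \<in> S'" unfolding m_def eq scaleR_add_right by (rule convexD[OF conv(2) uS(3,4)]) simp_all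
      ultimately have m: "m \<in> S \<inter> S'" by simp
      then obtain f :: "vec \<Rightarrow> real" and b where f: "linear f" "\<forall>x\<in>S. f x \<le> b" "S \<inter> S' = S \<inter> {x. f x = b}"
        using faces[OF S(1,3) False] unfolding is_face_def by auto
      have "f m = b" using m f(3) by blast
      hence "f u + f v = 2 * b" unfolding m_def by (simp add: linear_scale[OF f(1)] linear_add[OF f(1)])
      moreover have "f u \<le> b" "f v \<le> b" using f(2) uS by auto
      ultimately have "f u = b" "f v = b" by linarith+
      thus ?thesis using f(3) uS by blast
    qed (use uS in simp)
    hence "u \<in> C S'" "v \<in> C S'" using lat[OF S(3)] CL[OF S(1)] S(2) uv by auto
    hence "u' \<in> {u, v}" "v' \<in> {u, v}"
      using S'.pair_sum_unique[of u v u' v'] S'.pair_sum_unique[of u v v' u'] S(4) uv eq by (auto simp: add.commute)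
    thus "w = w'" using uv by auto
  qed
  have "(\<lambda>w. \<Sum>x\<in>w. x) ` W = pair_sums E"
  proof (intro equalityI subsetI)
    fix z assume "z \<in> (\<lambda>w. \<Sum>x\<in>w. x) ` W"
    then obtain w S where w: "z = (\<Sum>x\<in>w. x)" "S \<in> T" "w \<subseteq> C S" "card w = 2" unfolding W_def by blast
    then obtain u v where uv: "w = {u, v}" "u \<noteq> v" by (auto simp: card_2_iff)
    have z: "z = u + v" using w uv by simp
    have uC: "u \<in> C S" "v \<in> C S" using w uv by auto
    interpret unimodular_in V A S "C S" by (rule C[OF w(2)])
    have "z \<noteq> a + a" if "a \<in> ?L" for a
    proof
      assume "z = a + a"
      hence "(1/2) *\<^sub>R (u + v) = a" using z scaleR_half_double[of a] by simp
      thus False using midpoint_not_lattice[OF uC uv(2)] that arrows_int_lattice by blast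
    qed
    thus "z \<in> pair_sums E" unfolding pair_sums_def using z uC CL[OF w(2)] by blast
  next
    fix z assume "z \<in> pair_sums E"
    then obtain u v where uv: "z = u + v" "u \<in> ?L" "v \<in> ?L" and n: "\<And>a. a \<in> ?L \<Longrightarrow> z \<noteq> a + a"
      unfolding pair_sums_def by blast
    define x where "x = (1/2) *\<^sub>R z"
    have xx: "x + x = z" by (simp add: x_def scaleR_add_left[symmetric])
    have LP: "?L \<subseteq> P" using zero hull_subset[of "arrows E" convex] unfolding P by blast
    have "convex P" unfolding P by (rule convex_convex_hull)
    hence "x \<in> P" unfolding x_def uv(1) scaleR_add_right
      by (rule convexD) (use uv(2,3) LP in auto)
    then obtain S where ST: "S \<in> T" "x \<in> S" using tri by blast
    interpret unimodular_in V A S "C S" by (rule C[OF ST(1)])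
    \<comment> \<open>Otherwise \<open>z\<close> would be twice a lattice point.\<close>
    have xC: "x \<notin> C S"
    proof
      assume "x \<in> C S"
      hence "x \<in> ?L" using CL[OF ST(1)] by blast
      from n[OF this] xx show False by simp
    qed
    have "x + x \<in> int_lattice V" unfolding xx uv(1) using arrows_int_lattice uv(2,3) by (intro int_lattice_add) auto
    from half_lattice_point[OF ST(2) this] xC
    obtain u' v' where uv': "u' \<in> C S" "v' \<in> C S" "u' \<noteq> v'" "x + x = u' + v'"
      by auto
    hence "{u', v'} \<in> W" using ST unfolding W_def by auto
    moreover have "z = (\<Sum>x\<in>{u', v'}. x)" using uv' xx by simp
    ultimately show "z \<in> (\<lambda>w. \<Sum>x\<in>w. x) ` W" by blast
  qed
  thus ?thesis unfolding edges card_image[OF inj] using card_image[OF injs] by simp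
qed

end


section \<open>Counting sums of two lattice points\<close>

text \<open>Counts an image whose fibres differ in size by giving every fibre total weight 1. The
  fibres over sums of disjoint arrows have two or four elements.\<close>

lemma card_image_fibre_weights:
  fixes w :: "'a \<Rightarrow> real"
  assumes "finite S" "\<And>x. x \<in> S \<Longrightarrow> (\<Sum>y\<in>{y\<in>S. f y = f x}. w y) = 1"
  shows "real (card (f ` S)) = (\<Sum>x\<in>S. w x)"
proof -
  have "(\<Sum>x\<in>S. w x) = (\<Sum>z\<in>f ` S. \<Sum>y\<in>{y\<in>S. f y = z}. w y)"
    by (rule sum.image_gen[OF assms(1)])
  also have "\<dots> = (\<Sum>z\<in>f ` S. 1)" using assms(2) by (intro sum.cong) auto
  finally show ?thesis by simp
qed

text \<open>No tail is also a head, so nothing cancels and the sum determines the set of tails and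
  the set of heads.\<close>

lemma arrow_sum_coords:
  assumes "a \<notin> {b, d}" "c \<notin> {b, d}" "x = arrow a b + arrow c d"
  shows "{a, c} = {i. coord x i > 0}" "{b, d} = {i. coord x i < 0}"
  using assms by (auto simp: lookup_add lookup_arrow split: if_splits)

context graph
begin

lemma card_arrows: "card (arrows E) = 2 * card E"
proof -
  have "E \<subseteq> Pow V" using arcs by (auto simp: all_arcs_def)
  hence fE: "finite E" by (rule finite_subset) (simp add: finite_V)
  have "card (arrows E) = card {(u, w). u \<noteq> w \<and> {u, w} \<in> E}"
  proof (rule bij_betw_same_card[symmetric, of "\<lambda>(a, b). arrow a b"])
    show "bij_betw (\<lambda>(a, b). arrow a b) {(u, w). u \<noteq> w \<and> {u, w} \<in> E} (arrows E)"
      unfolding bij_betw_def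
    proof
      show "inj_on (\<lambda>(a, b). arrow a b) {(u, w). u \<noteq> w \<and> {u, w} \<in> E}"
        by (auto simp: inj_on_def arrow_eq_iff)
      show "(\<lambda>(a, b). arrow a b) ` {(u, w). u \<noteq> w \<and> {u, w} \<in> E} = arrows E"
        using arc_neq by (auto simp: arrows_def image_iff)
    qed
  qed
  also have "\<dots> = 2 * card E"
    by (rule card_ordered_pairs[OF fE]) (use arcs in \<open>auto simp: all_arcs_def\<close>)
  finally show ?thesis .
qed

text \<open>Sums of two consecutive arrows. Those with \<open>{a, c} \<in> E\<close> are arrows of
  the graph and already occur as sums with 0.\<close>

definition far_arrows :: "vec set" where
  "far_arrows = {arrow a c |a b c. {a, b} \<in> E \<and> {b, c} \<in> E \<and> a \<noteq> c \<and> {a, c} \<notin> E}"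

lemma card_far_arrows: "card far_arrows \<le> card (cherries E)" "card far_arrows \<le> card V ^ 2"
proof -
  have "far_arrows \<subseteq> (\<lambda>(b, a, c). arrow a c) ` cherries E"
  proof
    fix x assume "x \<in> far_arrows"
    then obtain a b c where "{a, b} \<in> E" "{b, c} \<in> E" "a \<noteq> c" "x = arrow a c"
      unfolding far_arrows_def by auto
    hence "x = (\<lambda>(b, a, c). arrow a c) (b, a, c)" "(b, a, c) \<in> cherries E"
      by (auto simp: cherries_def insert_commute dest: arc_neq)
    thus "x \<in> (\<lambda>(b, a, c). arrow a c) ` cherries E" by (rule image_eqI)
  qed
  thus "card far_arrows \<le> card (cherries E)"
    using surj_card_le[OF finite_tuples(3)] by blast
  have "far_arrows \<subseteq> (\<lambda>(a, c). arrow a c) ` (V \<times> V)"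
    unfolding far_arrows_def by (auto dest: arc_V)
  hence "card far_arrows \<le> card (V \<times> V)" by (rule surj_card_le[rotated]) (simp add: finite_V)
  thus "card far_arrows \<le> card V ^ 2" by (simp add: card_cartesian_product power2_eq_square)
qed

text \<open>For disjoint arrows the sets of tails and heads leave two orders and, if the crossing
  arcs are present, the other matching in two orders. Hence the weights 1/2 and 1/4, and four-cycles
  count half as much as for the polytope.\<close>

lemma card_pair_images:
  shows "2 * card ((\<lambda>(a, b, c). arrow a b + arrow a c) ` cherries E) = card (cherries E)" (is "2 * card (?f ` _) = _")
    and "2 * card ((\<lambda>(a, b, c). arrow b a + arrow c a) ` cherries E) = card (cherries E)" (is "2 * card (?g ` _) = _")
    and "4 * real (card ((\<lambda>(a, b, c, d). arrow a b + arrow c d) ` arc_pairs E))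
      = 2 * real (card (arc_pairs E)) - real (card (four_cycles E))" (is "4 * real (card (?h ` _)) = _")
proof -
  have "real (card (?f ` cherries E)) = (\<Sum>x\<in>cherries E. 1/2)"
  proof (rule card_image_fibre_weights[OF finite_tuples(3)])
    fix x assume x: "x \<in> cherries E"
    obtain a b c where xa: "x = (a, b, c)" by (cases x) auto
    have n: "a \<notin> {b, c}" "b \<noteq> c" using x xa by (auto simp: cherries_def)
    have "{y \<in> cherries E. ?f y = ?f x} = {(a, b, c), (a, c, b)}"
    proof (intro equalityI subsetI)
      fix y assume "y \<in> {y \<in> cherries E. ?f y = ?f x}"
      moreover obtain a' b' c' where ya: "y = (a', b', c')" by (cases y) auto
      ultimately have y: "a' \<notin> {b', c'}" "arrow a b + arrow a c = arrow a' b' + arrow a' c'" using xa by (auto simp: cherries_def)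
      have "{a, a} = {a', a'}" "{b, c} = {b', c'}"
      proof -
        have n': "a \<notin> {b, c}" and y': "a' \<notin> {b', c'}" using n y by blast+
        show "{a, a} = {a', a'}"
          by (rule trans[OF arrow_sum_coords(1)[OF n' n' refl] arrow_sum_coords(1)[OF y' y' y(2), symmetric]])
        show "{b, c} = {b', c'}"
          by (rule trans[OF arrow_sum_coords(2)[OF n' n' refl] arrow_sum_coords(2)[OF y' y' y(2), symmetric]])
      qed
      thus "y \<in> {(a, b, c), (a, c, b)}" by (auto simp: ya doubleton_eq_iff)
    qed (use x xa in \<open>auto simp: cherries_def add.commute\<close>)
    thus "(\<Sum>y\<in>{y \<in> cherries E. ?f y = ?f x}. 1 / 2 :: real) = 1" using n by simp
  qed
  thus f: "2 * card (?f ` cherries E) = card (cherries E)" by simp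
  have "?g ` cherries E = uminus ` ?f ` cherries E"
    unfolding image_image by (rule image_cong) (auto simp: arrow_def)
  hence "card (?g ` cherries E) = card (?f ` cherries E)"
    by (simp only: card_image[OF inj_uminus])
  thus "2 * card (?g ` cherries E) = card (cherries E)" using f by simp
  let ?w = "\<lambda>t. if t \<in> four_cycles E then 1/4 else 1/2 :: real"
  have "real (card (?h ` arc_pairs E)) = (\<Sum>t\<in>arc_pairs E. ?w t)"
  proof (rule card_image_fibre_weights[OF finite_tuples(1)])
    fix x assume x: "x \<in> arc_pairs E"
    obtain a b c d where xa: "x = (a, b, c, d)" by (cases x) auto
    have n: "a \<notin> {b, d}" "c \<notin> {b, d}" "a \<noteq> c" "b \<noteq> d" "{a, b} \<in> E" "{c, d} \<in> E"
      using x xa by (auto simp: arc_pairs_def)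
    have F: "{y \<in> arc_pairs E. ?h y = ?h x} = {(a, b, c, d), (c, d, a, b)} \<union>
        (if x \<in> four_cycles E then {(a, d, c, b), (c, b, a, d)} else {})" (is "?L = ?R")
    proof (intro equalityI subsetI)
      fix y assume y': "y \<in> ?L"
      moreover obtain a' b' c' d' where ya: "y = (a', b', c', d')" by (cases y) auto
      ultimately have y: "a' \<notin> {b', d'}" "c' \<notin> {b', d'}" "arrow a b + arrow c d = arrow a' b' + arrow c' d'"
        using xa by (auto simp: arc_pairs_def)
      have "{a, c} = {a', c'}" "{b, d} = {b', d'}"
      proof -
        show "{a, c} = {a', c'}"
          by (rule trans[OF arrow_sum_coords(1)[OF n(1) n(2) refl] arrow_sum_coords(1)[OF y, symmetric]])
        show "{b, d} = {b', d'}"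
          by (rule trans[OF arrow_sum_coords(2)[OF n(1) n(2) refl] arrow_sum_coords(2)[OF y, symmetric]])
      qed
      hence "y \<in> {(a, b, c, d), (c, d, a, b), (a, d, c, b), (c, b, a, d)}"
        by (auto simp: ya doubleton_eq_iff)
      moreover have "x \<in> four_cycles E" if "y \<in> {(a, d, c, b), (c, b, a, d)}"
        using that y' n xa by (auto simp: four_cycles_def arc_pairs_def insert_commute)
      ultimately show "y \<in> ?R" by auto
    next
      fix y assume "y \<in> ?R"
      moreover have "(a, d, c, b) \<in> arc_pairs E \<and> (c, b, a, d) \<in> arc_pairs E" if "x \<in> four_cycles E"
        using that xa by (auto simp: four_cycles_def arc_pairs_def insert_commute)
      moreover have "(c, d, a, b) \<in> arc_pairs E" using x xa by (auto simp: arc_pairs_def)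
      ultimately show "y \<in> ?L" using x xa by (auto simp: arrow_def algebra_simps split: if_splits)
    qed
    show "(\<Sum>y\<in>{y \<in> arc_pairs E. ?h y = ?h x}. ?w y) = 1"
    proof (cases "x \<in> four_cycles E")
      case True
      hence "(c, d, a, b) \<in> four_cycles E" "(a, d, c, b) \<in> four_cycles E" "(c, b, a, d) \<in> four_cycles E"
        using xa by (auto simp: four_cycles_def insert_commute)
      thus ?thesis unfolding F using True n xa by auto
    next
      case False
      hence "(c, d, a, b) \<notin> four_cycles E" using xa by (auto simp: four_cycles_def insert_commute)
      thus ?thesis unfolding F using False n xa by auto
    qed
  qed
  also have "\<dots> = (\<Sum>t\<in>arc_pairs E. 1/2) - (\<Sum>t\<in>arc_pairs E. if t \<in> four_cycles E then 1/4 else 0)"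
    by (subst sum_subtractf[symmetric]) (intro sum.cong, auto)
  also have "(\<Sum>t\<in>arc_pairs E. if t \<in> four_cycles E then 1/4 else 0) = (\<Sum>t\<in>four_cycles E. 1/4 :: real)"
  proof -
    have "arc_pairs E \<inter> four_cycles E = four_cycles E" by (auto simp: arc_pairs_def four_cycles_def)
    thus ?thesis using finite_tuples(1) by (simp add: sum.If_cases)
  qed
  finally show "4 * real (card (?h ` arc_pairs E)) = 2 * real (card (arc_pairs E)) - real (card (four_cycles E))"
    by (simp add: algebra_simps)
qed

lemma pair_sums_eq:
  "pair_sums E = arrows E \<union> far_arrows \<union> (\<lambda>(a, b, c). arrow a b + arrow a c) ` cherries E
    \<union> (\<lambda>(a, b, c). arrow b a + arrow c a) ` cherries E \<union> (\<lambda>(a, b, c, d). arrow a b + arrow c d) ` arc_pairs E"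
  (is "_ = ?A \<union> ?U \<union> ?B \<union> ?C \<union> ?D")
proof (intro equalityI subsetI)
  fix z assume "z \<in> pair_sums E"
  then obtain u w where uw: "z = u + w" "u \<in> insert 0 (arrows E)" "w \<in> insert 0 (arrows E)"
    and n: "\<And>v. v \<in> insert 0 (arrows E) \<Longrightarrow> z \<noteq> v + v" unfolding pair_sums_def by blast
  show "z \<in> ?A \<union> ?U \<union> ?B \<union> ?C \<union> ?D"
  proof (cases "u = 0 \<or> w = 0")
    case True
    thus ?thesis using uw n[of 0] by auto
  next
    case False
    then obtain a b c d where ab: "u = arrow a b" "w = arrow c d" "{a, b} \<in> E" "{c, d} \<in> E"
      using uw by (auto simp: arrows_def)
    have z: "z = arrow a b + arrow c d" using uw ab by simp
    have neq: "a \<noteq> b" "c \<noteq> d" using ab arc_neq by auto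
    have n1: "\<not> (a = c \<and> b = d)" using n[of u] uw ab by auto
    have n2: "\<not> (a = d \<and> b = c)" using n[of 0] z by (auto simp: arrow_def)
    consider "a \<noteq> c" "a \<noteq> d" "b \<noteq> c" "b \<noteq> d" | "a = c" "b \<noteq> d" | "b = d" "a \<noteq> c"
      | "b = c" "a \<noteq> d" | "a = d" "b \<noteq> c" using n1 n2 by auto
    thus ?thesis
    proof cases
      case 1
      hence "(a, b, c, d) \<in> arc_pairs E" using ab neq by (auto simp: arc_pairs_def)
      hence "z \<in> ?D" unfolding z by force
      thus ?thesis by blast
    next
      case 2
      hence "(a, b, d) \<in> cherries E" using ab neq by (auto simp: cherries_def)
      hence "z \<in> ?B" unfolding z 2 by force
      thus ?thesis by blast
    next
      case 3
      hence "(b, a, c) \<in> cherries E" using ab neq by (auto simp: cherries_def insert_commute)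
      hence "z \<in> ?C" unfolding z 3 by force
      thus ?thesis by blast
    next
      case 4
      hence "z = arrow a d" by (simp add: z arrow_def)
      moreover have "arrow a d \<in> ?A \<union> ?U"
      proof (cases "{a, d} \<in> E")
        case False
        hence "arrow a d \<in> ?U" using 4 ab unfolding far_arrows_def by blast
        thus ?thesis by blast
      qed (simp add: arrow_in_arrows)
      ultimately show ?thesis by blast
    next
      case 5
      hence "z = arrow c b" by (simp add: z arrow_def)
      moreover have "arrow c b \<in> ?A \<union> ?U"
      proof (cases "{c, b} \<in> E")
        case False
        hence "arrow c b \<in> ?U" using 5 ab unfolding far_arrows_def by blast
        thus ?thesis by blast
      qed (simp add: arrow_in_arrows)
      ultimately show ?thesis by blast
    qed
  qed
next
  \<comment> \<open>Twice a lattice point of the polytope has only entries 0, 2 and -2, so an entry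
    1 or -1 keeps a sum in \<open>pair_sums\<close>.\<close>
  have nonzero: "z \<noteq> v + v" if "coord z i = 1 \<or> coord z i = -1" "v \<in> insert 0 (arrows E)" for z v i
  proof
    assume "z = v + v"
    with that have v: "2 * coord v i = 1 \<or> 2 * coord v i = -1"
      by (simp only: lookup_add mult_2)
    have "coord v i \<in> {-1, 0, 1}" using that(2) by (auto simp: arrows_def lookup_arrow split: if_splits)
    with v show False by auto
  qed
  have sum: "u + w \<in> pair_sums E"
    if "u \<in> insert 0 (arrows E)" "w \<in> insert 0 (arrows E)"
      "coord (u + w) i = 1 \<or> coord (u + w) i = -1" for u w i
    using that nonzero[OF that(3)] unfolding pair_sums_def by blast
  fix z assume "z \<in> ?A \<union> ?U \<union> ?B \<union> ?C \<union> ?D"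
  then consider "z \<in> ?A" | "z \<in> ?U" | "z \<in> ?B" | "z \<in> ?C" | "z \<in> ?D" by blast
  thus "z \<in> pair_sums E"
  proof cases
    case 1
    then obtain a b where ab: "z = arrow a b" "{a, b} \<in> E" by (auto simp: arrows_def)
    have "0 + arrow a b \<in> pair_sums E"
      by (rule sum[of _ _ a]) (use ab arc_neq[OF ab(2)] arrow_in_arrows in \<open>auto simp: lookup_arrow\<close>)
    thus ?thesis using ab by simp
  next
    case 2
    then obtain a b c where ab: "z = arrow a c" "{a, b} \<in> E" "{b, c} \<in> E" "a \<noteq> c" by (auto simp: far_arrows_def)
    have "arrow a b + arrow b c \<in> pair_sums E"
      by (rule sum[of _ _ a]) (use ab arc_neq[OF ab(2)] arrow_in_arrows in \<open>auto simp: lookup_arrow lookup_add\<close>)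
    thus ?thesis using ab by (simp add: arrow_def)
  next
    case 3
    then obtain a b c where ab: "z = arrow a b + arrow a c" "{a, b} \<in> E" "{a, c} \<in> E" "b \<noteq> c" "a \<noteq> b"
      by (auto simp: cherries_def)
    show ?thesis unfolding ab(1)
      by (rule sum[of _ _ b]) (use ab arrow_in_arrows in \<open>auto simp: lookup_arrow lookup_add\<close>)
  next
    case 4
    then obtain a b c where ab: "z = arrow b a + arrow c a" "{b, a} \<in> E" "{c, a} \<in> E" "b \<noteq> c" "a \<noteq> b"
      by (auto simp: cherries_def insert_commute)
    show ?thesis unfolding ab(1)
      by (rule sum[of _ _ b]) (use ab arrow_in_arrows in \<open>auto simp: lookup_arrow lookup_add\<close>)
  next
    case 5
    then obtain a b c d where ab: "z = arrow a b + arrow c d" "{a, b} \<in> E" "{c, d} \<in> E" "a \<noteq> c" "a \<noteq> b" "a \<noteq> d"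
      by (auto simp: arc_pairs_def)
    show ?thesis unfolding ab(1)
      by (rule sum[of _ _ a]) (use ab arrow_in_arrows in \<open>auto simp: lookup_arrow lookup_add\<close>)
  qed
qed

lemma card_pair_sums:
  "4 * real (card (pair_sums E)) + real (card (four_cycles E))
    = 2 * real (card (arc_pairs E)) + 4 * real (card (cherries E)) + 8 * real (card E) + 4 * real (card far_arrows)"
proof -
  let ?A = "arrows E" and ?U = far_arrows
  let ?B = "(\<lambda>(a, b, c). arrow a b + arrow a c) ` cherries E"
  let ?C = "(\<lambda>(a, b, c). arrow b a + arrow c a) ` cherries E"
  let ?D = "(\<lambda>(a, b, c, d). arrow a b + arrow c d) ` arc_pairs E"
  have fU: "finite ?U"
    by (rule finite_subset[of _ "(\<lambda>(a, c). arrow a c) ` (V \<times> V)"])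
      (auto simp: finite_V far_arrows_def dest: arc_V)
  \<comment> \<open>The numbers of positive and negative entries separate the five classes, except
    for \<open>arrows E\<close> and \<open>far_arrows\<close>; these differ in whether the two ends
    form an arc.\<close>
  define npos where "npos x = (card {i. coord x i > 0}, card {i. coord x i < 0})" for x :: vec
  have npos1: "npos (arrow a b) = (1, 1)" if "a \<noteq> b" for a b
  proof -
    have "{i. coord (arrow a b) i > 0} = {a}" "{i. coord (arrow a b) i < 0} = {b}"
      using that by (auto simp: lookup_arrow split: if_splits)
    thus ?thesis by (simp add: npos_def)
  qed
  have npos2: "npos (arrow a b + arrow c d) = (card {a, c}, card {b, d})" if "a \<notin> {b, d}" "c \<notin> {b, d}" for a b c d
    unfolding npos_def arrow_sum_coords(1)[OF that refl, symmetric] arrow_sum_coords(2)[OF that refl, symmetric] ..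
  have A: "npos x = (1, 1)" if "x \<in> ?A \<union> ?U" for x
    using that arc_neq by (auto simp: arrows_def far_arrows_def npos1)
  have B: "npos x = (1, 2)" if xB: "x \<in> ?B" for x
  proof -
    obtain a b c where x: "x = arrow a b + arrow a c" "distinct [a, b, c]" using xB by (auto simp: cherries_def)
    show ?thesis unfolding x(1) by (subst npos2) (use x(2) in auto)
  qed
  have C: "npos x = (2, 1)" if xC: "x \<in> ?C" for x
  proof -
    obtain a b c where x: "x = arrow b a + arrow c a" "distinct [a, b, c]" using xC by (auto simp: cherries_def)
    show ?thesis unfolding x(1) by (subst npos2) (use x(2) in auto)
  qed
  have D: "npos x = (2, 2)" if xD: "x \<in> ?D" for x
  proof -
    obtain a b c d where x: "x = arrow a b + arrow c d" "distinct [a, b, c, d]" using xD by (auto simp: arc_pairs_def)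
    show ?thesis unfolding x(1) by (subst npos2) (use x(2) in auto)
  qed
  have disj: "?A \<inter> ?U = {}"
  proof -
    have False if "x \<in> ?A" "x \<in> ?U" for x
    proof -
      obtain a b where ab: "x = arrow a b" "{a, b} \<in> E" using \<open>x \<in> ?A\<close> by (auto simp: arrows_def)
      obtain a' c where "x = arrow a' c" "{a', c} \<notin> E" using \<open>x \<in> ?U\<close> by (auto simp: far_arrows_def)
      thus False using ab arrow_eq_iff[OF arc_neq[OF ab(2)], of a' c] by auto
    qed
    thus ?thesis by blast
  qed
  have sep: "X \<inter> Y = {}" if "\<And>x. x \<in> X \<Longrightarrow> npos x = p" "\<And>x. x \<in> Y \<Longrightarrow> npos x = q" "p \<noteq> q" for X Y p q
    using that by fastforce
  have "card (?A \<union> ?U \<union> ?B \<union> ?C \<union> ?D) = card ?A + card ?U + card ?B + card ?C + card ?D"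
  proof (rule card_Un_disjoint5)
    show "?A \<inter> ?B = {}" "?U \<inter> ?B = {}" by (rule sep[OF A B]; simp)+
    show "?A \<inter> ?C = {}" "?U \<inter> ?C = {}" by (rule sep[OF A C]; simp)+
    show "?A \<inter> ?D = {}" "?U \<inter> ?D = {}" by (rule sep[OF A D]; simp)+
    show "?B \<inter> ?C = {}" by (rule sep[OF B C]; simp)
    show "?B \<inter> ?D = {}" by (rule sep[OF B D]; simp)
    show "?C \<inter> ?D = {}" by (rule sep[OF C D]; simp)
  qed (use finite_tuples fU disj in auto)
  hence "real (card (pair_sums E)) = real (card ?A) + real (card ?U) + real (card ?B) + real (card ?C) + real (card ?D)"
    by (simp only: pair_sums_eq of_nat_add)
  moreover have "2 * real (card ?B) = real (card (cherries E))" "2 * real (card ?C) = real (card (cherries E))"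
    using arg_cong[OF card_pair_images(1), of real] arg_cong[OF card_pair_images(2), of real]
    by (simp_all only: of_nat_mult of_nat_numeral)
  moreover have "real (card ?A) = 2 * real (card E)" by (simp add: card_arrows)
  ultimately show ?thesis using card_pair_images(3) by linarith
qed

end


section \<open>Subgraph counts in the random graph\<close>

lemma finite_all_arcs: "finite V \<Longrightarrow> finite (all_arcs V)"
  by (rule finite_subset[of _ "Pow V"]) (auto simp: all_arcs_def)

lemma card_all_arcs: "finite V \<Longrightarrow> card (all_arcs V) = card V choose 2"
  unfolding all_arcs_def by (rule n_subsets)

lemma prod_bool_partition:
  fixes x y :: "'a::comm_monoid_mult"
  assumes "finite A" "E \<subseteq> A"
  shows "(\<Prod>e\<in>A. if e \<in> E then f e else g e) = prod f E * prod g (A - E)"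
proof -
  have "A \<inter> {e. e \<in> E} = E" "A \<inter> - {e. e \<in> E} = A - E" using assms(2) by auto
  thus ?thesis using assms(1) by (simp add: prod.If_cases)
qed

text \<open>The unnormalised q-biased Fourier-Walsh basis of the functions on graphs.\<close>

definition centered :: "real \<Rightarrow> nat set set \<Rightarrow> nat set set \<Rightarrow> real" where
  "centered q H E = (\<Prod>e\<in>H. of_bool (e \<in> E) - q)"

lemma centered_empty: "centered q {} = (\<lambda>E. 1)"
  by (simp add: centered_def fun_eq_iff)

locale random_graph_model =
  fixes n :: nat and q :: real
  assumes q_nonneg: "0 \<le> q" and q_le_1: "q \<le> 1"
begin

definition arcs :: "nat set set" where "arcs = all_arcs {1..n}"
abbreviation G :: "nat set set pmf" where "G \<equiv> random_graph n q"
abbreviation expect :: "(nat set set \<Rightarrow> real) \<Rightarrow> real" where "expect \<equiv> measure_pmf.expectation G"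
abbreviation cexpect :: "(nat set set \<Rightarrow> complex) \<Rightarrow> complex" where "cexpect \<equiv> measure_pmf.expectation G"

lemma finite_arcs: "finite arcs"
  by (simp add: arcs_def finite_all_arcs)

lemma random_graph_eq:
  "G = map_pmf (\<lambda>\<omega>. {e \<in> arcs. \<omega> e}) (Pi_pmf arcs False (\<lambda>_. bernoulli_pmf q))"
  by (simp only: random_graph_def arcs_def)

lemma set_random_graph: "set_pmf G \<subseteq> Pow arcs"
  by (auto simp: random_graph_eq)

lemma integrable_random_graph:
  fixes f :: "nat set set \<Rightarrow> 'b::{banach, second_countable_topology}"
  shows "integrable G f"
  by (rule integrable_measure_pmf_finite) (rule finite_subset[OF set_random_graph], simp add: finite_arcs)

lemma expectation_random_graph:
  fixes f :: "nat set set \<Rightarrow> 'b::{banach, second_countable_topology}"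
  shows "measure_pmf.expectation G f = (\<Sum>E\<in>Pow arcs. (q ^ card E * (1 - q) ^ card (arcs - E)) *\<^sub>R f E)"
proof -
  let ?\<chi> = "\<lambda>E e. e \<in> (E :: nat set set)"
  let ?P = "Pi_pmf arcs False (\<lambda>_. bernoulli_pmf q)"
  have inj: "inj_on ?\<chi> (Pow arcs)" by (auto simp: inj_on_def fun_eq_iff)
  have "measure_pmf.expectation G f = measure_pmf.expectation ?P (\<lambda>\<omega>. f {e \<in> arcs. \<omega> e})"
    by (simp add: random_graph_eq)
  also have "\<dots> = (\<Sum>\<omega>\<in>?\<chi> ` Pow arcs. pmf ?P \<omega> *\<^sub>R f {e \<in> arcs. \<omega> e})"
  proof (rule integral_measure_pmf)
    show "finite (?\<chi> ` Pow arcs)" by (simp add: finite_arcs)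
    fix \<omega> assume "\<omega> \<in> set_pmf ?P"
    hence "\<And>e. e \<notin> arcs \<Longrightarrow> \<not> \<omega> e" using set_Pi_pmf_subset[OF finite_arcs, of False] by auto
    hence "\<omega> = ?\<chi> {e \<in> arcs. \<omega> e}" by auto
    thus "\<omega> \<in> ?\<chi> ` Pow arcs" by blast
  qed
  also have "\<dots> = (\<Sum>E\<in>Pow arcs. pmf ?P (?\<chi> E) *\<^sub>R f {e \<in> arcs. ?\<chi> E e})"
    by (simp add: sum.reindex[OF inj])
  also have "\<dots> = (\<Sum>E\<in>Pow arcs. (q ^ card E * (1 - q) ^ card (arcs - E)) *\<^sub>R f E)"
  proof (rule sum.cong[OF refl])
    fix E assume "E \<in> Pow arcs"
    hence E: "E \<subseteq> arcs" by simp
    hence "{e \<in> arcs. ?\<chi> E e} = E" by auto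
    moreover have "pmf ?P (?\<chi> E) = q ^ card E * (1 - q) ^ card (arcs - E)"
    proof -
      have "pmf ?P (?\<chi> E) = (\<Prod>e\<in>arcs. pmf (bernoulli_pmf q) (e \<in> E))"
        using E finite_arcs by (intro pmf_Pi') auto
      also have "\<dots> = (\<Prod>e\<in>arcs. if e \<in> E then q else 1 - q)"
        using q_nonneg q_le_1 by (intro prod.cong) auto
      also have "\<dots> = q ^ card E * (1 - q) ^ card (arcs - E)"
        by (subst prod_bool_partition[OF finite_arcs E]) simp
      finally show ?thesis .
    qed
    ultimately show "pmf ?P (?\<chi> E) *\<^sub>R f {e \<in> arcs. ?\<chi> E e} = (q ^ card E * (1 - q) ^ card (arcs - E)) *\<^sub>R f E"
      by simp
  qed
  finally show ?thesis .
qed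

text \<open>Independence of the arcs. Values in a normed field let one identity serve both real
  moments and complex characteristic functions.\<close>

lemma expectation_prod:
  fixes g :: "nat set \<Rightarrow> bool \<Rightarrow> 'b::{real_normed_field, banach, second_countable_topology}"
  shows "measure_pmf.expectation G (\<lambda>E. \<Prod>e\<in>arcs. g e (e \<in> E))
    = (\<Prod>e\<in>arcs. of_real q * g e True + of_real (1 - q) * g e False)"
proof -
  have "measure_pmf.expectation G (\<lambda>E. \<Prod>e\<in>arcs. g e (e \<in> E))
      = (\<Sum>E\<in>Pow arcs. (\<Prod>e\<in>E. of_real q * g e True) * (\<Prod>e\<in>arcs - E. of_real (1 - q) * g e False))"
    unfolding expectation_random_graph
  proof (rule sum.cong[OF refl])
    fix E assume "E \<in> Pow arcs"
    hence E: "E \<subseteq> arcs" by simp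
    have "(\<Prod>e\<in>arcs. g e (e \<in> E)) = (\<Prod>e\<in>arcs. if e \<in> E then g e True else g e False)"
      by (intro prod.cong) auto
    also have "\<dots> = (\<Prod>e\<in>E. g e True) * (\<Prod>e\<in>arcs - E. g e False)"
      by (rule prod_bool_partition[OF finite_arcs E])
    finally have P: "(\<Prod>e\<in>arcs. g e (e \<in> E)) = (\<Prod>e\<in>E. g e True) * (\<Prod>e\<in>arcs - E. g e False)" .
    show "(q ^ card E * (1 - q) ^ card (arcs - E)) *\<^sub>R (\<Prod>e\<in>arcs. g e (e \<in> E))
        = (\<Prod>e\<in>E. of_real q * g e True) * (\<Prod>e\<in>arcs - E. of_real (1 - q) * g e False)"
      unfolding P by (simp only: prod.distrib prod_constant scaleR_conv_of_real of_real_mult of_real_power mult_ac)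
  qed
  also have "\<dots> = (\<Prod>e\<in>arcs. of_real q * g e True + of_real (1 - q) * g e False)"
    by (rule prod_add[OF finite_arcs, symmetric])
  finally show ?thesis .
qed

text \<open>An arc in exactly one of the sets contributes a factor of mean 0, an arc in both
  contributes the variance q (1 - q).\<close>

lemma expect_centered_mult:
  assumes "H \<subseteq> arcs" "H' \<subseteq> arcs"
  shows "expect (\<lambda>E. centered q H E * centered q H' E) = (if H = H' then (q * (1 - q)) ^ card H else 0)"
proof -
  let ?y = "\<lambda>S e b. if e \<in> S then of_bool b - q else 1"
  have c: "centered q S E = (\<Prod>e\<in>arcs. ?y S e (e \<in> E))" if "S \<subseteq> arcs" for S E
    using prod_bool_partition[OF finite_arcs that, of "\<lambda>e. of_bool (e \<in> E) - q" "\<lambda>_. 1"] by (simp add: centered_def)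
  have "expect (\<lambda>E. centered q H E * centered q H' E) = expect (\<lambda>E. \<Prod>e\<in>arcs. ?y H e (e \<in> E) * ?y H' e (e \<in> E))"
    by (simp only: c assms prod.distrib)
  also have "\<dots> = (\<Prod>e\<in>arcs. q * (?y H e True * ?y H' e True) + (1 - q) * (?y H e False * ?y H' e False))"
    by (subst expectation_prod) simp
  also have "\<dots> = (\<Prod>e\<in>arcs. if e \<in> H then if e \<in> H' then q * (1 - q) else 0 else if e \<in> H' then 0 else 1)"
    by (intro prod.cong) (auto simp: algebra_simps)
  also have "\<dots> = (if H = H' then (q * (1 - q)) ^ card H else 0)"
  proof (cases "H = H'")
    case True
    have "(\<Prod>e\<in>arcs. if e \<in> H then if e \<in> H' then q * (1 - q) else 0 else if e \<in> H' then 0 else 1)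
        = (\<Prod>e\<in>arcs. if e \<in> H then q * (1 - q) else 1)" using True by (intro prod.cong) auto
    also have "\<dots> = (q * (1 - q)) ^ card H" by (subst prod_bool_partition[OF finite_arcs assms(1)]) simp
    finally show ?thesis using True by simp
  next
    case False
    then obtain e where "e \<in> arcs" "e \<in> H \<longleftrightarrow> e \<notin> H'" using assms by blast
    hence "\<exists>e\<in>arcs. (if e \<in> H then if e \<in> H' then q * (1 - q) else 0 else if e \<in> H' then 0 else 1) = 0" by auto
    thus ?thesis using False finite_arcs by (simp only: if_False prod_zero)
  qed
  finally show ?thesis .
qed

lemma expect_sum: "expect (\<lambda>E. \<Sum>i\<in>I. f i E) = (\<Sum>i\<in>I. expect (f i))"
  by (rule Bochner_Integration.integral_sum) (rule integrable_random_graph)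

lemma expect_add: "expect (\<lambda>E. f E + g E) = expect f + expect g"
  by (rule Bochner_Integration.integral_add) (rule integrable_random_graph)+

lemma expect_diff: "expect (\<lambda>E. f E - g E) = expect f - expect g"
  by (rule Bochner_Integration.integral_diff) (rule integrable_random_graph)+

lemma expect_mono: "(\<And>E. E \<subseteq> arcs \<Longrightarrow> f E \<le> g E) \<Longrightarrow> expect f \<le> expect g"
  by (rule integral_mono_AE) (use set_random_graph in \<open>auto intro!: integrable_random_graph AE_pmfI\<close>)

lemma expect_cong: "(\<And>E. E \<subseteq> arcs \<Longrightarrow> f E = g E) \<Longrightarrow> expect f = expect g"
  by (rule integral_cong_AE) (use set_random_graph in \<open>auto intro!: AE_pmfI\<close>)

text \<open>Parseval's identity.\<close>

lemma expect_square_centered_sum: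
  assumes "\<H> \<subseteq> Pow arcs"
  shows "expect (\<lambda>E. (\<Sum>H\<in>\<H>. c H * centered q H E)\<^sup>2) = (\<Sum>H\<in>\<H>. (c H)\<^sup>2 * (q * (1 - q)) ^ card H)"
proof -
  have fin: "finite \<H>" using assms finite_arcs finite_subset by blast
  have "expect (\<lambda>E. (\<Sum>H\<in>\<H>. c H * centered q H E)\<^sup>2)
      = expect (\<lambda>E. \<Sum>H\<in>\<H>. \<Sum>H'\<in>\<H>. c H * c H' * (centered q H E * centered q H' E))"
    by (simp add: power2_eq_square sum_product algebra_simps)
  also have "\<dots> = (\<Sum>H\<in>\<H>. \<Sum>H'\<in>\<H>. c H * c H' * expect (\<lambda>E. centered q H E * centered q H' E))"
    by (simp add: expect_sum)
  also have "\<dots> = (\<Sum>H\<in>\<H>. \<Sum>H'\<in>\<H>. if H' = H then (c H)\<^sup>2 * (q * (1 - q)) ^ card H else 0)"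
  proof (intro sum.cong refl)
    fix H H' assume "H \<in> \<H>" "H' \<in> \<H>"
    hence "H \<subseteq> arcs" "H' \<subseteq> arcs" using assms by auto
    from expect_centered_mult[OF this]
    show "c H * c H' * expect (\<lambda>E. centered q H E * centered q H' E) = (if H' = H then (c H)\<^sup>2 * (q * (1 - q)) ^ card H else 0)"
      by (simp add: power2_eq_square)
  qed
  also have "\<dots> = (\<Sum>H\<in>\<H>. (c H)\<^sup>2 * (q * (1 - q)) ^ card H)" using fin by simp
  finally show ?thesis .
qed

end

text \<open>A labelled subgraph count: \<open>T\<close> holds the possible positions and
  \<open>es\<close> the arcs required at each. With a common number \<open>k\<close> of arcs, the
  expansion coefficient of \<open>H\<close> depends only on \<open>card H\<close> and the number of
  copies through \<open>H\<close>.\<close>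

locale subgraph_count = random_graph_model +
  fixes T :: "'t set" and es :: "'t \<Rightarrow> nat set set" and k :: nat
  assumes finite_T: "finite T" and es_arcs: "\<And>t. t \<in> T \<Longrightarrow> es t \<subseteq> arcs" and card_es: "\<And>t. t \<in> T \<Longrightarrow> card (es t) = k"
begin

definition copies :: "nat set set \<Rightarrow> real" where
  "copies E = real (card {t\<in>T. es t \<subseteq> E})"

definition extensions :: "nat set set \<Rightarrow> nat" where
  "extensions H = card {t\<in>T. H \<subseteq> es t}"

lemma extensions_empty: "extensions {} = card T"
  by (simp add: extensions_def)

lemma extensions_antimono: "H \<subseteq> H' \<Longrightarrow> extensions H' \<le> extensions H"
  unfolding extensions_def using finite_T by (intro card_mono) auto

lemma extensions_eq_0:
  assumes "k < card H" "H \<subseteq> arcs"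
  shows "extensions H = 0"
proof -
  have "\<not> H \<subseteq> es t" if "t \<in> T" for t
    using card_mono[of "es t" H] assms card_es[OF that] es_arcs[OF that] finite_arcs finite_subset by fastforce
  hence none: "{t\<in>T. H \<subseteq> es t} = {}" by auto
  show ?thesis unfolding extensions_def none by simp
qed

text \<open>Each indicator is written as its centred version plus \<open>q\<close>. After
  multiplying out, the coefficient of \<open>H\<close> collects the copies whose arcs contain
  \<open>H\<close>.\<close>

lemma copies_expansion:
  "copies E = (\<Sum>H\<in>Pow arcs. real (extensions H) * q ^ (k - card H) * centered q H E)"
proof -
  have one: "of_bool (es t \<subseteq> E) = (\<Sum>H\<in>Pow arcs. of_bool (H \<subseteq> es t) * (q ^ (k - card H) * centered q H E))" if t: "t \<in> T" for t
  proof -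
    have fin: "finite (es t)" using es_arcs[OF t] finite_arcs finite_subset by blast
    have "of_bool (es t \<subseteq> E) = (\<Prod>e\<in>es t. of_bool (e \<in> E) :: real)"
    proof (cases "es t \<subseteq> E")
      case True
      have "(\<Prod>e\<in>es t. of_bool (e \<in> E)) = (1::real)" by (rule prod.neutral) (use True in auto)
      thus ?thesis using True by simp
    next
      case False
      hence "\<exists>e\<in>es t. of_bool (e \<in> E) = (0::real)" by auto
      hence "(\<Prod>e\<in>es t. of_bool (e \<in> E)) = (0::real)" by (rule prod_zero[OF fin])
      thus ?thesis using False by simp
    qed
    also have "\<dots> = (\<Prod>e\<in>es t. (of_bool (e \<in> E) - q) + q)" by simp
    also have "\<dots> = (\<Sum>H\<in>Pow (es t). centered q H E * (\<Prod>e\<in>es t - H. q))"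
      unfolding centered_def by (rule prod_add[OF fin])
    also have "\<dots> = (\<Sum>H\<in>Pow (es t). q ^ (k - card H) * centered q H E)"
    proof (rule sum.cong[OF refl])
      fix H assume "H \<in> Pow (es t)"
      hence "card (es t - H) = k - card H" using card_Diff_subset[of H "es t"] fin card_es[OF t] finite_subset by auto
      thus "centered q H E * (\<Prod>e\<in>es t - H. q) = q ^ (k - card H) * centered q H E" by simp
    qed
    also have "\<dots> = (\<Sum>H\<in>Pow arcs. of_bool (H \<subseteq> es t) * (q ^ (k - card H) * centered q H E))"
      using es_arcs[OF t] finite_arcs by (intro sum.mono_neutral_cong_left) auto
    finally show ?thesis .
  qed
  have card_of_bool: "real (card {t\<in>T. P t}) = (\<Sum>t\<in>T. of_bool (P t))" for P
    using finite_T by (simp add: of_bool_def sum.If_cases Int_def)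
  have "copies E = (\<Sum>t\<in>T. \<Sum>H\<in>Pow arcs. of_bool (H \<subseteq> es t) * (q ^ (k - card H) * centered q H E))"
    unfolding copies_def card_of_bool by (intro sum.cong refl one)
  also have "\<dots> = (\<Sum>H\<in>Pow arcs. \<Sum>t\<in>T. of_bool (H \<subseteq> es t) * (q ^ (k - card H) * centered q H E))"
    by (rule sum.swap)
  also have "\<dots> = (\<Sum>H\<in>Pow arcs. real (extensions H) * q ^ (k - card H) * centered q H E)"
    unfolding extensions_def card_of_bool by (simp add: sum_distrib_right mult.assoc)
  finally show ?thesis .
qed

text \<open>Double counting: every copy contains 2^k sets of arcs.\<close>

lemma sum_extensions: "(\<Sum>H\<in>Pow arcs. extensions H) = card T * 2 ^ k"
proof -
  have "(\<Sum>H\<in>Pow arcs. extensions H) = (\<Sum>H\<in>Pow arcs. \<Sum>t\<in>T. of_bool (H \<subseteq> es t))"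
    unfolding extensions_def using finite_T by (simp add: of_bool_def sum.If_cases Int_def)
  also have "\<dots> = (\<Sum>t\<in>T. \<Sum>H\<in>Pow arcs. of_bool (H \<subseteq> es t))" by (rule sum.swap)
  also have "\<dots> = (\<Sum>t\<in>T. 2 ^ k)"
  proof (rule sum.cong[OF refl])
    fix t assume t: "t \<in> T"
    have "(\<Sum>H\<in>Pow arcs. of_bool (H \<subseteq> es t)) = card (Pow arcs \<inter> {H. H \<subseteq> es t})"
      using finite_arcs by (simp add: of_bool_def sum.If_cases)
    also have "Pow arcs \<inter> {H. H \<subseteq> es t} = Pow (es t)" using es_arcs[OF t] by auto
    also have "card \<dots> = 2 ^ k"
      using card_Pow[of "es t"] card_es[OF t] es_arcs[OF t] finite_arcs finite_subset by metis
    finally show "(\<Sum>H\<in>Pow arcs. of_bool (H \<subseteq> es t)) = (2::nat) ^ k" .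
  qed
  finally show ?thesis by simp
qed

text \<open>\<open>L\<close> holds the terms that are split off. In Parseval's sum over the others,
  one factor \<open>extensions H\<close> is bounded by \<open>B\<close> and the second is summed by
  \<open>sum_extensions\<close>.\<close>

lemma expect_square_projection:
  assumes B: "\<And>H. H \<subseteq> arcs \<Longrightarrow> H \<notin> L \<Longrightarrow> extensions H \<le> B" and L: "L \<subseteq> Pow arcs"
  shows "expect (\<lambda>E. (copies E - (\<Sum>H\<in>L. real (extensions H) * q ^ (k - card H) * centered q H E))\<^sup>2)
    \<le> 2 ^ k * real B * real (card T) * q ^ k"
proof -
  let ?c = "\<lambda>H. real (extensions H) * q ^ (k - card H)"
  have "expect (\<lambda>E. (copies E - (\<Sum>H\<in>L. ?c H * centered q H E))\<^sup>2)
      = expect (\<lambda>E. (\<Sum>H\<in>Pow arcs - L. ?c H * centered q H E)\<^sup>2)"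
    unfolding copies_expansion using L finite_arcs by (simp add: sum_diff)
  also have "\<dots> = (\<Sum>H\<in>Pow arcs - L. (?c H)\<^sup>2 * (q * (1 - q)) ^ card H)"
    by (rule expect_square_centered_sum) auto
  also have "\<dots> \<le> (\<Sum>H\<in>Pow arcs - L. real (extensions H) * real B * q ^ k)"
  proof (rule sum_mono)
    fix H assume H: "H \<in> Pow arcs - L"
    show "(?c H)\<^sup>2 * (q * (1 - q)) ^ card H \<le> real (extensions H) * real B * q ^ k"
    proof (cases "card H \<le> k")
      case False
      thus ?thesis using extensions_eq_0[of H] H by simp
    next
      case True
      have "(q * (1 - q)) ^ card H \<le> q ^ card H"
        using q_nonneg q_le_1 by (intro power_mono) (auto simp: mult_left_le)
      hence "(?c H)\<^sup>2 * (q * (1 - q)) ^ card H \<le> (?c H)\<^sup>2 * q ^ card H" by (intro mult_left_mono) auto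
      \<comment> \<open>The square supplies the exponent \<open>k - card H\<close> twice: one of
        them completes \<open>card H\<close> to \<open>k\<close>, the other power is at most
        1.\<close>
      also have "\<dots> = (real (extensions H))\<^sup>2 * (q ^ (k - card H) * q ^ ((k - card H) + card H))"
        by (simp add: power2_eq_square power_add)
      also have "\<dots> = (real (extensions H))\<^sup>2 * (q ^ (k - card H) * q ^ k)" using True by simp
      also have "\<dots> \<le> (real (extensions H))\<^sup>2 * (1 * q ^ k)"
        using q_nonneg q_le_1 by (intro mult_left_mono mult_right_mono power_le_one) auto
      also have "\<dots> = real (extensions H) * real (extensions H) * q ^ k" by (simp add: power2_eq_square)
      also have "\<dots> \<le> real (extensions H) * real B * q ^ k"
        using B[of H] H q_nonneg by (intro mult_left_mono mult_right_mono) auto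
      finally show ?thesis .
    qed
  qed
  also have "\<dots> \<le> (\<Sum>H\<in>Pow arcs. real (extensions H) * real B * q ^ k)"
    using finite_arcs q_nonneg by (intro sum_mono2) auto
  also have "\<dots> = real (\<Sum>H\<in>Pow arcs. extensions H) * real B * q ^ k"
    by (simp only: sum_distrib_right of_nat_sum)
  also have "\<dots> = 2 ^ k * real B * real (card T) * q ^ k" unfolding sum_extensions by simp
  finally show ?thesis .
qed

lemma expect_copies: "expect copies = real (card T) * q ^ k"
proof -
  have "expect (centered q H) = of_bool (H = {})" if "H \<subseteq> arcs" for H
    using expect_centered_mult[of "{}" H] that by (cases "H = {}") (simp_all add: centered_empty)
  hence "expect copies = (\<Sum>H\<in>Pow arcs. real (extensions H) * q ^ (k - card H) * of_bool (H = {}))"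
    unfolding copies_expansion by (simp add: expect_sum)
  also have "\<dots> = (\<Sum>H\<in>Pow arcs. if H = {} then real (card T) * q ^ k else 0)"
    by (intro sum.cong) (auto simp: extensions_empty)
  also have "\<dots> = real (card T) * q ^ k" using finite_arcs by simp
  finally show ?thesis .
qed

lemma variance_copies_le:
  assumes "\<And>e. e \<in> arcs \<Longrightarrow> extensions {e} \<le> B"
  shows "expect (\<lambda>E. (copies E - real (card T) * q ^ k)\<^sup>2) \<le> 2 ^ k * real B * real (card T) * q ^ k"
proof -
  have "expect (\<lambda>E. (copies E - (\<Sum>H\<in>{{}}. real (extensions H) * q ^ (k - card H) * centered q H E))\<^sup>2)
    \<le> 2 ^ k * real B * real (card T) * q ^ k"
  proof (rule expect_square_projection)
    fix H assume "H \<subseteq> arcs" "H \<notin> {{}}"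
    then obtain e where e: "e \<in> arcs" "{e} \<subseteq> H" by blast
    show "extensions H \<le> B" by (rule order_trans[OF extensions_antimono[OF e(2)] assms[OF e(1)]])
  qed auto
  thus ?thesis by (simp add: centered_def extensions_empty)
qed

text \<open>Apart from the empty set and the singletons every set contains two distinct arcs, so a
  bound for pairs controls all remaining terms.\<close>

lemma linear_approximation:
  assumes D: "\<And>e. e \<in> arcs \<Longrightarrow> extensions {e} = D"
    and B: "\<And>e f. e \<in> arcs \<Longrightarrow> f \<in> arcs \<Longrightarrow> e \<noteq> f \<Longrightarrow> extensions {e, f} \<le> B"
  shows "expect (\<lambda>E. (copies E - real (card T) * q ^ k - real D * q ^ (k - 1) * (\<Sum>e\<in>arcs. of_bool (e \<in> E) - q))\<^sup>2)
    \<le> 2 ^ k * real B * real (card T) * q ^ k"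
proof -
  let ?L = "insert {} ((\<lambda>e. {e}) ` arcs)"
  have "expect (\<lambda>E. (copies E - (\<Sum>H\<in>?L. real (extensions H) * q ^ (k - card H) * centered q H E))\<^sup>2)
    \<le> 2 ^ k * real B * real (card T) * q ^ k"
  proof (rule expect_square_projection)
    fix H assume H: "H \<subseteq> arcs" "H \<notin> ?L"
    then obtain e where "e \<in> H" by blast
    moreover have "H \<noteq> {e}" using H calculation by blast
    ultimately obtain f where ef: "e \<in> H" "f \<in> H" "e \<noteq> f" by blast
    hence sub: "{e, f} \<subseteq> H" and "e \<in> arcs" "f \<in> arcs" using H by auto
    show "extensions H \<le> B"
      by (rule order_trans[OF extensions_antimono[OF sub] B[OF \<open>e \<in> arcs\<close> \<open>f \<in> arcs\<close> ef(3)]])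
  qed auto
  also have "(\<lambda>E. (copies E - (\<Sum>H\<in>?L. real (extensions H) * q ^ (k - card H) * centered q H E))\<^sup>2)
    = (\<lambda>E. (copies E - real (card T) * q ^ k - real D * q ^ (k - 1) * (\<Sum>e\<in>arcs. of_bool (e \<in> E) - q))\<^sup>2)"
  proof
    fix E
    have "(\<Sum>H\<in>?L. real (extensions H) * q ^ (k - card H) * centered q H E)
        = real (card T) * q ^ k + (\<Sum>e\<in>arcs. real D * q ^ (k - 1) * (of_bool (e \<in> E) - q))"
      using finite_arcs by (subst sum.insert) (auto simp: extensions_empty centered_def sum.reindex D intro!: sum.cong)
    thus "(copies E - (\<Sum>H\<in>?L. real (extensions H) * q ^ (k - card H) * centered q H E))\<^sup>2
      = (copies E - real (card T) * q ^ k - real D * q ^ (k - 1) * (\<Sum>e\<in>arcs. of_bool (e \<in> E) - q))\<^sup>2"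
      by (simp add: sum_distrib_left algebra_simps)
  qed
  finally show ?thesis .
qed

end

section \<open>Enumeration of tuples of distinct nodes\<close>

abbreviation pair_arcs :: "nat \<times> nat \<times> nat \<times> nat \<Rightarrow> nat set set" where
  "pair_arcs \<equiv> \<lambda>(a, b, c, d). {{a, b}, {c, d}}"

abbreviation cycle_arcs :: "nat \<times> nat \<times> nat \<times> nat \<Rightarrow> nat set set" where
  "cycle_arcs \<equiv> \<lambda>(a, b, c, d). {{a, b}, {b, c}, {c, d}, {d, a}}"

abbreviation cherry_arcs :: "nat \<times> nat \<times> nat \<Rightarrow> nat set set" where
  "cherry_arcs \<equiv> \<lambda>(a, b, c). {{a, b}, {a, c}}"

definition inj4 :: "nat \<Rightarrow> (nat \<times> nat \<times> nat \<times> nat) set" where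
  "inj4 n = {(a, b, c, d). a \<in> {1..n} \<and> b \<in> {1..n} \<and> c \<in> {1..n} \<and> d \<in> {1..n} \<and> distinct [a, b, c, d]}"

definition inj3 :: "nat \<Rightarrow> (nat \<times> nat \<times> nat) set" where
  "inj3 n = {(a, b, c). a \<in> {1..n} \<and> b \<in> {1..n} \<and> c \<in> {1..n} \<and> distinct [a, b, c]}"

lemma card_off_diagonal:
  assumes "finite W"
  shows "card {(c, d). c \<in> W \<and> d \<in> W \<and> c \<noteq> d} = card W * (card W - 1)"
proof -
  have "{(c, d). c \<in> W \<and> d \<in> W \<and> c \<noteq> d} = W \<times> W - (\<lambda>x. (x, x)) ` W" by auto
  also have "card \<dots> = card (W \<times> W) - card ((\<lambda>x. (x, x)) ` W)"
    using assms by (intro card_Diff_subset) auto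
  also have "card ((\<lambda>x. (x, x)) ` W) = card W" by (rule card_image) (simp add: inj_on_def)
  finally show ?thesis by (simp add: card_cartesian_product diff_mult_distrib2)
qed

lemma finite_inj4: "finite (inj4 n)"
  by (rule finite_subset[of _ "{1..n} \<times> {1..n} \<times> {1..n} \<times> {1..n}"]) (auto simp: inj4_def)

lemma finite_inj3: "finite (inj3 n)"
  by (rule finite_subset[of _ "{1..n} \<times> {1..n} \<times> {1..n}"]) (auto simp: inj3_def)

lemma card_inj3_le: "card (inj3 n) \<le> n ^ 3"
proof -
  have "card (inj3 n) \<le> card ({1..n} \<times> {1..n} \<times> {1..n})"
    by (intro card_mono) (auto simp: inj3_def)
  also have "\<dots> = n ^ 3" by (simp add: card_cartesian_product power3_eq_cube)
  finally show ?thesis .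
qed

lemma card_inj4: "card (inj4 n) = n * (n - 1) * ((n - 2) * (n - 3))"
proof -
  let ?P = "{(a, b). a \<in> {1..n} \<and> b \<in> {1..n} \<and> a \<noteq> b}"
  let ?R = "\<lambda>(a, b). {(c, d). c \<in> {1..n} - {a, b} \<and> d \<in> {1..n} - {a, b} \<and> c \<noteq> d}"
  have "bij_betw (\<lambda>(a, b, c, d). ((a, b), (c, d))) (inj4 n) (Sigma ?P ?R)"
    by (rule bij_betw_byWitness[where f' = "\<lambda>((a, b), (c, d)). (a, b, c, d)"]) (auto simp: inj4_def)
  hence "card (inj4 n) = card (Sigma ?P ?R)" by (rule bij_betw_same_card)
  also have "\<dots> = (\<Sum>x\<in>?P. card (?R x))"
    by (rule card_SigmaI)
      (auto intro: finite_subset[of _ "{1..n} \<times> {1..n}"])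
  also have "\<dots> = (\<Sum>x\<in>?P. (n - 2) * (n - 3))"
  proof (rule sum.cong[OF refl])
    fix x assume "x \<in> ?P"
    then obtain a b where x: "x = (a, b)" "a \<in> {1..n}" "b \<in> {1..n}" "a \<noteq> b" by auto
    have "card ({1..n} - {a, b}) = n - 2" using x by (subst card_Diff_subset) auto
    thus "card (?R x) = (n - 2) * (n - 3)"
      using card_off_diagonal[of "{1..n} - {a, b}"] x(1) by simp
  qed
  also have "\<dots> = n * (n - 1) * ((n - 2) * (n - 3))"
    using card_off_diagonal[of "{1..n}"] by simp
  finally show ?thesis .
qed

lemma card_inj4_le: "card (inj4 n) \<le> n ^ 4"
proof -
  have "card (inj4 n) \<le> card ({1..n} \<times> {1..n} \<times> {1..n} \<times> {1..n})"
    by (intro card_mono) (auto simp: inj4_def)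
  also have "\<dots> = n ^ 4" by (simp add: card_cartesian_product power4_eq_xxxx)
  finally show ?thesis .
qed

definition inj4_at :: "nat \<Rightarrow> nat set \<Rightarrow> (nat \<times> nat \<times> nat \<times> nat) set" where
  "inj4_at n e = {(a, b, c, d) \<in> inj4 n. {a, b} = e}"

lemma card_inj4_at:
  assumes "e \<in> all_arcs {1..n}"
  shows "card (inj4_at n e) = 2 * ((n - 2) * (n - 3))"
proof -
  obtain x y where e: "e = {x, y}" "x \<noteq> y" "x \<in> {1..n}" "y \<in> {1..n}"
    using assms by (auto simp: all_arcs_def card_2_iff)
  let ?W = "{1..n} - {x, y}"
  have "bij_betw (\<lambda>(a, b, c, d). ((a, b), (c, d))) (inj4_at n e)
      ({(x, y), (y, x)} \<times> {(c, d). c \<in> ?W \<and> d \<in> ?W \<and> c \<noteq> d})"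
    by (rule bij_betw_byWitness[where f' = "\<lambda>((a, b), (c, d)). (a, b, c, d)"])
      (use e in \<open>auto simp: inj4_def inj4_at_def doubleton_eq_iff\<close>)
  hence "card (inj4_at n e) = card ({(x, y), (y, x)} \<times> {(c, d). c \<in> ?W \<and> d \<in> ?W \<and> c \<noteq> d})"
    by (rule bij_betw_same_card)
  also have "\<dots> = card {(x, y), (y, x)} * (card ?W * (card ?W - 1))"
    using card_off_diagonal[of ?W] by (simp only: card_cartesian_product finite_Diff finite_atLeastAtMost)
  also have "card ?W = n - 2" using e by (subst card_Diff_subset) auto
  finally show ?thesis using e(2) by simp
qed

lemma card_preimage_bij:
  assumes "bij_betw g S S" "P \<subseteq> S"
  shows "card {t\<in>S. g t \<in> P} = card P"
proof (rule bij_betw_same_card)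
  show "bij_betw g {t\<in>S. g t \<in> P} P"
    unfolding bij_betw_def
  proof
    show "inj_on g {t\<in>S. g t \<in> P}"
      using assms(1) unfolding bij_betw_def by (auto intro: inj_on_subset)
    show "g ` {t\<in>S. g t \<in> P} = P"
    proof (intro equalityI subsetI)
      fix y assume y: "y \<in> P"
      hence "y \<in> g ` S" using assms unfolding bij_betw_def by auto
      then obtain t where "t \<in> S" "y = g t" by auto
      thus "y \<in> g ` {t\<in>S. g t \<in> P}" using y by auto
    qed auto
  qed
qed

text \<open>Permutes the four sides of a tuple cyclically, so that the count for the side
  \<open>{a, b}\<close> carries over to the other three.\<close>

definition rotate4 :: "nat \<times> nat \<times> nat \<times> nat \<Rightarrow> nat \<times> nat \<times> nat \<times> nat" where
  "rotate4 = (\<lambda>(a, b, c, d). (b, c, d, a))"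

lemma bij_rotate4: "bij_betw rotate4 (inj4 n) (inj4 n)"
  by (rule bij_betw_byWitness[where f' = "\<lambda>(a, b, c, d). (d, a, b, c)"]) (auto simp: rotate4_def inj4_def)

lemma card_inj4_rotated:
  assumes "e \<in> all_arcs {1..n}"
  shows "card {(a, b, c, d) \<in> inj4 n. {b, c} = e} = 2 * ((n - 2) * (n - 3))"
    "card {(a, b, c, d) \<in> inj4 n. {c, d} = e} = 2 * ((n - 2) * (n - 3))"
    "card {(a, b, c, d) \<in> inj4 n. {d, a} = e} = 2 * ((n - 2) * (n - 3))"
proof -
  have sub: "inj4_at n e \<subseteq> inj4 n" by (auto simp: inj4_at_def)
  note r1 = bij_rotate4[of n]
  note r2 = bij_betw_trans[OF r1 r1]
  note r3 = bij_betw_trans[OF r2 r1]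
  have "{(a, b, c, d) \<in> inj4 n. {b, c} = e} = {t\<in>inj4 n. rotate4 t \<in> inj4_at n e}"
    by (auto simp: rotate4_def inj4_at_def inj4_def)
  thus "card {(a, b, c, d) \<in> inj4 n. {b, c} = e} = 2 * ((n - 2) * (n - 3))"
    by (simp only: card_preimage_bij[OF r1 sub] card_inj4_at[OF assms])
  have "{(a, b, c, d) \<in> inj4 n. {c, d} = e} = {t\<in>inj4 n. (rotate4 \<circ> rotate4) t \<in> inj4_at n e}"
    by (auto simp: rotate4_def inj4_at_def inj4_def)
  thus "card {(a, b, c, d) \<in> inj4 n. {c, d} = e} = 2 * ((n - 2) * (n - 3))"
    by (simp only: card_preimage_bij[OF r2 sub] card_inj4_at[OF assms])
  have "{(a, b, c, d) \<in> inj4 n. {d, a} = e} = {t\<in>inj4 n. (rotate4 \<circ> (rotate4 \<circ> rotate4)) t \<in> inj4_at n e}"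
    by (auto simp: rotate4_def inj4_at_def inj4_def)
  thus "card {(a, b, c, d) \<in> inj4 n. {d, a} = e} = 2 * ((n - 2) * (n - 3))"
    by (simp only: card_preimage_bij[OF r3 sub] card_inj4_at[OF assms])
qed

text \<open>The upper bound limits the tuples through two given arcs; the lower bound says that two
  nodes cannot carry both.\<close>

lemma card_union_arcs:
  assumes "e \<in> all_arcs V" "f \<in> all_arcs V" "e \<noteq> f"
  shows "finite (e \<union> f)" "card (e \<union> f) \<le> 4" "3 \<le> card (e \<union> f)"
proof -
  have c: "card e = 2" "card f = 2" using assms by (auto simp: all_arcs_def)
  hence fin: "finite e" "finite f" by (auto intro: card_ge_0_finite)
  show "finite (e \<union> f)" using fin by simp
  show "card (e \<union> f) \<le> 4" using card_Un_le[of e f] c by simp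
  show "3 \<le> card (e \<union> f)"
  proof (rule ccontr)
    assume "\<not> 3 \<le> card (e \<union> f)"
    hence "card (e \<union> f) \<le> 2" by simp
    hence "e = e \<union> f" "f = e \<union> f" using c fin by (intro card_seteq; auto)+
    thus False using assms(3) by simp
  qed
qed

section \<open>Approximation of the subgraph counts\<close>

context random_graph_model
begin

lemma subgraph_count_arc_pairs: "subgraph_count n q (inj4 n) pair_arcs 2"
  by unfold_locales (rule finite_inj4, auto simp: inj4_def arcs_def all_arcs_def doubleton_eq_iff)

lemma subgraph_count_four_cycles: "subgraph_count n q (inj4 n) cycle_arcs 4"
  by unfold_locales (rule finite_inj4, auto simp: inj4_def arcs_def all_arcs_def doubleton_eq_iff card_insert_if)

lemma subgraph_count_cherries: "subgraph_count n q (inj3 n) cherry_arcs 2"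
  by unfold_locales (rule finite_inj3, auto simp: inj3_def arcs_def all_arcs_def doubleton_eq_iff)

lemma subgraph_count_arcs: "subgraph_count n q arcs (\<lambda>e. {e}) 1"
  by unfold_locales (auto simp: finite_arcs)

lemma arc_in_arcs: "E \<subseteq> arcs \<Longrightarrow> {a, b} \<in> E \<Longrightarrow> a \<in> {1..n} \<and> b \<in> {1..n}"
  by (auto simp: arcs_def all_arcs_def)

lemma card_arc_pairs:
  assumes "E \<subseteq> arcs"
  shows "real (card (arc_pairs E)) = subgraph_count.copies (inj4 n) pair_arcs E"
proof -
  have "arc_pairs E = {t\<in>inj4 n. pair_arcs t \<subseteq> E}"
    by (auto simp: arc_pairs_def inj4_def dest: arc_in_arcs[OF assms])
  thus ?thesis by (simp only: subgraph_count.copies_def[OF subgraph_count_arc_pairs])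
qed

lemma card_four_cycles:
  assumes "E \<subseteq> arcs"
  shows "real (card (four_cycles E)) = subgraph_count.copies (inj4 n) cycle_arcs E"
proof -
  have "four_cycles E = {t\<in>inj4 n. cycle_arcs t \<subseteq> E}"
    by (auto simp: four_cycles_def inj4_def dest: arc_in_arcs[OF assms])
  thus ?thesis by (simp only: subgraph_count.copies_def[OF subgraph_count_four_cycles])
qed

lemma card_cherries:
  assumes "E \<subseteq> arcs"
  shows "real (card (cherries E)) = subgraph_count.copies (inj3 n) cherry_arcs E"
proof -
  have "cherries E = {t\<in>inj3 n. cherry_arcs t \<subseteq> E}"
    by (auto simp: cherries_def inj3_def dest: arc_in_arcs[OF assms])
  thus ?thesis by (simp only: subgraph_count.copies_def[OF subgraph_count_cherries])
qed

lemma card_graph: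
  assumes "E \<subseteq> arcs"
  shows "real (card E) = subgraph_count.copies arcs (\<lambda>e. {e}) E"
proof -
  have "E = {e\<in>arcs. {e} \<subseteq> E}" using assms by auto
  thus ?thesis by (simp only: subgraph_count.copies_def[OF subgraph_count_arcs])
qed

abbreviation arc_sum :: "nat set set \<Rightarrow> real" where
  "arc_sum E \<equiv> \<Sum>e\<in>arcs. of_bool (e \<in> E) - q"

text \<open>A given arc can stand in two positions. Two distinct arcs use up all four entries, which
  leaves at most 4^4 = 256 tuples; 1024 is 2^2 * 256.\<close>

lemma arc_pairs_approximation:
  "expect (\<lambda>E. (real (card (arc_pairs E)) - real (card (inj4 n)) * q\<^sup>2
      - 4 * real ((n - 2) * (n - 3)) * q * arc_sum E)\<^sup>2) \<le> 1024 * real n ^ 4 * q\<^sup>2"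
proof -
  interpret S: subgraph_count n q "inj4 n" pair_arcs 2
    by (rule subgraph_count_arc_pairs)
  have D: "S.extensions {e} = 4 * ((n - 2) * (n - 3))" if "e \<in> arcs" for e
  proof -
    have e: "e \<in> all_arcs {1..n}" using that by (simp only: arcs_def)
    have "S.extensions {e} = card (inj4_at n e \<union> {(a, b, c, d) \<in> inj4 n. {c, d} = e})"
      unfolding S.extensions_def by (rule arg_cong[of _ _ card]) (auto simp: inj4_at_def)
    also have "\<dots> = card (inj4_at n e) + card {(a, b, c, d) \<in> inj4 n. {c, d} = e}"
      by (rule card_Un_disjoint)
        (auto simp: inj4_at_def inj4_def doubleton_eq_iff intro!: finite_subset[OF _ finite_inj4[of n]])
    finally show ?thesis by (simp only: card_inj4_at[OF e] card_inj4_rotated(2)[OF e])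
  qed
  have B: "S.extensions {e, f} \<le> 256" if ef: "e \<in> arcs" "f \<in> arcs" "e \<noteq> f" for e f
  proof -
    let ?U = "e \<union> f"
    note U = card_union_arcs[OF ef[unfolded arcs_def]]
    have "S.extensions {e, f} \<le> card (?U \<times> ?U \<times> ?U \<times> ?U)"
      unfolding S.extensions_def using U(1) ef(3) by (intro card_mono) auto
    also have "\<dots> = card ?U ^ 4" by (simp add: card_cartesian_product power4_eq_xxxx)
    also have "\<dots> \<le> 4 ^ 4" using U(2) by (intro power_mono) auto
    finally show ?thesis by simp
  qed
  have "expect (\<lambda>E. (real (card (arc_pairs E)) - real (card (inj4 n)) * q\<^sup>2
      - 4 * real ((n - 2) * (n - 3)) * q * arc_sum E)\<^sup>2)
    = expect (\<lambda>E. (S.copies E - real (card (inj4 n)) * q\<^sup>2 - real (4 * ((n - 2) * (n - 3))) * q ^ (2 - 1) * arc_sum E)\<^sup>2)"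
    by (rule expect_cong) (simp add: card_arc_pairs)
  also have "\<dots> \<le> 2 ^ 2 * real 256 * real (card (inj4 n)) * q\<^sup>2"
    by (rule S.linear_approximation[OF D B])
  also have "\<dots> \<le> 2 ^ 2 * real 256 * real (n ^ 4) * q\<^sup>2"
    by (intro mult_right_mono mult_left_mono) (use card_inj4_le in \<open>simp_all only: of_nat_le_iff zero_le_power2\<close>, simp)
  finally show ?thesis by simp
qed

text \<open>A given arc can stand in four positions. Two distinct sides cover at least three
  entries, so at most one entry is free: 4 * n * 4^3 = 256 n tuples, and 4096 is 2^4 * 256.\<close>

lemma four_cycles_approximation:
  "expect (\<lambda>E. (real (card (four_cycles E)) - real (card (inj4 n)) * q ^ 4
      - 8 * real ((n - 2) * (n - 3)) * q ^ 3 * arc_sum E)\<^sup>2) \<le> 4096 * real n ^ 5 * q ^ 4"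
proof -
  interpret S: subgraph_count n q "inj4 n" cycle_arcs 4
    by (rule subgraph_count_four_cycles)
  have D: "S.extensions {e} = 8 * ((n - 2) * (n - 3))" if "e \<in> arcs" for e
  proof -
    have e: "e \<in> all_arcs {1..n}" using that by (simp only: arcs_def)
    let ?B = "{(a, b, c, d) \<in> inj4 n. {b, c} = e}"
    let ?C = "{(a, b, c, d) \<in> inj4 n. {c, d} = e}"
    let ?D = "{(a, b, c, d) \<in> inj4 n. {d, a} = e}"
    have fin: "finite (inj4_at n e)" "finite ?B" "finite ?C" "finite ?D"
      by (auto simp: inj4_at_def intro!: finite_subset[OF _ finite_inj4[of n]])
    \<comment> \<open>The empty set pads the union to the five sets of
      \<open>card_Un_disjoint5\<close>.\<close>
    have "S.extensions {e} = card (inj4_at n e \<union> ?B \<union> ?C \<union> ?D \<union> {})"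
      unfolding S.extensions_def by (rule arg_cong[of _ _ card]) (auto simp: inj4_at_def)
    also have "\<dots> = card (inj4_at n e) + card ?B + card ?C + card ?D + card ({} :: (nat \<times> nat \<times> nat \<times> nat) set)"
      by (rule card_Un_disjoint5)
        (use fin in \<open>auto simp: inj4_at_def inj4_def doubleton_eq_iff\<close>)
    finally show ?thesis by (simp only: card_inj4_at[OF e] card_inj4_rotated[OF e]) simp
  qed
  have B: "S.extensions {e, f} \<le> 256 * n" if ef: "e \<in> arcs" "f \<in> arcs" "e \<noteq> f" for e f
  proof -
    let ?U = "e \<union> f" and ?V = "{1..n}"
    note U = card_union_arcs[OF ef[unfolded arcs_def]]
    \<comment> \<open>At most one entry lies outside \<open>?U\<close>: if two did, the other two
      would have to contain all of \<open>?U\<close>.\<close>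
    have two: False if "?U \<subseteq> {x, y}" for x y
    proof -
      have "card ?U \<le> card {x, y}" using that by (intro card_mono) auto
      also have "\<dots> \<le> 2" by (simp add: card_insert_if)
      finally show False using U(3) by simp
    qed
    have "{t \<in> inj4 n. {e, f} \<subseteq> (case t of (a, b, c, d) \<Rightarrow> {{a, b}, {b, c}, {c, d}, {d, a}})}
        \<subseteq> ?V \<times> ?U \<times> ?U \<times> ?U \<union> ?U \<times> ?V \<times> ?U \<times> ?U \<union> (?U \<times> ?U \<times> ?V \<times> ?U \<union> ?U \<times> ?U \<times> ?U \<times> ?V)"
      (is "?L \<subseteq> ?R")
    proof
      fix t assume t: "t \<in> ?L"
      obtain a b c d where ta: "t = (a, b, c, d)" by (cases t) auto
      have sub: "?U \<subseteq> {a, b, c, d}" using t ta by auto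
      have V: "a \<in> ?V" "b \<in> ?V" "c \<in> ?V" "d \<in> ?V" using t ta by (auto simp: inj4_def)
      have "a \<in> ?U \<or> b \<in> ?U" using two[of c d] sub by blast
      moreover have "a \<in> ?U \<or> c \<in> ?U" using two[of b d] sub by blast
      moreover have "a \<in> ?U \<or> d \<in> ?U" using two[of b c] sub by blast
      moreover have "b \<in> ?U \<or> c \<in> ?U" using two[of a d] sub by blast
      moreover have "b \<in> ?U \<or> d \<in> ?U" using two[of a c] sub by blast
      moreover have "c \<in> ?U \<or> d \<in> ?U" using two[of a b] sub by blast
      ultimately show "t \<in> ?R" unfolding ta Un_iff[of "(a, b, c, d)"] mem_Sigma_iff using V by blast
    qed
    hence "S.extensions {e, f} \<le> card ?R"
      unfolding S.extensions_def using U(1) by (intro card_mono) auto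
    also have "\<dots> \<le> (card (?V \<times> ?U \<times> ?U \<times> ?U) + card (?U \<times> ?V \<times> ?U \<times> ?U)) + (card (?U \<times> ?U \<times> ?V \<times> ?U) + card (?U \<times> ?U \<times> ?U \<times> ?V))"
      by (intro order_trans[OF card_Un_le] add_mono card_Un_le)
    also have "\<dots> = 4 * (n * card ?U ^ 3)"
      by (simp add: card_cartesian_product power3_eq_cube)
    also have "\<dots> \<le> 4 * (n * 4 ^ 3)" using U(2) by (intro mult_left_mono power_mono) auto
    finally show ?thesis by simp
  qed
  have "expect (\<lambda>E. (real (card (four_cycles E)) - real (card (inj4 n)) * q ^ 4
      - 8 * real ((n - 2) * (n - 3)) * q ^ 3 * arc_sum E)\<^sup>2)
    = expect (\<lambda>E. (S.copies E - real (card (inj4 n)) * q ^ 4 - real (8 * ((n - 2) * (n - 3))) * q ^ (4 - 1) * arc_sum E)\<^sup>2)"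
    by (rule expect_cong) (simp add: card_four_cycles)
  also have "\<dots> \<le> 2 ^ 4 * real (256 * n) * real (card (inj4 n)) * q ^ 4"
    by (rule S.linear_approximation[OF D B])
  also have "\<dots> \<le> 2 ^ 4 * real (256 * n) * real (n ^ 4) * q ^ 4"
  proof (intro mult_right_mono mult_left_mono)
    show "real (card (inj4 n)) \<le> real (n ^ 4)" using card_inj4_le by (simp only: of_nat_le_iff)
  qed (use q_nonneg in auto)
  also have "\<dots> = 4096 * real n ^ 5 * q ^ 4" by (simp add: power_Suc[symmetric] mult.assoc del: power_Suc)
  finally show ?thesis .
qed

text \<open>One arc lies in at most 2 * 2 * n + 2 * n * 2 = 8 n tuples, an order of n fewer than for
  \<open>arc_pairs\<close>; so even the linear part can go into the error.\<close>

lemma cherries_variance: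
  "expect (\<lambda>E. (real (card (cherries E)) - real (card (inj3 n)) * q\<^sup>2)\<^sup>2) \<le> 32 * real n ^ 4 * q\<^sup>2"
proof -
  interpret S: subgraph_count n q "inj3 n" cherry_arcs 2
    by (rule subgraph_count_cherries)
  have B: "S.extensions {e} \<le> 8 * n" if "e \<in> arcs" for e
  proof -
    have e: "card e = 2" using that by (auto simp: arcs_def all_arcs_def)
    hence fin: "finite e" by (auto intro: card_ge_0_finite)
    have "S.extensions {e} \<le> card (e \<times> e \<times> {1..n} \<union> e \<times> {1..n} \<times> e)"
      unfolding S.extensions_def using fin by (intro card_mono) (auto simp: inj3_def)
    also have "\<dots> \<le> card (e \<times> e \<times> {1..n}) + card (e \<times> {1..n} \<times> e)" by (rule card_Un_le)
    also have "\<dots> = 8 * n" by (simp add: card_cartesian_product e)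
    finally show ?thesis .
  qed
  have "expect (\<lambda>E. (real (card (cherries E)) - real (card (inj3 n)) * q\<^sup>2)\<^sup>2)
    = expect (\<lambda>E. (S.copies E - real (card (inj3 n)) * q\<^sup>2)\<^sup>2)"
    by (rule expect_cong) (simp add: card_cherries)
  also have "\<dots> \<le> 2 ^ 2 * real (8 * n) * real (card (inj3 n)) * q\<^sup>2"
    by (rule S.variance_copies_le[OF B])
  also have "\<dots> \<le> 2 ^ 2 * real (8 * n) * real (n ^ 3) * q\<^sup>2"
  proof (intro mult_right_mono mult_left_mono)
    show "real (card (inj3 n)) \<le> real (n ^ 3)" using card_inj3_le by (simp only: of_nat_le_iff)
  qed auto
  also have "\<dots> = 32 * real n ^ 4 * q\<^sup>2" by (simp add: eval_nat_numeral)
  finally show ?thesis .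
qed

lemma card_arcs_le: "real (card arcs) \<le> real n ^ 2"
proof -
  have "n choose 2 \<le> n ^ 2" by (cases "2 \<le> n") (auto simp: binomial_eq_0 intro: binomial_le_pow)
  hence "card arcs \<le> n ^ 2" unfolding arcs_def by (simp add: card_all_arcs)
  thus ?thesis by (metis of_nat_le_iff of_nat_power)
qed

lemma arcs_variance:
  "expect (\<lambda>E. (real (card E) - real (card arcs) * q)\<^sup>2) \<le> 2 * real n ^ 2 * q"
proof -
  interpret S: subgraph_count n q arcs "\<lambda>e. {e}" 1
    by (rule subgraph_count_arcs)
  have B: "S.extensions {e} \<le> 1" if "e \<in> arcs" for e
  proof -
    have "S.extensions {e} = card {e}" unfolding S.extensions_def using that by (intro arg_cong[of _ _ card]) auto
    thus ?thesis by simp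
  qed
  have "expect (\<lambda>E. (real (card E) - real (card arcs) * q)\<^sup>2)
    = expect (\<lambda>E. (S.copies E - real (card arcs) * q ^ 1)\<^sup>2)"
    by (rule expect_cong) (simp add: card_graph)
  also have "\<dots> \<le> 2 ^ 1 * real 1 * real (card arcs) * q ^ 1"
    by (rule S.variance_copies_le[OF B])
  also have "\<dots> \<le> 2 * real n ^ 2 * q" using card_arcs_le q_nonneg by (simp add: mult_right_mono)
  finally show ?thesis .
qed

lemma expect_counts:
  "expect (\<lambda>E. real (card (arc_pairs E))) = real (card (inj4 n)) * q\<^sup>2"
  "expect (\<lambda>E. real (card (four_cycles E))) = real (card (inj4 n)) * q ^ 4"
  "expect (\<lambda>E. real (card (cherries E))) = real (card (inj3 n)) * q\<^sup>2"
  "expect (\<lambda>E. real (card E)) = real (card arcs) * q"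
  using subgraph_count.expect_copies[OF subgraph_count_arc_pairs] expect_cong[OF card_arc_pairs]
    subgraph_count.expect_copies[OF subgraph_count_four_cycles] expect_cong[OF card_four_cycles]
    subgraph_count.expect_copies[OF subgraph_count_cherries] expect_cong[OF card_cherries]
    subgraph_count.expect_copies[OF subgraph_count_arcs] expect_cong[OF card_graph]
  by simp_all

lemma expect_arc_sum: "expect arc_sum = 0"
  "expect (\<lambda>E. (arc_sum E)\<^sup>2) = real (card arcs) * (q * (1 - q))"
proof -
  have sub: "(\<lambda>e. {e}) ` arcs \<subseteq> Pow arcs" by auto
  have "arc_sum E = (\<Sum>H\<in>(\<lambda>e. {e}) ` arcs. 1 * centered q H E)" for E
    by (simp add: sum.reindex centered_def)
  hence "expect (\<lambda>E. (arc_sum E)\<^sup>2) = (\<Sum>H\<in>(\<lambda>e. {e}) ` arcs. 1\<^sup>2 * (q * (1 - q)) ^ card H)"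
    by (simp only: expect_square_centered_sum[OF sub])
  thus "expect (\<lambda>E. (arc_sum E)\<^sup>2) = real (card arcs) * (q * (1 - q))"
    by (simp add: sum.reindex)
  have "expect (\<lambda>E. of_bool (e \<in> E) - q) = 0" if "e \<in> arcs" for e
  proof -
    have "centered q {e} = (\<lambda>E. of_bool (e \<in> E) - q)" by (simp add: centered_def fun_eq_iff)
    thus ?thesis using expect_centered_mult[of "{}" "{e}"] that by (simp add: centered_empty)
  qed
  thus "expect arc_sum = 0" by (simp add: expect_sum)
qed

end


section \<open>Linear approximation of the edge counts\<close>

lemma power2_add_le: "(x + y)\<^sup>2 \<le> 2 * x\<^sup>2 + 2 * y\<^sup>2" for x y :: real
  using zero_le_power2[of "x - y"] by (simp add: power2_eq_square algebra_simps)

text \<open>In the grouping (a + b) + (c + (d + e)) the two-term bound is applied at most three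
  times to a summand, hence 8 = 2^3.\<close>

lemma sum5_power2_le:
  fixes a b c d e :: real
  shows "(a + b + c + d + e)\<^sup>2 \<le> 8 * (a\<^sup>2 + b\<^sup>2 + c\<^sup>2 + d\<^sup>2 + e\<^sup>2)"
proof -
  note two = power2_add_le
  have "(a + b + c + d + e)\<^sup>2 = ((a + b) + (c + (d + e)))\<^sup>2" by (simp add: algebra_simps)
  also have "\<dots> \<le> 2 * (a + b)\<^sup>2 + 2 * (c + (d + e))\<^sup>2" by (rule two)
  finally show ?thesis
    using two[of a b] two[of c "d + e"] two[of d e] zero_le_power2[of a] zero_le_power2[of b] zero_le_power2[of c]
    by argo
qed

context random_graph_model
begin

lemma expect_const: "expect (\<lambda>E. c) = c"
  by simp

lemma expect_cmult: "expect (\<lambda>E. c * f E) = c * expect f"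
  by simp

lemma expect_square_shift:
  "expect (\<lambda>E. (f E)\<^sup>2) = expect (\<lambda>E. (f E - expect f)\<^sup>2) + (expect f)\<^sup>2"
proof -
  have "expect (\<lambda>E. (f E - expect f)\<^sup>2) = expect (\<lambda>E. (f E)\<^sup>2 + (expect f)\<^sup>2 - 2 * expect f * f E)"
    by (simp add: power2_diff mult_ac)
  also have "\<dots> = expect (\<lambda>E. (f E)\<^sup>2) + (expect f)\<^sup>2 - 2 * expect f * expect f"
    by (simp only: expect_diff expect_add expect_const expect_cmult)
  finally show ?thesis by (simp add: power2_eq_square)
qed

lemma expect_square_deviation_le: "expect (\<lambda>E. (f E - expect f)\<^sup>2) \<le> expect (\<lambda>E. (f E)\<^sup>2)"
  unfolding expect_square_shift[of f] by simp

lemma expect_power2_le: "(expect f)\<^sup>2 \<le> expect (\<lambda>E. (f E)\<^sup>2)"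
proof -
  have "0 \<le> expect (\<lambda>E. (f E - expect f)\<^sup>2)" by (rule Bochner_Integration.integral_nonneg) simp
  thus ?thesis unfolding expect_square_shift[of f] by (rule add_increasing) (rule order_refl)
qed

section \<open>Characteristic function of the centred number of arcs\<close>

lemma expect_iexp_arc_sum:
  "cexpect (\<lambda>E. iexp (c * arc_sum E))
    = (of_real q * iexp (c * (1 - q)) + of_real (1 - q) * iexp (c * (- q))) ^ card arcs"
proof -
  have "iexp (c * arc_sum E) = (\<Prod>e\<in>arcs. iexp (c * (of_bool (e \<in> E) - q)))" for E
  proof -
    have "\<i> * complex_of_real (c * arc_sum E) = (\<Sum>e\<in>arcs. \<i> * complex_of_real (c * (of_bool (e \<in> E) - q)))"
      by (simp only: sum_distrib_left of_real_sum)
    thus ?thesis by (simp only: exp_sum[OF finite_arcs])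
  qed
  hence "cexpect (\<lambda>E. iexp (c * arc_sum E))
      = cexpect (\<lambda>E. \<Prod>e\<in>arcs. (\<lambda>b. iexp (c * (of_bool b - q))) (e \<in> E))"
    by simp
  also have "\<dots> = (\<Prod>e\<in>arcs. of_real q * iexp (c * (of_bool True - q)) + of_real (1 - q) * iexp (c * (of_bool False - q)))"
    by (rule expectation_prod)
  also have "\<dots> = (of_real q * iexp (c * (1 - q)) + of_real (1 - q) * iexp (c * (- q))) ^ card arcs"
    by simp
  finally show ?thesis .
qed

text \<open>Second-order Taylor expansion at both values. The first-order terms cancel because the
  mean is 0, the second moment is q (1 - q), and the third absolute moment q (1 - q) ((1 - q)^2 +
  q^2) is at most that.\<close>

lemma norm_two_point_char_approx:
  "norm (of_real q * iexp (c * (1 - q)) + of_real (1 - q) * iexp (c * (- q)) - of_real (1 - c\<^sup>2 * (q * (1 - q)) / 2))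
    \<le> \<bar>c\<bar> ^ 3 * (q * (1 - q)) / 6"
proof -
  let ?P = "\<lambda>x::real. \<Sum>k\<le>2. (\<i> * x) ^ k / fact k"
  have P: "?P x = of_real (1 - x\<^sup>2 / 2) + \<i> * x" for x
    by (simp add: eval_nat_numeral algebra_simps complex_eq_iff)
  have ap: "norm (iexp x - ?P x) \<le> \<bar>x\<bar> ^ 3 / 6" for x
    using iexp_approx1[of x 2] by (simp add: eval_nat_numeral)
  have eq: "of_real q * ?P (c * (1 - q)) + of_real (1 - q) * ?P (c * (- q)) = of_real (1 - c\<^sup>2 * (q * (1 - q)) / 2)"
    unfolding P by (simp add: complex_eq_iff power2_eq_square) (simp add: field_simps)
  have split_diff: "x * a + y * b - w = x * (a - P) + y * (b - P')" if "x * P + y * P' = w" for x y a b w P P' :: complex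
    using that by (auto simp: algebra_simps)
  from eq have "of_real q * iexp (c * (1 - q)) + of_real (1 - q) * iexp (c * (- q)) - of_real (1 - c\<^sup>2 * (q * (1 - q)) / 2)
      = of_real q * (iexp (c * (1 - q)) - ?P (c * (1 - q))) + of_real (1 - q) * (iexp (c * (- q)) - ?P (c * (- q)))"
    by (rule split_diff)
  also have "norm \<dots> \<le> q * (\<bar>c * (1 - q)\<bar> ^ 3 / 6) + (1 - q) * (\<bar>c * (- q)\<bar> ^ 3 / 6)"
  proof (rule order_trans[OF norm_triangle_ineq], intro add_mono)
    show "norm (of_real q * (iexp (c * (1 - q)) - ?P (c * (1 - q)))) \<le> q * (\<bar>c * (1 - q)\<bar> ^ 3 / 6)"
      unfolding norm_mult using ap[of "c * (1 - q)"] q_nonneg by (simp only: norm_of_real abs_of_nonneg mult_left_mono)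
    have "0 \<le> 1 - q" using q_le_1 by simp
    thus "norm (of_real (1 - q) * (iexp (c * (- q)) - ?P (c * (- q)))) \<le> (1 - q) * (\<bar>c * (- q)\<bar> ^ 3 / 6)"
      unfolding norm_mult using ap[of "c * (- q)"] by (simp only: norm_of_real abs_of_nonneg mult_left_mono)
  qed
  also have "\<dots> = \<bar>c\<bar> ^ 3 * (q * (1 - q)) / 6 * ((1 - q)\<^sup>2 + q\<^sup>2)"
  proof -
    have "\<bar>c * (1 - q)\<bar> = \<bar>c\<bar> * (1 - q)" "\<bar>c * (- q)\<bar> = \<bar>c\<bar> * q"
      using q_nonneg q_le_1 by (simp_all add: abs_mult)
    moreover have "q * ((x * (1 - q)) ^ 3 / 6) + (1 - q) * ((x * q) ^ 3 / 6) = x ^ 3 * (q * (1 - q)) / 6 * ((1 - q)\<^sup>2 + q\<^sup>2)" for x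
      by (simp add: power2_eq_square power3_eq_cube field_simps)
    ultimately show ?thesis by simp
  qed
  also have "\<dots> \<le> \<bar>c\<bar> ^ 3 * (q * (1 - q)) / 6 * 1"
  proof (rule mult_left_mono)
    have "q * q \<le> q * 1" using q_nonneg q_le_1 by (intro mult_left_mono) auto
    thus "(1 - q)\<^sup>2 + q\<^sup>2 \<le> 1" by (simp add: power2_eq_square algebra_simps)
    show "0 \<le> \<bar>c\<bar> ^ 3 * (q * (1 - q)) / 6" using q_nonneg q_le_1 by simp
  qed
  finally show ?thesis by simp
qed

text \<open>A difference of N-th powers is at most N times the difference of the bases if both lie
  in the unit disc; the bound on \<open>t\<^sup>2\<close> ensures this for the real base.
  \<open>\<sigma>\<close> is the standard deviation of \<open>arc_sum\<close>.\<close>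

lemma char_arc_sum_approx:
  assumes q: "0 < q" "q < 1" and N: "0 < card arcs" "t\<^sup>2 \<le> 4 * real (card arcs)"
  defines "\<sigma> \<equiv> sqrt (real (card arcs) * (q * (1 - q)))"
  shows "norm (cexpect (\<lambda>E. iexp (t / \<sigma> * arc_sum E))
      - of_real ((1 + (- t\<^sup>2 / 2) / real (card arcs)) ^ card arcs)) \<le> \<bar>t\<bar> ^ 3 / (6 * \<sigma>)"
proof -
  let ?N = "card arcs"
  let ?\<psi> = "of_real q * iexp (t / \<sigma> * (1 - q)) + of_real (1 - q) * iexp (t / \<sigma> * (- q)) :: complex"
  let ?w = "1 + (- t\<^sup>2 / 2) / real ?N"
  have pos: "0 < real ?N * (q * (1 - q))" using q N by simp
  have \<sigma>: "0 < \<sigma>" "\<sigma>\<^sup>2 = real ?N * (q * (1 - q))" using pos by (simp_all add: \<sigma>_def)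
  have "norm ?\<psi> \<le> norm (of_real q * iexp (t / \<sigma> * (1 - q))) + norm (of_real (1 - q) * iexp (t / \<sigma> * (- q)))"
    by (rule norm_triangle_ineq)
  also have "\<dots> = 1" using q by (simp add: norm_mult del: of_real_diff)
  finally have \<psi>: "norm ?\<psi> \<le> 1" .
  have "t\<^sup>2 / 2 / real ?N \<le> 2" using N by (simp add: field_simps)
  moreover have "0 \<le> t\<^sup>2 / 2 / real ?N" by simp
  moreover have "?w = 1 - t\<^sup>2 / 2 / real ?N" by simp
  ultimately have "\<bar>?w\<bar> \<le> 1" by linarith
  hence w: "norm (of_real ?w :: complex) \<le> 1" by (simp only: norm_of_real)
  have wc: "?w = 1 - (t / \<sigma>)\<^sup>2 * (q * (1 - q)) / 2"
    using N q by (simp add: power_divide \<sigma>(2) field_simps)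
  have "norm (cexpect (\<lambda>E. iexp (t / \<sigma> * arc_sum E)) - of_real (?w ^ ?N))
      = norm (?\<psi> ^ ?N - of_real ?w ^ ?N)"
    by (simp only: expect_iexp_arc_sum of_real_power)
  also have "\<dots> \<le> real ?N * norm (?\<psi> - of_real ?w)" by (rule norm_power_diff[OF \<psi> w])
  also have "\<dots> \<le> real ?N * (\<bar>t / \<sigma>\<bar> ^ 3 * (q * (1 - q)) / 6)"
    unfolding wc by (intro mult_left_mono norm_two_point_char_approx) simp
  also have "\<dots> = \<bar>t\<bar> ^ 3 * \<sigma>\<^sup>2 / (6 * \<sigma> ^ 3)"
    using \<sigma>(1) by (simp add: \<sigma>(2) power_divide abs_divide field_simps)
  also have "\<dots> = \<bar>t\<bar> ^ 3 / (6 * \<sigma>)" using \<sigma>(1) by (simp add: power2_eq_square power3_eq_cube)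
  finally show ?thesis .
qed

text \<open>Scaled by \<open>n\<^sup>6 q\<^sup>3\<close>, the order of the variance; it tends to \<open>0\<close> because \<open>n\<^sup>2 q\<close> tends to infinity.\<close>

definition projection_error :: real where
  "projection_error = 8 * (1280 / (real n ^ 2 * q) + 4096 / real n + 32 / (real n ^ 2 * q)\<^sup>2 + 4 / sqrt (real n))"

text \<open>The order n^3 q^2 of the mean number of cherries meets the bound n^2 at q = 1 / sqrt n,
  which explains the threshold and the term 1 / sqrt n.\<close>

lemma expect_square_min_cherries:
  assumes q: "0 < q" and n: "1 \<le> n"
    and U: "\<And>E. E \<subseteq> arcs \<Longrightarrow> 0 \<le> U E \<and> U E \<le> real (card (cherries E)) \<and> U E \<le> real n ^ 2"
  shows "expect (\<lambda>E. (U E)\<^sup>2) \<le> (real n ^ 6 * q ^ 3) * (32 / (real n ^ 2 * q) + 1 / sqrt (real n))"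
proof -
  let ?M = "real n ^ 6 * q ^ 3"
  have n0: "0 < real n" using n by simp
  have sq: "sqrt (real n) * sqrt (real n) = real n" "0 < sqrt (real n)" using n0 by simp_all
  show ?thesis
  proof (cases "q \<le> 1 / sqrt (real n)")
    \<comment> \<open>Sparse graphs have few cherries; for dense graphs the trivial bound \<open>n\<^sup>2\<close> suffices.\<close>
    case True
    have "expect (\<lambda>E. (U E)\<^sup>2) \<le> expect (\<lambda>E. (real (card (cherries E)))\<^sup>2)"
      by (rule expect_mono) (use U in \<open>auto intro!: power_mono\<close>)
    also have "\<dots> = expect (\<lambda>E. (real (card (cherries E)) - real (card (inj3 n)) * q\<^sup>2)\<^sup>2) + (real (card (inj3 n)) * q\<^sup>2)\<^sup>2"
      using expect_square_shift[of "\<lambda>E. real (card (cherries E))"] by (simp only: expect_counts)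
    also have "\<dots> \<le> 32 * real n ^ 4 * q\<^sup>2 + (real (n ^ 3) * q\<^sup>2)\<^sup>2"
    proof (intro add_mono cherries_variance power_mono mult_right_mono)
      show "real (card (inj3 n)) \<le> real (n ^ 3)" using card_inj3_le by (simp only: of_nat_le_iff)
    qed auto
    also have "(real (n ^ 3) * q\<^sup>2)\<^sup>2 = ?M * q" by (simp add: power_mult_distrib flip: power_mult) (simp add: eval_nat_numeral)
    also have "\<dots> \<le> ?M * (1 / sqrt (real n))" using True q by (intro mult_left_mono) auto
    also have "32 * real n ^ 4 * q\<^sup>2 = ?M * (32 / (real n ^ 2 * q))"
      using q n0 by (simp add: field_simps eval_nat_numeral)
    finally show ?thesis by (simp add: distrib_left)
  next
    case False
    hence "1 \<le> q * sqrt (real n)" using sq by (simp add: field_simps)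
    hence "1 ^ 3 \<le> (q * sqrt (real n)) ^ 3" by (intro power_mono) auto
    also have "\<dots> = q ^ 3 * (real n * sqrt (real n))" using sq by (simp add: power_mult_distrib power3_eq_cube)
    finally have h: "1 \<le> q ^ 3 * (real n * sqrt (real n))" by simp
    have "expect (\<lambda>E. (U E)\<^sup>2) \<le> expect (\<lambda>E. (real n ^ 2)\<^sup>2)"
    proof (rule expect_mono)
      fix E assume "E \<subseteq> arcs"
      from U[OF this] show "(U E)\<^sup>2 \<le> (real n ^ 2)\<^sup>2" by (intro power_mono) simp_all
    qed
    also have "\<dots> = real n ^ 4 * 1" by (simp flip: power_mult)
    also have "\<dots> \<le> real n ^ 4 * (q ^ 3 * (real n * sqrt (real n)))" using h by (intro mult_left_mono) auto
    also have "\<dots> = ?M * (1 / sqrt (real n))"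
      using sq by (simp add: field_simps eval_nat_numeral)
    also have "\<dots> \<le> ?M * (32 / (real n ^ 2 * q) + 1 / sqrt (real n))" using q by (intro mult_left_mono) auto
    finally show ?thesis .
  qed
qed

end

section \<open>Common model of the two edge counts\<close>

definition main_count :: "real \<Rightarrow> real \<Rightarrow> nat set set \<Rightarrow> real" where
  "main_count \<gamma> \<kappa> E = real (card (arc_pairs E)) - \<gamma> * real (card (four_cycles E))
    + 2 * real (card (cherries E)) + 4 * \<kappa> * real (card E)"

definition small_correction :: "nat \<Rightarrow> nat set set \<Rightarrow> real \<Rightarrow> bool" where
  "small_correction n E u \<longleftrightarrow> 0 \<le> u \<and> u \<le> real (card (cherries E)) \<and> u \<le> real n ^ 2"

text \<open>The polytope is the case \<gamma> = 1, \<kappa> = 0 with \<open>U\<close> counting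
  exposed paths, the triangulation the case \<gamma> = 1/2, \<kappa> = 1 with \<open>U\<close>
  counting far arrows.\<close>

locale edge_count_model = random_graph_model +
  fixes K U :: "nat set set \<Rightarrow> real" and \<gamma> \<kappa> :: real
  assumes q_pos: "0 < q" and q_lt_1: "q < 1" and n_pos: "1 \<le> n"
    and \<gamma>: "0 \<le> \<gamma>" "\<gamma> \<le> 1" and \<kappa>: "0 \<le> \<kappa>" "\<kappa> \<le> 1"
    and K: "\<And>E. E \<subseteq> arcs \<Longrightarrow> 2 * K E = main_count \<gamma> \<kappa> E + 2 * U E"
    and U: "\<And>E. E \<subseteq> arcs \<Longrightarrow> small_correction n E (U E)"
begin

text \<open>First-order coefficient of \<open>2 * K\<close>, not of \<open>K\<close>: 4 (n-2)(n-3) q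
  from the arc pairs minus \<gamma> times 8 (n-2)(n-3) q^3 from the four-cycles. Cherries, arcs and
  \<open>U\<close> are left to the remainder.\<close>

definition slope :: real where
  "slope = 4 * real ((n - 2) * (n - 3)) * q * (1 - 2 * \<gamma> * q\<^sup>2)"

abbreviation remainder :: "nat set set \<Rightarrow> real" where
  "remainder E \<equiv> 2 * (K E - expect K) - slope * arc_sum E"

lemma expect_K:
  "2 * expect K = real (card (inj4 n)) * q\<^sup>2 - \<gamma> * (real (card (inj4 n)) * q ^ 4)
    + 2 * (real (card (inj3 n)) * q\<^sup>2) + 4 * \<kappa> * (real (card arcs) * q) + 2 * expect U"
proof -
  have "2 * expect K = expect (\<lambda>E. 2 * K E)" by simp
  also have "\<dots> = expect (\<lambda>E. main_count \<gamma> \<kappa> E + 2 * U E)"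
    by (rule expect_cong) (rule K)
  also have "\<dots> = expect (\<lambda>E. real (card (arc_pairs E))) - \<gamma> * expect (\<lambda>E. real (card (four_cycles E)))
      + 2 * expect (\<lambda>E. real (card (cherries E))) + 4 * \<kappa> * expect (\<lambda>E. real (card E)) + 2 * expect U"
    by (simp only: main_count_def expect_add expect_diff expect_cmult)
  finally show ?thesis by (simp only: expect_counts)
qed

text \<open>From below, \<gamma> q^2 \<le> q lets the arc pairs outweigh the four-cycles. From
  above, cherries and \<open>U\<close> contribute at most 2 n^3 q^2 each and the arcs 4 n^2 q, that
  is 4 / n and 4 / (n^2 q) relative to n^4 q^2.\<close>

lemma expect_K_bounds:
  "real (card (inj4 n)) * q\<^sup>2 * (1 - q) \<le> 2 * expect K"
  "2 * expect K \<le> real n ^ 4 * q\<^sup>2 * (1 + 4 / real n + 4 / (real n ^ 2 * q))"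
proof -
  have n0: "0 < real n" using n_pos by simp
  have U0: "0 \<le> expect U" using expect_mono[of "\<lambda>_. 0" U] U by (simp add: small_correction_def)
  have U1: "expect U \<le> real (card (inj3 n)) * q\<^sup>2"
    using expect_mono[of U "\<lambda>E. real (card (cherries E))"] U by (simp add: expect_counts small_correction_def)
  have "\<gamma> * q\<^sup>2 \<le> 1 * q" 
    using \<gamma> q_pos q_lt_1 by (intro mult_mono) (auto simp: power2_eq_square mult_left_le)
  hence "real (card (inj4 n)) * q\<^sup>2 * (1 - q) \<le> real (card (inj4 n)) * q\<^sup>2 * (1 - \<gamma> * q\<^sup>2)"
    by (intro mult_left_mono) auto
  also have "\<dots> = real (card (inj4 n)) * q\<^sup>2 - \<gamma> * (real (card (inj4 n)) * q ^ 4)"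
    by (simp add: algebra_simps power2_eq_square eval_nat_numeral)
  also have "\<dots> \<le> 2 * expect K"
    using expect_K U0 \<kappa> q_pos by simp
  finally show "real (card (inj4 n)) * q\<^sup>2 * (1 - q) \<le> 2 * expect K" .
  have "real (card (inj4 n)) \<le> real n ^ 4" "real (card (inj3 n)) \<le> real n ^ 3"
    using card_inj4_le[of n] card_inj3_le[of n] by (metis of_nat_le_iff of_nat_power)+
  hence b: "real (card (inj4 n)) * q\<^sup>2 \<le> real n ^ 4 * q\<^sup>2" "real (card (inj3 n)) * q\<^sup>2 \<le> real n ^ 3 * q\<^sup>2"
    by (intro mult_right_mono; simp)+
  have c: "4 * \<kappa> * (real (card arcs) * q) \<le> 4 * 1 * (real n ^ 2 * q)"
    using \<kappa> q_pos card_arcs_le by (intro mult_mono) auto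
  have g: "0 \<le> \<gamma> * (real (card (inj4 n)) * q ^ 4)" using \<gamma> q_pos by simp
  have "2 * expect K \<le> real n ^ 4 * q\<^sup>2 + 4 * (real n ^ 3 * q\<^sup>2) + 4 * (real n ^ 2 * q)"
    using expect_K U1 b c g by linarith
  also have "\<dots> = real n ^ 4 * q\<^sup>2 * (1 + 4 / real n + 4 / (real n ^ 2 * q))"
    using n0 q_pos by (simp add: field_simps eval_nat_numeral)
  finally show "2 * expect K \<le> real n ^ 4 * q\<^sup>2 * (1 + 4 / real n + 4 / (real n ^ 2 * q))" .
qed

lemma expect_square_projection_error:
  "expect (\<lambda>E. (remainder E)\<^sup>2) \<le> projection_error * (real n ^ 6 * q ^ 3)"
proof -
  let ?M = "real n ^ 6 * q ^ 3"
  have n0: "0 < real n" using n_pos by simp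
  define a where "a E = real (card (arc_pairs E)) - real (card (inj4 n)) * q\<^sup>2
      - 4 * real ((n - 2) * (n - 3)) * q * arc_sum E" for E
  define b where "b E = real (card (four_cycles E)) - real (card (inj4 n)) * q ^ 4
      - 8 * real ((n - 2) * (n - 3)) * q ^ 3 * arc_sum E" for E
  define c where "c E = real (card (cherries E)) - real (card (inj3 n)) * q\<^sup>2" for E
  define d where "d E = real (card E) - real (card arcs) * q" for E :: "nat set set"
  define u where "u E = U E - expect U" for E
  have bounds: "expect (\<lambda>E. (a E)\<^sup>2) \<le> 1024 * real n ^ 4 * q\<^sup>2" "expect (\<lambda>E. (b E)\<^sup>2) \<le> 4096 * real n ^ 5 * q ^ 4"
    "expect (\<lambda>E. (c E)\<^sup>2) \<le> 32 * real n ^ 4 * q\<^sup>2" "expect (\<lambda>E. (d E)\<^sup>2) \<le> 2 * real n ^ 2 * q"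
    "expect (\<lambda>E. (u E)\<^sup>2) \<le> ?M * (32 / (real n ^ 2 * q) + 1 / sqrt (real n))"
    unfolding a_def b_def c_def d_def u_def
    using arc_pairs_approximation four_cycles_approximation cherries_variance arcs_variance
      order_trans[OF expect_square_deviation_le expect_square_min_cherries[OF q_pos n_pos U[unfolded small_correction_def]]] by blast+
  have "\<gamma>\<^sup>2 \<le> 1" "\<kappa>\<^sup>2 \<le> 1" using \<gamma> \<kappa> by (simp_all add: power_le_one)
  have pt: "(remainder E)\<^sup>2
      \<le> 8 * ((a E)\<^sup>2 + (b E)\<^sup>2 + 4 * (c E)\<^sup>2 + 16 * (d E)\<^sup>2 + 4 * (u E)\<^sup>2)" if E: "E \<subseteq> arcs" for E
  proof -
    have "2 * (K E - expect K) - slope * arc_sum E = 2 * K E - 2 * expect K - slope * arc_sum E" by simp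
    \<comment> \<open>The means are subtracted term by term, and the linear parts removed in
      \<open>a\<close> and \<open>b\<close> combine to the slope.\<close>
    also have "\<dots> = a E + (- \<gamma> * b E) + 2 * c E + 4 * \<kappa> * d E + 2 * u E"
      unfolding K[OF E] main_count_def expect_K a_def b_def c_def d_def u_def slope_def
      by (simp add: algebra_simps power2_eq_square power3_eq_cube)
    also have "(\<dots>)\<^sup>2 \<le> 8 * ((a E)\<^sup>2 + (- \<gamma> * b E)\<^sup>2 + (2 * c E)\<^sup>2 + (4 * \<kappa> * d E)\<^sup>2 + (2 * u E)\<^sup>2)"
      by (rule sum5_power2_le)
    also have "\<dots> \<le> 8 * ((a E)\<^sup>2 + (b E)\<^sup>2 + 4 * (c E)\<^sup>2 + 16 * (d E)\<^sup>2 + 4 * (u E)\<^sup>2)"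
    proof -
      have "\<gamma>\<^sup>2 * (b E)\<^sup>2 \<le> 1 * (b E)\<^sup>2" "\<kappa>\<^sup>2 * (d E)\<^sup>2 \<le> 1 * (d E)\<^sup>2"
        using \<open>\<gamma>\<^sup>2 \<le> 1\<close> \<open>\<kappa>\<^sup>2 \<le> 1\<close> by (intro mult_right_mono; simp)+
      thus ?thesis by (simp add: power_mult_distrib)
    qed
    finally show ?thesis .
  qed
  have "expect (\<lambda>E. (remainder E)\<^sup>2)
      \<le> expect (\<lambda>E. 8 * ((a E)\<^sup>2 + (b E)\<^sup>2 + 4 * (c E)\<^sup>2 + 16 * (d E)\<^sup>2 + 4 * (u E)\<^sup>2))"
    by (rule expect_mono) (rule pt)
  also have "\<dots> = 8 * (expect (\<lambda>E. (a E)\<^sup>2) + expect (\<lambda>E. (b E)\<^sup>2) + 4 * expect (\<lambda>E. (c E)\<^sup>2)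
      + 16 * expect (\<lambda>E. (d E)\<^sup>2) + 4 * expect (\<lambda>E. (u E)\<^sup>2))"
    by (simp only: expect_cmult expect_add)
  also have "\<dots> \<le> 8 * (1024 * real n ^ 4 * q\<^sup>2 + 4096 * real n ^ 5 * q ^ 4 + 4 * (32 * real n ^ 4 * q\<^sup>2)
      + 16 * (2 * real n ^ 2 * q) + 4 * (?M * (32 / (real n ^ 2 * q) + 1 / sqrt (real n))))"
    by (intro mult_left_mono add_mono bounds) simp_all
  also have "\<dots> \<le> projection_error * ?M"
  proof -
    \<comment> \<open>Origin of the constants in \<open>projection_error\<close>: 1280 = 1024 + 4 *
      32 + 4 * 32 from arc pairs, cherries and \<open>U\<close>; 4096 from the four-cycles; 32 = 16
      * 2 from the arcs; 4 / sqrt n from \<open>U\<close>; the factor 8 from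
      \<open>sum5_power2_le\<close>.\<close>
    have "q ^ 4 \<le> q ^ 3" using q_pos q_lt_1 by (intro power_decreasing) auto
    hence "4096 * real n ^ 5 * q ^ 4 \<le> 4096 * real n ^ 5 * q ^ 3" by (intro mult_left_mono) auto
    also have "\<dots> = ?M * (4096 / real n)" using n0 by (simp add: field_simps eval_nat_numeral)
    finally have 1: "4096 * real n ^ 5 * q ^ 4 \<le> ?M * (4096 / real n)" .
    have 2: "1024 * real n ^ 4 * q\<^sup>2 + 4 * (32 * real n ^ 4 * q\<^sup>2) = ?M * (1152 / (real n ^ 2 * q))"
      using n0 q_pos by (simp add: field_simps eval_nat_numeral)
    have 3: "16 * (2 * real n ^ 2 * q) = ?M * (32 / (real n ^ 2 * q)\<^sup>2)"
      using n0 q_pos by (simp add: field_simps eval_nat_numeral)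
    have 4: "projection_error * ?M = 8 * (?M * (1152 / (real n ^ 2 * q)) + ?M * (4096 / real n) + ?M * (32 / (real n ^ 2 * q)\<^sup>2)
      + 4 * (?M * (32 / (real n ^ 2 * q) + 1 / sqrt (real n))))"
      unfolding projection_error_def by (simp add: algebra_simps add_divide_distrib[symmetric])
    have "8 * (A + B + C + D + F) \<le> 8 * (P + B' + D' + F)"
      if "B \<le> B'" "A + C = P" "D = D'" for A B C D F P B' D' :: real
      unfolding that(2)[symmetric] that(3) using that(1) by simp
    from this[OF 1 2 3] show ?thesis unfolding 4 .
  qed
  finally show ?thesis .
qed

definition linear_variance :: real where
  "linear_variance = slope\<^sup>2 * (real (card arcs) * (q * (1 - q)))"

lemma linear_variance_eq: "expect (\<lambda>E. (slope * arc_sum E)\<^sup>2) = linear_variance"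
  unfolding linear_variance_def by (simp add: power_mult_distrib expect_arc_sum)

definition variance_K :: real where
  "variance_K = expect (\<lambda>E. (K E - expect K)\<^sup>2)"

text \<open>A remainder with at most a quarter of the second moment of the linear part changes the
  variance by a bounded factor only; this follows from \<open>power2_add_le\<close> applied in both
  directions.\<close>

lemma variance_K_bounds:
  assumes r: "4 * (projection_error * (real n ^ 6 * q ^ 3)) \<le> linear_variance"
  shows "linear_variance \<le> 16 * variance_K" "4 * variance_K \<le> 3 * linear_variance"
proof -
  let ?r = "expect (\<lambda>E. (remainder E)\<^sup>2)"
  have r': "4 * ?r \<le> linear_variance" using expect_square_projection_error r by linarith
  note two = power2_add_le
  have "expect (\<lambda>E. (slope * arc_sum E)\<^sup>2) \<le> expect (\<lambda>E. 8 * (K E - expect K)\<^sup>2 + 2 * (remainder E)\<^sup>2)"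
  proof (rule expect_mono)
    fix E
    have "slope * arc_sum E = 2 * (K E - expect K) + - (2 * (K E - expect K) - slope * arc_sum E)" by simp
    thus "(slope * arc_sum E)\<^sup>2 \<le> 8 * (K E - expect K)\<^sup>2 + 2 * (remainder E)\<^sup>2"
      using two[of "2 * (K E - expect K)" "- (2 * (K E - expect K) - slope * arc_sum E)"]
      by (simp only: power_mult_distrib power2_minus) simp
  qed
  hence "linear_variance \<le> 8 * variance_K + 2 * ?r"
    unfolding linear_variance_eq by (simp only: expect_add expect_cmult variance_K_def)
  thus "linear_variance \<le> 16 * variance_K" using r' by linarith
  have "expect (\<lambda>E. 4 * (K E - expect K)\<^sup>2) \<le> expect (\<lambda>E. 2 * (slope * arc_sum E)\<^sup>2 + 2 * (remainder E)\<^sup>2)"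
  proof (rule expect_mono)
    fix E
    have "2 * (K E - expect K) = slope * arc_sum E + (2 * (K E - expect K) - slope * arc_sum E)" by simp
    moreover have "4 * (K E - expect K)\<^sup>2 = (2 * (K E - expect K))\<^sup>2" by (simp only: power_mult_distrib) simp
    ultimately show "4 * (K E - expect K)\<^sup>2 \<le> 2 * (slope * arc_sum E)\<^sup>2 + 2 * (remainder E)\<^sup>2"
      using two[of "slope * arc_sum E" "2 * (K E - expect K) - slope * arc_sum E"] by presburger
  qed
  hence "4 * variance_K \<le> 2 * linear_variance + 2 * ?r"
    unfolding linear_variance_eq[symmetric] by (simp only: expect_add expect_cmult variance_K_def)
  moreover have "0 \<le> linear_variance"
    unfolding linear_variance_def using q_pos q_lt_1 by simp
  ultimately show "4 * variance_K \<le> 3 * linear_variance" using r' by linarith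
qed

text \<open>Both variables are normalised to second moment 1, so their L2-distance is controlled by
  the remainder. It passes to characteristic functions because \<open>iexp\<close> is 1-Lipschitz on
  the reals and the mean of an absolute value is at most the root of the second moment.\<close>

lemma char_K_approx:
  assumes r: "4 * (projection_error * (real n ^ 6 * q ^ 3)) \<le> linear_variance" and pos: "0 < linear_variance"
  shows "norm (cexpect (\<lambda>E. iexp (t * ((K E - expect K) / sqrt variance_K)))
      - cexpect (\<lambda>E. iexp (t * (slope * arc_sum E / sqrt linear_variance))))
    \<le> \<bar>t\<bar> * sqrt (2 * (projection_error * (real n ^ 6 * q ^ 3)) / linear_variance)"
proof -
  let ?D = "\<lambda>E. 2 * (K E - expect K)" and ?L = "\<lambda>E. slope * arc_sum E"
  let ?R = "projection_error * (real n ^ 6 * q ^ 3)"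
  define s where "s = sqrt linear_variance"
  \<comment> \<open>The standard deviation of \<open>2 * K\<close>, to which \<open>slope\<close>
    refers.\<close>
  define v where "v = 2 * sqrt variance_K"
  have vb: "linear_variance \<le> 16 * variance_K" using variance_K_bounds[OF r] by simp
  hence vp: "0 < variance_K" using pos by linarith
  have s: "0 < s" "s\<^sup>2 = linear_variance" using pos by (simp_all add: s_def)
  have v: "0 < v" "v\<^sup>2 = 4 * variance_K" using vp by (simp_all add: v_def power_mult_distrib)
  have "s\<^sup>2 \<le> (2 * v)\<^sup>2" using vb by (simp add: s v power_mult_distrib)
  hence sv: "s \<le> 2 * v" using v by (intro power2_le_imp_le[of s]) simp_all
  let ?X = "\<lambda>E. (K E - expect K) / sqrt variance_K" and ?Z = "\<lambda>E. ?L E / s"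
  have X: "?X E = ?D E / v" for E
    unfolding v_def by (rule mult_divide_mult_cancel_left[symmetric]) simp
  have D2: "expect (\<lambda>E. (?D E)\<^sup>2) = v\<^sup>2"
    by (simp only: power_mult_distrib expect_cmult variance_K_def v) simp
  have L2: "expect (\<lambda>E. (?L E)\<^sup>2) = s\<^sup>2" by (simp only: linear_variance_eq s)
  have cross: "expect (\<lambda>E. (?D E - ?L E)\<^sup>2) = v\<^sup>2 + s\<^sup>2 - 2 * expect (\<lambda>E. ?D E * ?L E)"
  proof -
    have "expect (\<lambda>E. (?D E - ?L E)\<^sup>2) = expect (\<lambda>E. (?D E)\<^sup>2 + (?L E)\<^sup>2 - 2 * (?D E * ?L E))"
      by (simp only: power2_diff mult.assoc)
    also have "\<dots> = v\<^sup>2 + s\<^sup>2 - 2 * expect (\<lambda>E. ?D E * ?L E)"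
      by (simp only: expect_diff expect_add D2 L2 expect_cmult)
    finally show ?thesis .
  qed
  have "expect (\<lambda>E. (?X E - ?Z E)\<^sup>2) = expect (\<lambda>E. (1 / v\<^sup>2) * (?D E)\<^sup>2 + (1 / s\<^sup>2) * (?L E)\<^sup>2 - (2 / (v * s)) * (?D E * ?L E))"
    unfolding X by (intro arg_cong[of _ _ expect] ext) (simp add: power2_diff power_divide)
  also have "\<dots> = (1 / v\<^sup>2) * v\<^sup>2 + (1 / s\<^sup>2) * s\<^sup>2 - (2 / (v * s)) * expect (\<lambda>E. ?D E * ?L E)"
    by (simp only: expect_diff expect_add expect_cmult D2 L2)
  \<comment> \<open>With the mixed moment m this is 2 - 2 m / (v s) = (v^2 + s^2 - 2 m - (v - s)^2)
    / (v s). The difference of the two normalisations thus enters with a favourable sign.\<close>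
  also have "\<dots> = (expect (\<lambda>E. (?D E - ?L E)\<^sup>2) - (v - s)\<^sup>2) / (v * s)"
    unfolding cross using s(1) v(1) by (simp add: field_simps power2_diff)
  also have "\<dots> \<le> ?R / (v * s)"
  proof (rule divide_right_mono)
    have "x - (v - s)\<^sup>2 \<le> x" for x by simp
    thus "expect (\<lambda>E. (?D E - ?L E)\<^sup>2) - (v - s)\<^sup>2 \<le> ?R"
      by (rule order_trans) (rule expect_square_projection_error)
  qed (use s(1) v(1) in simp)
  also have "\<dots> \<le> 2 * ?R / linear_variance"
  proof -
    have R0: "0 \<le> ?R" unfolding projection_error_def using q_pos by simp
    have "linear_variance \<le> 2 * (v * s)"
      unfolding s(2)[symmetric] power2_eq_square using mult_right_mono[OF sv, of s] s(1) by simp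
    hence "?R * linear_variance \<le> ?R * (2 * (v * s))" using R0 by (intro mult_left_mono)
    thus ?thesis using s(1) v(1) pos by (simp add: field_simps)
  qed
  finally have XZ: "expect (\<lambda>E. (?X E - ?Z E)\<^sup>2) \<le> 2 * ?R / linear_variance" .
  have abs: "expect (\<lambda>E. \<bar>?X E - ?Z E\<bar>) \<le> sqrt (2 * ?R / linear_variance)"
  proof (rule real_le_rsqrt)
    show "(expect (\<lambda>E. \<bar>?X E - ?Z E\<bar>))\<^sup>2 \<le> 2 * ?R / linear_variance"
    proof (rule order_trans[OF expect_power2_le])
      show "expect (\<lambda>E. \<bar>?X E - ?Z E\<bar>\<^sup>2) \<le> 2 * ?R / linear_variance" unfolding power2_abs by (rule XZ)
    qed
  qed
  have lip: "norm (iexp x - iexp y) \<le> \<bar>x - y\<bar>" for x y :: real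
  proof -
    have "iexp x - iexp y = iexp y * (iexp (x - y) - 1)"
      by (simp add: right_diff_distrib exp_add[symmetric])
    hence "norm (iexp x - iexp y) = norm (iexp (x - y) - 1)" by (simp add: norm_mult)
    also have "\<dots> \<le> \<bar>x - y\<bar>" using iexp_approx1[of "x - y" 0] by simp
    finally show ?thesis .
  qed
  have "norm (cexpect (\<lambda>E. iexp (t * ?X E)) - cexpect (\<lambda>E. iexp (t * ?Z E)))
      = norm (cexpect (\<lambda>E. iexp (t * ?X E) - iexp (t * ?Z E)))"
    by (subst Bochner_Integration.integral_diff) (rule integrable_random_graph refl)+
  also have "\<dots> \<le> expect (\<lambda>E. norm (iexp (t * ?X E) - iexp (t * ?Z E)))"
    by (rule integral_norm_bound)
  also have "\<dots> \<le> expect (\<lambda>E. \<bar>t\<bar> * \<bar>?X E - ?Z E\<bar>)"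
  proof (rule expect_mono)
    fix E
    show "norm (iexp (t * ?X E) - iexp (t * ?Z E)) \<le> \<bar>t\<bar> * \<bar>?X E - ?Z E\<bar>"
      using lip[of "t * ?X E" "t * ?Z E"] by (simp only: right_diff_distrib[symmetric] abs_mult)
  qed
  also have "\<dots> = \<bar>t\<bar> * expect (\<lambda>E. \<bar>?X E - ?Z E\<bar>)" by (rule expect_cmult)
  also have "\<dots> \<le> \<bar>t\<bar> * sqrt (2 * ?R / linear_variance)" using abs by (rule mult_left_mono) simp
  finally show ?thesis unfolding s_def .
qed

end


section \<open>Asymptotics\<close>

lemma same_orderI:
  assumes "0 < c" and lower: "\<forall>\<^sub>F n in sequentially. c * b n \<le> a n" and upper: "\<forall>\<^sub>F n in sequentially. a n \<le> C * b n"
    and pos: "\<forall>\<^sub>F n in sequentially. 0 < b n"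
  shows "same_order a b"
proof -
  have ratio: "\<forall>\<^sub>F n in sequentially. c \<le> \<bar>a n / b n\<bar> \<and> \<bar>a n / b n\<bar> \<le> C"
    using lower upper pos
  proof eventually_elim
    case (elim n)
    hence "c \<le> a n / b n" "a n / b n \<le> C" by (simp_all add: field_simps)
    moreover from this have "\<bar>a n / b n\<bar> = a n / b n" using \<open>0 < c\<close> by (intro abs_of_nonneg) linarith
    ultimately show ?case by (simp only:)
  qed
  have "ereal c \<le> liminf (\<lambda>n. ereal \<bar>a n / b n\<bar>)"
    by (rule Liminf_bounded) (use ratio in \<open>auto elim: eventually_mono\<close>)
  moreover have "limsup (\<lambda>n. ereal \<bar>a n / b n\<bar>) \<le> ereal C"
    by (rule Limsup_bounded) (use ratio in \<open>auto elim: eventually_mono\<close>)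
  ultimately show ?thesis
    unfolding same_order_def using \<open>0 < c\<close> less_le_trans[of 0 "ereal c"] le_less_trans[of _ "ereal C" \<infinity>] by simp
qed

lemma much_greater_imp_at_top:
  assumes "\<forall>n\<ge>1. 0 < p n" "much_greater p (\<lambda>n. 1 / real n ^ 2)"
  shows "filterlim (\<lambda>n. real n ^ 2 * p n) at_top sequentially"
  unfolding filterlim_at_top
proof
  fix Z :: real
  have "ereal Z < liminf (\<lambda>n. ereal \<bar>p n / (1 / real n ^ 2)\<bar>)"
    using assms(2) unfolding much_greater_def by simp
  hence "\<forall>\<^sub>F n in sequentially. ereal Z < ereal \<bar>p n / (1 / real n ^ 2)\<bar>" by (rule less_LiminfD)
  thus "\<forall>\<^sub>F n in sequentially. Z \<le> real n ^ 2 * p n"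
    using eventually_ge_at_top[of 1]
  proof eventually_elim
    case (elim n)
    have "0 < p n" using assms(1) elim(2) by blast
    hence "\<bar>p n / (1 / real n ^ 2)\<bar> = real n ^ 2 * p n" by (simp add: abs_mult)
    thus ?case using elim(1) by simp
  qed
qed

lemma limsup_less_1_bound:
  assumes "limsup (\<lambda>n. ereal (p n)) < 1"
  shows "\<exists>\<delta>>0. \<forall>\<^sub>F n in sequentially. p n \<le> 1 - \<delta>"
proof -
  obtain z where z: "limsup (\<lambda>n. ereal (p n)) < ereal z" "ereal z < 1"
    using assms ereal_dense2 by blast
  have "\<forall>\<^sub>F n in sequentially. ereal (p n) < ereal z" using z(1) by (rule Limsup_lessD)
  hence "\<forall>\<^sub>F n in sequentially. p n \<le> 1 - (1 - z)" by (auto elim: eventually_mono)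
  moreover have "0 < 1 - z" using z(2) by simp
  ultimately show ?thesis by blast
qed

text \<open>Otherwise dependent choice yields a strictly increasing sequence of indices along which
  the distance to \<open>x\<close> is below 1 / (k + 1).\<close>

lemma not_accumulation_point_bound:
  assumes "\<not> accumulation_point p x"
  shows "\<exists>\<epsilon>>0. \<forall>\<^sub>F n in sequentially. \<epsilon> \<le> \<bar>p n - x\<bar>"
proof (rule ccontr)
  assume "\<not> ?thesis"
  hence close: "\<exists>m>n. \<bar>p m - x\<bar> < \<epsilon>" if "0 < \<epsilon>" for n and \<epsilon> :: real
    using that unfolding eventually_at_top_dense not_all not_ex not_imp by (meson not_less)
  have "\<exists>r. \<forall>k. \<bar>p (r k) - x\<bar> < 1 / real (Suc k) \<and> r k < r (Suc k)"
  proof (rule dependent_nat_choice)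
    show "\<exists>m. \<bar>p m - x\<bar> < 1 / real (Suc 0)" using close[of 1 0] by auto
    fix m k
    show "\<exists>m'. \<bar>p m' - x\<bar> < 1 / real (Suc (Suc k)) \<and> m < m'"
      using close[of "1 / real (Suc (Suc k))" m] by auto
  qed
  then obtain r where r: "\<And>k. \<bar>p (r k) - x\<bar> < 1 / real (Suc k)" "\<And>k. r k < r (Suc k)" by blast
  have "strict_mono r" using r(2) by (simp add: strict_mono_Suc_iff)
  moreover have "(\<lambda>k. p (r k) - x) \<longlonglongrightarrow> 0"
  proof (rule Lim_null_comparison)
    show "\<forall>\<^sub>F k in sequentially. norm (p (r k) - x) \<le> 1 / real (Suc k)"
      using r(1) by (intro always_eventually) (simp add: less_imp_le)
    show "(\<lambda>k. 1 / real (Suc k)) \<longlonglongrightarrow> 0" by (rule LIMSEQ_Suc) (rule lim_1_over_n)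
  qed
  hence "(p \<circ> r) \<longlonglongrightarrow> x" unfolding o_def by (rule LIM_zero_cancel)
  ultimately show False using assms unfolding accumulation_point_def by blast
qed

lemma char_distr_measure_pmf:
  "char (distr (measure_pmf M) borel X) t = measure_pmf.expectation M (\<lambda>x. iexp (t * X x))"
  unfolding char_def by (rule integral_distr) simp_all

section \<open>Error bounds for large n\<close>

context edge_count_model
begin

text \<open>\<open>6 \<le> n\<close> gives n - 3 \<ge> n / 2, so every factor in the counts is at
  least half of n.\<close>

lemma large_n_bounds:
  assumes "6 \<le> n"
  shows "real n ^ 4 / 8 \<le> real (card (inj4 n))" "real n ^ 2 / 4 \<le> real (card arcs)"
    "real n ^ 2 / 4 \<le> real ((n - 2) * (n - 3))" "real ((n - 2) * (n - 3)) \<le> real n ^ 2"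
proof -
  have h: "real n / 2 \<le> real (n - 1)" "real n / 2 \<le> real (n - 2)" "real n / 2 \<le> real (n - 3)"
    using assms by (simp_all add: of_nat_diff)
  have "real n / 2 * (real n / 2) \<le> real (n - 2) * real (n - 3)" using h by (intro mult_mono) auto
  thus d: "real n ^ 2 / 4 \<le> real ((n - 2) * (n - 3))" by (simp add: power2_eq_square)
  have "real n * (real n / 2) * (real n ^ 2 / 4) \<le> real n * real (n - 1) * real ((n - 2) * (n - 3))"
    using h d by (intro mult_mono) auto
  thus "real n ^ 4 / 8 \<le> real (card (inj4 n))"
    unfolding card_inj4 of_nat_mult by (simp add: power2_eq_square power4_eq_xxxx)
  have "real (n - 2) * real (n - 3) \<le> real n * real n" by (intro mult_mono) auto
  thus "real ((n - 2) * (n - 3)) \<le> real n ^ 2" by (simp add: power2_eq_square)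
  have "real (card arcs) = real (n * (n - 1) div 2)" by (simp add: arcs_def card_all_arcs choose_two)
  also have "\<dots> = real n * real (n - 1) / 2" by (subst real_of_nat_div) auto
  also have "\<dots> \<ge> real n * (real n / 2) / 2" using h by (intro divide_right_mono mult_left_mono) auto
  finally show "real n ^ 2 / 4 \<le> real (card arcs)" by (simp add: power2_eq_square)
qed

text \<open>\<open>\<eta>\<close> keeps the slope and \<open>\<delta>\<close> the variance of a
  single arc from degenerating. The lower constant 1/4 is 16 * (1/4)^2 * 1/4.\<close>

lemma linear_variance_bounds:
  assumes n: "6 \<le> n" and \<delta>: "0 < \<delta>" "q \<le> 1 - \<delta>" and \<eta>: "0 < \<eta>" "\<eta> \<le> \<bar>1 - 2 * \<gamma> * q\<^sup>2\<bar>"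
  shows "\<eta>\<^sup>2 * \<delta> / 4 * (real n ^ 6 * q ^ 3) \<le> linear_variance" "linear_variance \<le> 16 * (real n ^ 6 * q ^ 3)"
proof -
  let ?D = "real ((n - 2) * (n - 3))" and ?w = "(1 - 2 * \<gamma> * q\<^sup>2)\<^sup>2"
  note b = large_n_bounds[OF n]
  have eq: "linear_variance = 16 * ?D\<^sup>2 * ?w * real (card arcs) * (1 - q) * q ^ 3"
    unfolding linear_variance_def slope_def by (simp add: power2_eq_square power3_eq_cube mult_ac)
  have w: "\<eta>\<^sup>2 \<le> ?w" using power_mono[OF \<eta>(2), of 2] \<eta>(1) by simp
  have "\<gamma> * q\<^sup>2 \<le> 1 * 1" using \<gamma> q_pos q_lt_1 by (intro mult_mono) (auto simp: power_le_one)
  moreover have "0 \<le> \<gamma> * q\<^sup>2" using \<gamma> by simp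
  ultimately have "\<bar>1 - 2 * \<gamma> * q\<^sup>2\<bar> \<le> 1" by simp
  hence w1: "?w \<le> 1" by (simp add: abs_square_le_1)
  have D2: "(real n ^ 2 / 4)\<^sup>2 \<le> ?D\<^sup>2" "?D\<^sup>2 \<le> (real n ^ 2)\<^sup>2" using b by (intro power_mono; simp)+
  have "\<eta>\<^sup>2 * \<delta> / 4 * (real n ^ 6 * q ^ 3) = 16 * (real n ^ 2 / 4)\<^sup>2 * \<eta>\<^sup>2 * (real n ^ 2 / 4) * \<delta> * q ^ 3"
    by (simp add: power_divide power_mult[symmetric])
  also have "\<dots> \<le> linear_variance"
    unfolding eq using D2 w b \<delta> q_pos by (intro mult_mono) auto
  finally show "\<eta>\<^sup>2 * \<delta> / 4 * (real n ^ 6 * q ^ 3) \<le> linear_variance" .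
  have "linear_variance \<le> 16 * (real n ^ 2)\<^sup>2 * 1 * real n ^ 2 * 1 * q ^ 3"
    unfolding eq using D2 w1 card_arcs_le q_pos q_lt_1 by (intro mult_mono) auto
  also have "\<dots> = 16 * (real n ^ 6 * q ^ 3)" by (simp add: power_mult[symmetric] power_add[symmetric])
  finally show "linear_variance \<le> 16 * (real n ^ 6 * q ^ 3)" .
qed

lemma char_K_normal_approx:
  assumes r: "4 * (projection_error * (real n ^ 6 * q ^ 3)) \<le> linear_variance" and pos: "0 < linear_variance"
    and t: "t\<^sup>2 \<le> 4 * real (card arcs)"
  shows "norm (char (distr G borel (\<lambda>E. (K E - expect K) / sqrt variance_K)) t
      - of_real ((1 + (- t\<^sup>2 / 2) / real (card arcs)) ^ card arcs))
    \<le> \<bar>t\<bar> * sqrt (2 * (projection_error * (real n ^ 6 * q ^ 3)) / linear_variance)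
      + \<bar>t\<bar> ^ 3 / (6 * sqrt (real (card arcs) * (q * (1 - q))))"
proof -
  \<comment> \<open>The slope is negative when 2 \<gamma> q^2 exceeds 1. Its sign is moved into
    \<open>t\<close>, of which the comparison sequence and the error see only the square and the
    absolute value.\<close>
  let ?\<sigma> = "sqrt (real (card arcs) * (q * (1 - q)))" and ?t = "sgn slope * t"
  let ?A = "cexpect (\<lambda>E. iexp (t * ((K E - expect K) / sqrt variance_K)))"
  let ?B = "cexpect (\<lambda>E. iexp (t * (slope * arc_sum E / sqrt linear_variance)))"
  let ?w = "of_real ((1 + (- t\<^sup>2 / 2) / real (card arcs)) ^ card arcs) :: complex"
  have "slope \<noteq> 0" by (rule notI) (use pos in \<open>simp add: linear_variance_def\<close>)
  have "card arcs \<noteq> 0" by (rule notI) (use pos in \<open>simp add: linear_variance_def\<close>)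
  have s: "?t\<^sup>2 = t\<^sup>2" "\<bar>?t\<bar> = \<bar>t\<bar>" using \<open>slope \<noteq> 0\<close> by (auto simp: power_mult_distrib abs_mult sgn_if)
  have "sqrt linear_variance = \<bar>slope\<bar> * ?\<sigma>"
    by (simp add: linear_variance_def real_sqrt_mult)
  hence "t * (slope * x / sqrt linear_variance) = ?t / ?\<sigma> * x" for x
    using \<open>slope \<noteq> 0\<close> by (simp add: sgn_if)
  hence B: "?B = cexpect (\<lambda>E. iexp (?t / ?\<sigma> * arc_sum E))" by simp
  have "0 < card arcs" using \<open>card arcs \<noteq> 0\<close> by simp
  from char_arc_sum_approx[OF q_pos q_lt_1 this, of ?t] t
  have 2: "norm (?B - ?w) \<le> \<bar>t\<bar> ^ 3 / (6 * ?\<sigma>)" unfolding B s by simp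
  have 1: "norm (?A - ?B) \<le> \<bar>t\<bar> * sqrt (2 * (projection_error * (real n ^ 6 * q ^ 3)) / linear_variance)"
    by (rule char_K_approx[OF r pos])
  have "norm (?A - ?w) \<le> norm (?A - ?B) + norm (?B - ?w)"
    using norm_triangle_ineq[of "?A - ?B" "?B - ?w"] by simp
  thus ?thesis unfolding char_distr_measure_pmf using 1 2 by linarith
qed

end

lemma projection_error_tendsto_0:
  assumes a: "filterlim (\<lambda>n. real n ^ 2 * p n) at_top sequentially" and p: "\<forall>n\<ge>1. 0 < p n \<and> p n < 1"
  shows "(\<lambda>n. random_graph_model.projection_error n (p n)) \<longlonglongrightarrow> 0"
proof -
  have inv: "(\<lambda>n. c / f n) \<longlonglongrightarrow> 0" if "filterlim f at_top sequentially" for c and f :: "nat \<Rightarrow> real"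
    by (rule tendsto_divide_0[OF tendsto_const filterlim_at_top_imp_at_infinity[OF that]])
  have sq: "filterlim (\<lambda>n. (real n ^ 2 * p n)\<^sup>2) at_top sequentially"
    by (rule filterlim_pow_at_top[OF _ a]) simp
  have rt: "filterlim (\<lambda>n. sqrt (real n)) at_top sequentially"
    by (rule filterlim_compose[OF sqrt_at_top filterlim_real_sequentially])
  have "(\<lambda>n. 8 * (1280 / (real n ^ 2 * p n) + 4096 / real n + 32 / (real n ^ 2 * p n)\<^sup>2 + 4 / sqrt (real n))) \<longlonglongrightarrow> 8 * (0 + 0 + 0 + 0)"
    by (intro tendsto_mult tendsto_add tendsto_const inv a sq rt filterlim_real_sequentially)
  moreover have "\<forall>\<^sub>F n in sequentially. 8 * (1280 / (real n ^ 2 * p n) + 4096 / real n + 32 / (real n ^ 2 * p n)\<^sup>2 + 4 / sqrt (real n))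
      = random_graph_model.projection_error n (p n)"
    using eventually_ge_at_top[of 1]
  proof eventually_elim
    case (elim n)
    then interpret random_graph_model n "p n" using p by unfold_locales (auto simp: less_imp_le)
    show ?case by (simp only: projection_error_def)
  qed
  ultimately show ?thesis using tendsto_cong by force
qed

lemma edge_count_asymptotics:
  fixes p :: "nat \<Rightarrow> real" and K :: "nat \<Rightarrow> nat set set \<Rightarrow> real" and \<gamma> \<kappa> \<delta> \<eta> :: real
  defines "\<mu> \<equiv> (\<lambda>n. measure_pmf.expectation (random_graph n (p n)) (K n))"
    and "\<V> \<equiv> (\<lambda>n. measure_pmf.variance (random_graph n (p n)) (K n))"
  assumes p: "\<forall>n\<ge>1. 0 < p n \<and> p n < 1" and a: "filterlim (\<lambda>n. real n ^ 2 * p n) at_top sequentially"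
    and \<delta>: "0 < \<delta>" "\<forall>\<^sub>F n in sequentially. p n \<le> 1 - \<delta>"
    and \<eta>: "0 < \<eta>" "\<forall>\<^sub>F n in sequentially. \<eta> \<le> \<bar>1 - 2 * \<gamma> * (p n)\<^sup>2\<bar>"
    and \<gamma>: "0 \<le> \<gamma>" "\<gamma> \<le> 1" and \<kappa>: "0 \<le> \<kappa>" "\<kappa> \<le> 1"
    and K: "\<And>n E. 1 \<le> n \<Longrightarrow> E \<subseteq> all_arcs {1..n} \<Longrightarrow>
      \<exists>u. 2 * K n E = main_count \<gamma> \<kappa> E + 2 * u
        \<and> small_correction n E u"
  shows "same_order \<mu> (\<lambda>n. real n ^ 4 * p n ^ 2)
       \<and> same_order \<V> (\<lambda>n. real n ^ 6 * p n ^ 3)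
       \<and> weak_conv_m
            (\<lambda>n. distr (measure_pmf (random_graph n (p n))) borel
                   (\<lambda>E. (K n E - \<mu> n) / sqrt (\<V> n)))
            std_normal_distribution"
proof -
  \<comment> \<open>Solving for the correction avoids choosing a witness for every graph; by
    \<open>K\<close> it agrees with any such witness.\<close>
  define U where "U n E = (2 * K n E - main_count \<gamma> \<kappa> E) / 2" for n E
  have model: "edge_count_model n (p n) (K n) (U n) \<gamma> \<kappa>" if n: "1 \<le> n" for n
  proof -
    interpret random_graph_model n "p n" using p n by unfold_locales (auto simp: less_imp_le)
    show ?thesis
    proof unfold_locales
      fix E assume E: "E \<subseteq> arcs"
      show "2 * K n E = main_count \<gamma> \<kappa> E + 2 * U n E" by (simp add: U_def field_simps)
      obtain u where u: "2 * K n E = main_count \<gamma> \<kappa> E + 2 * u"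
        "small_correction n E u"
        using K[OF n E[unfolded arcs_def]] by blast
      have "U n E = u" unfolding U_def u(1) by simp
      thus "small_correction n E (U n E)" using u by simp
    qed (use p n \<gamma> \<kappa> in auto)
  qed
  define c where "c = \<eta>\<^sup>2 * \<delta> / 4"
  have c: "0 < c" unfolding c_def using \<delta> \<eta> by simp
  let ?M = "\<lambda>n. real n ^ 6 * p n ^ 3"
  let ?LV = "\<lambda>n. edge_count_model.linear_variance n (p n) \<gamma>"
  let ?\<rho> = "\<lambda>n. random_graph_model.projection_error n (p n)"
  let ?N = "\<lambda>n. card (random_graph_model.arcs n)"
  have \<rho>: "?\<rho> \<longlonglongrightarrow> 0" by (rule projection_error_tendsto_0[OF a p])
  have M_pos: "\<forall>\<^sub>F n in sequentially. 0 < ?M n"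
    using eventually_ge_at_top[of 1] by eventually_elim (use p in simp)
  have V: "\<V> n = edge_count_model.variance_K n (p n) (K n)" if "1 \<le> n" for n
    unfolding \<V>_def edge_count_model.variance_K_def[OF model[OF that]] ..
  have ev: "\<forall>\<^sub>F n in sequentially. 6 \<le> n \<and> p n \<le> 1 - \<delta> \<and> \<eta> \<le> \<bar>1 - 2 * \<gamma> * (p n)\<^sup>2\<bar> \<and> 1 \<le> real n ^ 2 * p n"
    using eventually_ge_at_top[of 6] \<delta>(2) \<eta>(2) filterlim_at_top_dense[THEN iffD1, OF a, rule_format, of 1]
    by eventually_elim auto
  have lin: "\<forall>\<^sub>F n in sequentially. c * ?M n \<le> ?LV n \<and> ?LV n \<le> 16 * ?M n"
    using ev
  proof eventually_elim
    case (elim n)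
    then interpret edge_count_model n "p n" "K n" "U n" \<gamma> \<kappa> by (intro model) simp
    show ?case unfolding c_def using linear_variance_bounds[of \<delta> \<eta>] elim \<delta>(1) \<eta>(1) by blast
  qed
  have "\<forall>\<^sub>F n in sequentially. ?\<rho> n < c / 4" using order_tendstoD(2)[OF \<rho>, of "c / 4"] c by simp
  \<comment> \<open>The remainder falls below a quarter of the linear variance, as
    \<open>variance_K_bounds\<close> and \<open>char_K_approx\<close> demand.\<close>
  hence small: "\<forall>\<^sub>F n in sequentially. 4 * (?\<rho> n * ?M n) \<le> ?LV n"
    using lin M_pos
  proof eventually_elim
    case (elim n)
    have "4 * ?\<rho> n * ?M n \<le> c * ?M n" using elim by (intro mult_right_mono) auto
    thus ?case using elim by simp
  qed
  have mean: "same_order \<mu> (\<lambda>n. real n ^ 4 * p n ^ 2)"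
  proof (rule same_orderI)
    show "0 < \<delta> / 16" using \<delta> by simp
    show "\<forall>\<^sub>F n in sequentially. \<delta> / 16 * (real n ^ 4 * p n ^ 2) \<le> \<mu> n"
      using ev
    proof eventually_elim
      case (elim n)
      then interpret edge_count_model n "p n" "K n" "U n" \<gamma> \<kappa> by (intro model) simp
      have "real n ^ 4 / 8 * (p n)\<^sup>2 * \<delta> \<le> real (card (inj4 n)) * (p n)\<^sup>2 * (1 - p n)"
        using elim large_n_bounds(1) \<delta>(1) by (intro mult_mono) auto
      also have "\<dots> \<le> 2 * \<mu> n" unfolding \<mu>_def by (rule expect_K_bounds)
      finally show ?case by (simp add: mult_ac)
    qed
    show "\<forall>\<^sub>F n in sequentially. \<mu> n \<le> 9 * (real n ^ 4 * p n ^ 2)"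
      using ev
    proof eventually_elim
      case (elim n)
      then interpret edge_count_model n "p n" "K n" "U n" \<gamma> \<kappa> by (intro model) simp
      \<comment> \<open>Eventually n^2 p is at least 1, so the bracket in
        \<open>expect_K_bounds\<close> is at most 1 + 4 + 4 = 9.\<close>
      have "4 / real n \<le> 4" "4 / (real n ^ 2 * p n) \<le> 4" using elim q_pos by (simp_all add: field_simps)
      hence "real n ^ 4 * (p n)\<^sup>2 * (1 + 4 / real n + 4 / (real n ^ 2 * p n)) \<le> real n ^ 4 * (p n)\<^sup>2 * 9"
        by (intro mult_left_mono) auto
      hence "2 * \<mu> n \<le> real n ^ 4 * (p n)\<^sup>2 * 9" unfolding \<mu>_def using expect_K_bounds(2) by linarith
      moreover have "0 \<le> real n ^ 4 * (p n)\<^sup>2" by simp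
      ultimately show ?case by linarith
    qed
    show "\<forall>\<^sub>F n in sequentially. 0 < real n ^ 4 * p n ^ 2"
      using eventually_ge_at_top[of 1]
    proof eventually_elim
      case (elim n)
      hence "0 < p n" using p by blast
      thus ?case using elim by simp
    qed
  qed
  have var: "same_order \<V> ?M"
  proof (rule same_orderI[OF _ _ _ M_pos])
    show "0 < c / 16" using c by simp
    have both: "\<forall>\<^sub>F n in sequentially. c / 16 * ?M n \<le> \<V> n \<and> \<V> n \<le> 12 * ?M n"
      using ev lin small
    proof eventually_elim
      case (elim n)
      then interpret edge_count_model n "p n" "K n" "U n" \<gamma> \<kappa> by (intro model) simp
      have "\<V> n = variance_K" using V elim by simp
      moreover have "linear_variance \<le> 16 * variance_K" "4 * variance_K \<le> 3 * linear_variance"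
        using variance_K_bounds elim by blast+
      ultimately show ?case using elim(2) by simp
    qed
    show "\<forall>\<^sub>F n in sequentially. c / 16 * ?M n \<le> \<V> n" "\<forall>\<^sub>F n in sequentially. \<V> n \<le> 12 * ?M n"
      using both by (auto elim: eventually_mono)
  qed
  let ?X = "\<lambda>n E. (K n E - \<mu> n) / sqrt (\<V> n)"
  have clt: "weak_conv_m (\<lambda>n. distr (measure_pmf (random_graph n (p n))) borel (?X n)) std_normal_distribution"
  proof (rule levy_continuity)
    show "real_distribution (distr (measure_pmf (random_graph n (p n))) borel (?X n))" for n
      by (rule prob_space.real_distribution_distr) (simp_all add: measure_pmf.prob_space_axioms)
    show "real_distribution std_normal_distribution" by (rule real_dist_normal_dist)
    fix t :: real
    \<comment> \<open>The intermediate sequence: it tends to exp (- t^2 / 2) because the number of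
      possible arcs tends to infinity.\<close>
    let ?w = "\<lambda>n. (1 + (- t\<^sup>2 / 2) / real (?N n)) ^ ?N n"
    let ?\<phi> = "\<lambda>n. char (distr (measure_pmf (random_graph n (p n))) borel (?X n)) t"
    have N_ge: "\<forall>\<^sub>F n in sequentially. real n ^ 2 / 4 \<le> real (?N n)"
      using ev
    proof eventually_elim
      case (elim n)
      then interpret edge_count_model n "p n" "K n" "U n" \<gamma> \<kappa> by (intro model) simp
      show ?case using large_n_bounds(2) elim by blast
    qed
    have "filterlim (\<lambda>n. real n ^ 2 / 4) at_top sequentially"
      using filterlim_at_top_mult_tendsto_pos[OF tendsto_const, of "1/4", OF _ filterlim_pow_at_top[OF _ filterlim_real_sequentially, of 2]]
      by simp
    hence N_real: "filterlim (\<lambda>n. real (?N n)) at_top sequentially"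
      by (rule filterlim_at_top_mono[OF _ N_ge])
    hence N_top: "filterlim ?N sequentially sequentially"
      unfolding filterlim_sequentially_iff_filterlim_real .
    have "(\<lambda>n. ?w n) \<longlonglongrightarrow> exp (- t\<^sup>2 / 2)"
      using filterlim_compose[OF tendsto_exp_limit_sequentially N_top, of "- t\<^sup>2 / 2"] by simp
    hence w: "(\<lambda>n. complex_of_real (?w n)) \<longlonglongrightarrow> complex_of_real (exp (- t\<^sup>2 / 2))"
      by (rule tendsto_of_real)
    have "(\<lambda>n. ?\<phi> n - complex_of_real (?w n)) \<longlonglongrightarrow> 0"
    \<comment> \<open>For fixed \<open>t\<close> the number of arcs eventually exceeds t^2 / 4, as
      \<open>char_K_normal_approx\<close> demands. Of the two error terms the first vanishes with
      the remainder, the second because n^2 p tends to infinity.\<close>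
    proof (rule Lim_null_comparison)
      have "\<forall>\<^sub>F n in sequentially. t\<^sup>2 / 4 \<le> real (?N n)"
        using N_real unfolding filterlim_at_top by blast
      thus "\<forall>\<^sub>F n in sequentially. norm (?\<phi> n - complex_of_real (?w n))
          \<le> \<bar>t\<bar> * sqrt (2 * ?\<rho> n / c) + \<bar>t\<bar> ^ 3 / 6 / sqrt (real n ^ 2 * p n * (\<delta> / 4))"
        using ev lin small M_pos N_ge
      proof eventually_elim
        case (elim n)
        then interpret edge_count_model n "p n" "K n" "U n" \<gamma> \<kappa> by (intro model) simp
        have Vn: "\<V> n = variance_K" using V elim by simp
        have "0 < c * ?M n" using c elim(5) by (rule mult_pos_pos)
        hence pos: "0 < linear_variance" using elim(3) by linarith
        have \<rho>0: "0 \<le> projection_error" unfolding projection_error_def using q_pos by simp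
        have "real n ^ 2 / 4 * (p n * \<delta>) \<le> real (card arcs) * (p n * (1 - p n))"
          using elim \<delta>(1) q_pos by (intro mult_mono) auto
        hence le: "real n ^ 2 * p n * (\<delta> / 4) \<le> real (card arcs) * (p n * (1 - p n))" by (simp add: mult_ac)
        have p0: "0 < real n ^ 2 * p n * (\<delta> / 4)" using n_pos q_pos \<delta>(1) by simp
        have p1: "0 < real (card arcs) * (p n * (1 - p n))" using p0 le by (rule less_le_trans)
        have "norm (?\<phi> n - complex_of_real (?w n)) \<le> \<bar>t\<bar> * sqrt (2 * (projection_error * ?M n) / linear_variance)
            + \<bar>t\<bar> ^ 3 / (6 * sqrt (real (card arcs) * (p n * (1 - p n))))"
          unfolding Vn \<mu>_def using elim(1) by (intro char_K_normal_approx[OF elim(4) pos]) simp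
        also have "\<dots> \<le> \<bar>t\<bar> * sqrt (2 * projection_error / c) + \<bar>t\<bar> ^ 3 / (6 * sqrt (real n ^ 2 * p n * (\<delta> / 4)))"
        proof (intro add_mono mult_left_mono divide_left_mono real_sqrt_le_mono)
          have "2 * (projection_error * ?M n) / linear_variance \<le> 2 * (projection_error * ?M n) / (c * ?M n)"
            using elim(3,5) \<open>0 < c * ?M n\<close> pos \<rho>0 by (intro divide_left_mono) auto
          also have "\<dots> = 2 * projection_error / c" using n_pos q_pos by simp
          finally show "2 * (projection_error * ?M n) / linear_variance \<le> 2 * projection_error / c" .
          show "real n ^ 2 * p n * (\<delta> / 4) \<le> real (card arcs) * (p n * (1 - p n))" by (rule le)
          show "0 < 6 * sqrt (real (card arcs) * (p n * (1 - p n))) * (6 * sqrt (real n ^ 2 * p n * (\<delta> / 4)))"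
            using p0 p1 by simp
        qed auto
        finally show ?case by simp
      qed
      have "filterlim (\<lambda>n. real n ^ 2 * p n * (\<delta> / 4)) at_top sequentially"
        by (rule filterlim_at_top_mult_tendsto_pos[OF tendsto_const _ a]) (use \<delta>(1) in simp)
      hence "filterlim (\<lambda>n. sqrt (real n ^ 2 * p n * (\<delta> / 4))) at_top sequentially"
        by (rule filterlim_compose[OF sqrt_at_top])
      hence "(\<lambda>n. \<bar>t\<bar> ^ 3 / 6 / sqrt (real n ^ 2 * p n * (\<delta> / 4))) \<longlonglongrightarrow> 0"
        by (intro tendsto_divide_0[OF tendsto_const] filterlim_at_top_imp_at_infinity)
      moreover have "(\<lambda>n. \<bar>t\<bar> * sqrt (2 * ?\<rho> n / c)) \<longlonglongrightarrow> 0"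
      proof -
        have "(\<lambda>n. \<bar>t\<bar> * sqrt (2 * ?\<rho> n / c)) \<longlonglongrightarrow> \<bar>t\<bar> * sqrt (2 * 0 / c)"
          using c by (intro tendsto_mult tendsto_const tendsto_real_sqrt tendsto_divide \<rho>) simp
        thus ?thesis by simp
      qed
      ultimately show "(\<lambda>n. \<bar>t\<bar> * sqrt (2 * ?\<rho> n / c) + \<bar>t\<bar> ^ 3 / 6 / sqrt (real n ^ 2 * p n * (\<delta> / 4))) \<longlonglongrightarrow> 0"
        by (rule tendsto_add_zero[rotated])
    qed
    from tendsto_add[OF this w] show "?\<phi> \<longlonglongrightarrow> char std_normal_distribution t"
      by (simp add: char_std_normal_distribution)
  qed
  show ?thesis using mean var clt by (intro conjI)
qed

theorem theorem1p1:
  fixes p :: "nat \<Rightarrow> real"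
    and K :: "nat \<Rightarrow> nat set set \<Rightarrow> real"
  defines "\<mu> \<equiv> (\<lambda>n. measure_pmf.expectation (random_graph n (p n)) (K n))"
    and "\<V> \<equiv> (\<lambda>n. measure_pmf.variance (random_graph n (p n)) (K n))"
  assumes p_range: "\<forall>n\<ge>1. 0 < p n \<and> p n < 1"
    and p_lower: "much_greater p (\<lambda>n. 1 / real n ^ 2)"
    and p_upper: "limsup (\<lambda>n. ereal (p n)) < 1"
    and K_cases:
      "((\<forall>n\<ge>1. \<forall>E \<subseteq> all_arcs {1..n}.
            K n E = real (card (polytope_edges (symmetric_edge_polytope E))))
          \<and> \<not> accumulation_point p (1 / sqrt 2))
       \<or> (\<forall>n\<ge>1. \<forall>E \<subseteq> all_arcs {1..n}.
            \<exists>T. unimodular_triangulation {1..n} (symmetric_edge_polytope E) T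
                \<and> K n E = real (card (triangulation_edges T)))"
  shows "same_order \<mu> (\<lambda>n. real n ^ 4 * p n ^ 2)
       \<and> same_order \<V> (\<lambda>n. real n ^ 6 * p n ^ 3)
       \<and> weak_conv_m
            (\<lambda>n. distr (measure_pmf (random_graph n (p n))) borel
                   (\<lambda>E. (K n E - \<mu> n) / sqrt (\<V> n)))
            std_normal_distribution"
proof -
  have a: "filterlim (\<lambda>n. real n ^ 2 * p n) at_top sequentially"
    using p_range p_lower by (intro much_greater_imp_at_top) auto
  obtain \<delta> where \<delta>: "0 < \<delta>" "\<forall>\<^sub>F n in sequentially. p n \<le> 1 - \<delta>"
    using limsup_less_1_bound[OF p_upper] by blast
  show ?thesis
    using K_cases
  proof (elim disjE conjE)
    assume K: "\<forall>n\<ge>1. \<forall>E \<subseteq> all_arcs {1..n}. K n E = real (card (polytope_edges (symmetric_edge_polytope E)))"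
      and acc: "\<not> accumulation_point p (1 / sqrt 2)"
    obtain \<epsilon> where \<epsilon>: "0 < \<epsilon>" "\<forall>\<^sub>F n in sequentially. \<epsilon> \<le> \<bar>p n - 1 / sqrt 2\<bar>"
      using not_accumulation_point_bound[OF acc] by blast
    have \<eta>: "\<forall>\<^sub>F n in sequentially. \<epsilon> \<le> \<bar>1 - 2 * 1 * (p n)\<^sup>2\<bar>"
      using \<epsilon>(2) eventually_ge_at_top[of 1]
    proof eventually_elim
      case (elim n)
      \<comment> \<open>1 - 2 p^2 is, up to sign, (p - 1 / sqrt 2) times 2 (p + 1 / sqrt 2), and the
        second factor is at least 1. So the distance of \<open>p\<close> from 1 / sqrt 2 bounds the
        slope factor from below.\<close>
      have "sqrt 2 \<le> 2" using real_sqrt_le_mono[of 2 4] by simp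
      hence "1 / 2 \<le> 1 / sqrt 2" by (intro divide_left_mono) auto
      moreover have "0 < p n" using p_range elim(2) by blast
      moreover have "1 \<le> 2 * (x + y)" if "1 / 2 \<le> y" "0 < x" for x y :: real using that by simp
      ultimately have "1 \<le> 2 * (p n + 1 / sqrt 2)" by blast
      hence "\<epsilon> * 1 \<le> \<bar>p n - 1 / sqrt 2\<bar> * (2 * (p n + 1 / sqrt 2))"
        using elim(1) by (intro mult_mono) auto
      also have "\<dots> = \<bar>(p n - 1 / sqrt 2) * (2 * (p n + 1 / sqrt 2))\<bar>"
        using \<open>1 \<le> 2 * (p n + 1 / sqrt 2)\<close> by (simp add: abs_mult)
      also have "(p n - 1 / sqrt 2) * (2 * (p n + 1 / sqrt 2)) = - (1 - 2 * 1 * (p n)\<^sup>2)"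
        by (simp add: field_simps power2_eq_square)
      finally show ?case by simp
    qed
    show ?thesis
      unfolding \<mu>_def \<V>_def
    proof (rule edge_count_asymptotics[where \<gamma> = 1 and \<kappa> = 0, OF p_range a \<delta> \<epsilon>(1) \<eta>])
      fix n :: nat and E assume n: "1 \<le> n" and E: "E \<subseteq> all_arcs {1..n}"
      interpret graph E "{1..n}" using E by unfold_locales simp_all
      let ?u = "real (card exposed_paths)"
      have "real (2 * card (polytope_edges (symmetric_edge_polytope E)) + card (four_cycles E))
          = real (card (arc_pairs E) + 2 * card (cherries E) + 2 * card exposed_paths)"
        unfolding card_polytope_edges ..
      hence "2 * K n E = main_count 1 0 E + 2 * ?u"
        using K n E by (simp add: main_count_def)
      moreover have "?u \<le> real (card (cherries E))" using card_exposed_paths(1) by simp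
      moreover have "?u \<le> real n ^ 2"
        using card_exposed_paths(2) by (metis card_atLeastAtMost diff_Suc_1 of_nat_le_iff of_nat_power)
      ultimately show "\<exists>u. 2 * K n E = main_count 1 0 E + 2 * u
        \<and> small_correction n E u" by (intro exI[of _ ?u]) (simp add: small_correction_def)
    qed simp_all
  next
    assume K: "\<forall>n\<ge>1. \<forall>E \<subseteq> all_arcs {1..n}. \<exists>T. unimodular_triangulation {1..n} (symmetric_edge_polytope E) T
        \<and> K n E = real (card (triangulation_edges T))"
    have \<eta>: "\<forall>\<^sub>F n in sequentially. \<delta> \<le> \<bar>1 - 2 * (1/2) * (p n)\<^sup>2\<bar>"
      using \<delta>(2) eventually_ge_at_top[of 1]
    proof eventually_elim
      case (elim n)
      \<comment> \<open>The slope factor is now 1 - p^2 \<ge> 1 - p \<ge> \<delta>, so no value of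
        \<open>p\<close> below 1 is exceptional.\<close>
      have "(p n)\<^sup>2 \<le> p n" using p_range elim(2) by (simp add: power2_eq_square mult_left_le less_imp_le)
      thus ?case using elim(1) by simp
    qed
    show ?thesis
      unfolding \<mu>_def \<V>_def
    proof (rule edge_count_asymptotics[where \<gamma> = "1/2" and \<kappa> = 1, OF p_range a \<delta> \<delta>(1) \<eta>])
      fix n :: nat and E assume n: "1 \<le> n" and E: "E \<subseteq> all_arcs {1..n}"
      interpret graph E "{1..n}" using E by unfold_locales simp_all
      let ?u = "real (card far_arrows)"
      \<comment> \<open>The triangulation may vary arbitrarily with the graph: its number of edges
        is that of \<open>pair_sums E\<close>, which depends on \<open>E\<close> alone.\<close>
      obtain T where T: "unimodular_triangulation {1..n} (symmetric_edge_polytope E) T" "K n E = real (card (triangulation_edges T))"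
        using K n E by blast
      have "2 * K n E = main_count (1/2) 1 E + 2 * ?u"
        unfolding T(2) card_triangulation_edges[OF T(1)] using card_pair_sums by (simp add: main_count_def)
      moreover have "?u \<le> real (card (cherries E))" using card_far_arrows(1) by simp
      moreover have "?u \<le> real n ^ 2"
        using card_far_arrows(2) by (metis card_atLeastAtMost diff_Suc_1 of_nat_le_iff of_nat_power)
      ultimately show "\<exists>u. 2 * K n E = main_count (1/2) 1 E + 2 * u
        \<and> small_correction n E u" by (intro exI[of _ ?u]) (simp add: small_correction_def)
    qed simp_all
  qed
qed

end
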